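(* Let $\Omega\subset\mathbb{H}$ be a domain of finite measure in the Heisenberg group such that the embedding $S^1(\Omega)\subset L_2(\Omega)$ is compact. Let $L_\Omega^D$ and $L_\Omega^N$ be the Dirichlet and Neumann sub-Laplacians on $\Omega$. Then $\lambda_{j+1}(L_\Omega^N)<\lambda_j(L_\Omega^D)$ for every $j\in\mathbb{N}=\{1,2,3,\dots\}$.
   Context: The Heisenberg group $\mathbb{H}$ is $\mathbb{R}^3$ with coordinates $(x,y,t)$ and multiplication $(x,y,t)\circ(x',y',t')=(x+x',y+y',t+t'-2(xy'-yx'))$. A domain is a non-empty open connected set. Measure means Lebesgue measure on $\mathbb{R}^3$ (which is the Haar measure of $\mathbb{H}$), and $L_2(\Omega)$ is the space of complex-valued square-integrable functions with respect to it, with norm $\|\cdot\|$. The left-invariant vector fields are $$X=\frac{\partial}{\partial x}+2y\frac{\partial}{\partial t},\qquad Y=\frac{\partial}{\partial y}-2x\frac{\partial}{\partial t}.$$ $S^1(\Omega)$ is the space of all $u\in L_2(\Omega)$ whose distributional derivatives $Xu$ and $Yu$ belong to $L_2(\Omega)$, with norm $(\|Xu\|^2+\|Yu\|^2+\|u\|^2)^{1/2}$. $\mathring{S}^1(\Omega)$ is the closure of $C_0^\infty(\Omega)$ in $S^1(\Omega)$. The Dirichlet sub-Laplacian $L_\Omega^D$ and the Neumann sub-Laplacian $L_\Omega^N$ are the self-adjoint operators in $L_2(\Omega)$ associated with the quadratic form $\|Xu\|^2+\|Yu\|^2=\int_\Omega(|Xu|^2+|Yu|^2)\,dx\,dy\,dt$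 with form domain $\mathring{S}^1(\Omega)$ and $S^1(\Omega)$, respectively. For a lower semi-bounded self-adjoint operator $A$ with purely discrete spectrum, $\lambda_j(A)$, $j\in\mathbb{N}$, denotes its $j$-th eigenvalue in non-decreasing order, counting multiplicities. Under the compactness assumption both operators have purely discrete spectrum. *)

theory Defs
  imports "HOL-Analysis.Analysis"
begin

section \<open>The Heisenberg group and its left-invariant vector fields\<close>

type_synonym heis = "real \<times> real \<times> real"

fun heis_mult :: "heis \<Rightarrow> heis \<Rightarrow> heis" where
  "heis_mult (x, y, t) (x', y', t') = (x + x', y + y', t + t' - 2 * (x * y' - y * x'))"

text \<open>A vector field is represented by its coefficient vector at each point, so that it acts on a
  function as the directional derivative along that vector.\<close>

fun field_X :: "heis \<Rightarrow> heis" where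
  "field_X (x, y, t) = (1, 0, 2 * y)"

fun field_Y :: "heis \<Rightarrow> heis" where
  "field_Y (x, y, t) = (0, 1, - 2 * x)"

text \<open>The two fields generate right translation by the one-parameter groups of the first two
  coordinate directions; this is their left invariance.\<close>

lemma heis_mult_field_X: "heis_mult p (s, 0, 0) = p + s *\<^sub>R field_X p"
  by (cases p) (simp add: algebra_simps)

lemma heis_mult_field_Y: "heis_mult p (0, s, 0) = p + s *\<^sub>R field_Y p"
  by (cases p) (simp add: algebra_simps)

definition domain :: "heis set \<Rightarrow> bool" where
  "domain \<Omega> \<longleftrightarrow> \<Omega> \<noteq> {} \<and> open \<Omega> \<and> connected \<Omega>"


section \<open>Square-integrable functions\<close>

text \<open>Elements of $L_2(\Omega)$ are represented by functions on the whole space whose values outside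
  $\Omega$ are irrelevant; equality in $L_2(\Omega)$ is equality almost everywhere on $\Omega$.\<close>

definition L2 :: "heis set \<Rightarrow> (heis \<Rightarrow> complex) set" where
  "L2 \<Omega> = {u. u \<in> borel_measurable (lebesgue_on \<Omega>) \<and>
               integrable (lebesgue_on \<Omega>) (\<lambda>p. (cmod (u p))\<^sup>2)}"

definition L2_inner :: "heis set \<Rightarrow> (heis \<Rightarrow> complex) \<Rightarrow> (heis \<Rightarrow> complex) \<Rightarrow> complex" where
  "L2_inner \<Omega> u v = (LINT p|lebesgue_on \<Omega>. u p * cnj (v p))"

definition L2_norm :: "heis set \<Rightarrow> (heis \<Rightarrow> complex) \<Rightarrow> real" where
  "L2_norm \<Omega> u = sqrt (LINT p|lebesgue_on \<Omega>. (cmod (u p))\<^sup>2)"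

text \<open>A finite family that is a basis, modulo almost everywhere equality, of a subspace.\<close>

definition L2_basis ::
  "heis set \<Rightarrow> (heis \<Rightarrow> complex) set \<Rightarrow> nat \<Rightarrow> (nat \<Rightarrow> heis \<Rightarrow> complex) \<Rightarrow> bool" where
  "L2_basis \<Omega> E n e \<longleftrightarrow>
     (\<forall>i<n. e i \<in> E) \<and>
     (\<forall>c :: nat \<Rightarrow> complex.
        (AE p in lebesgue_on \<Omega>. (\<Sum>i<n. c i * e i p) = 0) \<longrightarrow> (\<forall>i<n. c i = 0)) \<and>
     (\<forall>u\<in>E. \<exists>c :: nat \<Rightarrow> complex. AE p in lebesgue_on \<Omega>. u p = (\<Sum>i<n. c i * e i p))"

definition L2_has_dim :: "heis set \<Rightarrow> (heis \<Rightarrow> complex) set \<Rightarrow> nat \<Rightarrow> bool" where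
  "L2_has_dim \<Omega> E n \<longleftrightarrow> (\<exists>e. L2_basis \<Omega> E n e)"


section \<open>Test functions and distributional derivatives\<close>

fun Ck :: "nat \<Rightarrow> (heis \<Rightarrow> complex) \<Rightarrow> bool" where
  "Ck 0 f \<longleftrightarrow> continuous_on UNIV f"
| "Ck (Suc k) f \<longleftrightarrow>
     (\<forall>p. f differentiable (at p)) \<and> (\<forall>v. Ck k (\<lambda>p. frechet_derivative f (at p) v))"

text \<open>$C_0^\infty(\Omega)$, with functions extended by zero to the whole space.\<close>

definition test_functions :: "heis set \<Rightarrow> (heis \<Rightarrow> complex) set" where
  "test_functions \<Omega> =
     {\<phi>. (\<forall>k. Ck k \<phi>) \<and> compact (closure {p. \<phi> p \<noteq> 0}) \<and> closure {p. \<phi> p \<noteq> 0} \<subseteq> \<Omega>}"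

text \<open>\<open>has_weak_deriv \<Omega> V u g\<close>: the distributional derivative of \<open>u\<close> along \<open>V\<close> on \<open>\<Omega>\<close> is \<open>g\<close>.
  The formula is the right one only for divergence-free \<open>V\<close>, as \<open>field_X\<close> and \<open>field_Y\<close> are: the
  formal transpose of such a field is its negative.\<close>

definition has_weak_deriv ::
  "heis set \<Rightarrow> (heis \<Rightarrow> heis) \<Rightarrow> (heis \<Rightarrow> complex) \<Rightarrow> (heis \<Rightarrow> complex) \<Rightarrow> bool" where
  "has_weak_deriv \<Omega> V u g \<longleftrightarrow>
     (\<forall>\<phi>\<in>test_functions \<Omega>.
        (LINT p|lebesgue_on \<Omega>. g p * \<phi> p) =
        - (LINT p|lebesgue_on \<Omega>. u p * frechet_derivative \<phi> (at p) (V p)))"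

text \<open>A representative of the square-integrable distributional derivative, which is unique almost
  everywhere; meaningful only if one exists.\<close>

definition weak_deriv ::
  "heis set \<Rightarrow> (heis \<Rightarrow> heis) \<Rightarrow> (heis \<Rightarrow> complex) \<Rightarrow> heis \<Rightarrow> complex" where
  "weak_deriv \<Omega> V u = (SOME g. g \<in> L2 \<Omega> \<and> has_weak_deriv \<Omega> V u g)"


section \<open>The spaces $S^1(\Omega)$ and $\mathring{S}^1(\Omega)$\<close>

definition S1 :: "heis set \<Rightarrow> (heis \<Rightarrow> complex) set" where
  "S1 \<Omega> = {u \<in> L2 \<Omega>. (\<exists>g\<in>L2 \<Omega>. has_weak_deriv \<Omega> field_X u g) \<and>
                      (\<exists>h\<in>L2 \<Omega>. has_weak_deriv \<Omega> field_Y u h)}"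

definition S1_norm :: "heis set \<Rightarrow> (heis \<Rightarrow> complex) \<Rightarrow> real" where
  "S1_norm \<Omega> u = sqrt ((L2_norm \<Omega> (weak_deriv \<Omega> field_X u))\<^sup>2 +
                       (L2_norm \<Omega> (weak_deriv \<Omega> field_Y u))\<^sup>2 + (L2_norm \<Omega> u)\<^sup>2)"

definition S1_0 :: "heis set \<Rightarrow> (heis \<Rightarrow> complex) set" where
  "S1_0 \<Omega> = {u \<in> S1 \<Omega>. \<forall>\<epsilon>>0. \<exists>\<phi>\<in>test_functions \<Omega>. S1_norm \<Omega> (\<lambda>p. u p - \<phi> p) < \<epsilon>}"

definition compact_embedding_S1_L2 :: "heis set \<Rightarrow> bool" where
  "compact_embedding_S1_L2 \<Omega> \<longleftrightarrow>
     (\<forall>u :: nat \<Rightarrow> heis \<Rightarrow> complex.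
        (\<forall>n. u n \<in> S1 \<Omega>) \<and> (\<exists>C. \<forall>n. S1_norm \<Omega> (u n) \<le> C) \<longrightarrow>
        (\<exists>v\<in>L2 \<Omega>. \<exists>r :: nat \<Rightarrow> nat. strict_mono r \<and>
            (\<lambda>n. L2_norm \<Omega> (\<lambda>p. u (r n) p - v p)) \<longlonglongrightarrow> 0))"


section \<open>The sub-Laplacians\<close>

text \<open>The sesquilinear form of the quadratic form $\|Xu\|^2 + \|Yu\|^2$.\<close>

definition sub_form :: "heis set \<Rightarrow> (heis \<Rightarrow> complex) \<Rightarrow> (heis \<Rightarrow> complex) \<Rightarrow> complex" where
  "sub_form \<Omega> u v =
     L2_inner \<Omega> (weak_deriv \<Omega> field_X u) (weak_deriv \<Omega> field_X v) +
     L2_inner \<Omega> (weak_deriv \<Omega> field_Y u) (weak_deriv \<Omega> field_Y v)"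

text \<open>Operators in $L_2(\Omega)$ are given by their graphs: \<open>A u f\<close> says that \<open>u\<close> is in the domain of
  \<open>A\<close> and that the value of \<open>A\<close> at \<open>u\<close> is \<open>f\<close>. The operator associated with a closed non-negative
  form with domain \<open>D\<close> is the one of the first representation theorem.\<close>

type_synonym L2_operator = "(heis \<Rightarrow> complex) \<Rightarrow> (heis \<Rightarrow> complex) \<Rightarrow> bool"

definition form_operator :: "heis set \<Rightarrow> (heis \<Rightarrow> complex) set \<Rightarrow> L2_operator" where
  "form_operator \<Omega> D u f \<longleftrightarrow> u \<in> D \<and> f \<in> L2 \<Omega> \<and> (\<forall>v\<in>D. sub_form \<Omega> u v = L2_inner \<Omega> f v)"

definition dirichlet_sublaplacian :: "heis set \<Rightarrow> L2_operator" where
  "dirichlet_sublaplacian \<Omega> = form_operator \<Omega> (S1_0 \<Omega>)"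

definition neumann_sublaplacian :: "heis set \<Rightarrow> L2_operator" where
  "neumann_sublaplacian \<Omega> = form_operator \<Omega> (S1 \<Omega>)"


section \<open>Eigenvalues counted with multiplicity\<close>

definition eigenspace :: "L2_operator \<Rightarrow> real \<Rightarrow> (heis \<Rightarrow> complex) set" where
  "eigenspace A \<mu> = {u. A u (\<lambda>p. of_real \<mu> * u p)}"

text \<open>\<open>l\<close> lists the eigenvalues in non-decreasing order, each one repeated as often as its (finite)
  multiplicity. A number that is not an eigenvalue has a zero-dimensional eigenspace and hence does
  not occur in the list.\<close>

definition eigenvalue_enumeration :: "heis set \<Rightarrow> L2_operator \<Rightarrow> (nat \<Rightarrow> real) \<Rightarrow> bool" where
  "eigenvalue_enumeration \<Omega> A l \<longleftrightarrow>
     incseq l \<and>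
     (\<forall>\<mu>. finite {k. l k = \<mu>} \<and> L2_has_dim \<Omega> (eigenspace A \<mu>) (card {k. l k = \<mu>}))"

text \<open>The \<open>j\<close>-th eigenvalue, counted from \<open>j = 1\<close>. Such an enumeration is always unique; it exists
  if the operator is self-adjoint and lower semi-bounded with purely discrete spectrum (the space
  $L_2(\Omega)$ being infinite-dimensional).\<close>

definition nth_eigenvalue :: "heis set \<Rightarrow> L2_operator \<Rightarrow> nat \<Rightarrow> real" where
  "nth_eigenvalue \<Omega> A j = (THE l. eigenvalue_enumeration \<Omega> A l) (j - 1)"

end

theory Submission
  imports Defs "HOL-Library.Function_Algebras"
begin

text \<open>The argument is Filonov's. Let $\mu$ be the \<open>j\<close>-th Dirichlet eigenvalue, which is positive, and let
  \<open>F\<close> be spanned by the first \<open>j\<close> Dirichlet eigenfunctions. For real \<open>s\<close> the lowest Landau level function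
  $U_s = \exp(i\frac{\mu}{4}(t + 2xy) - i\mu s x - \frac{\mu}{2}(y-s)^2)$ solves $-(X^2+Y^2)U_s = \mu U_s$, and
  $\|XU_s\|^2 + \|YU_s\|^2 - \mu\|U_s\|^2 = \frac12 G''(s)$ for $G(s) = \int_\Omega e^{-\mu(y-s)^2}$. As \<open>G\<close> is
  positive and vanishes at infinity, this is negative for some \<open>s\<close>.

  If $\lambda_{j+1}(L^N) \ge \mu$, some $w \ne 0$ in $F + \mathrm{span}\, U_s$ is orthogonal to the first \<open>j\<close>
  Neumann eigenfunctions. Comparing the two bounds on the form at \<open>w\<close> forces equality, hence $w \in F$ and
  \<open>w\<close> is a Neumann eigenfunction for $\mu$ that lies in the Dirichlet form domain. Its extension by zero
  is then an $L_2$ eigenfunction on the whole group; so are its dilates, with eigenvalues $r^2\mu$.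
  Eigenfunctions for distinct eigenvalues are orthogonal, and $r \to 1$ gives $w = 0$.\<close>


section \<open>Quadratic forms with compact embedding\<close>

text \<open>In the Euclidean version of the argument the added trial functions are plane waves,
  whose gradient has pointwise norm a constant times that of the function. Here X and Y do not
  commute and U_s satisfies |XU|^2 + |YU|^2 = 2 \<mu>^2 (y-s)^2 |U|^2, which is large away from y =
  s; so the centre s has to be adapted to the set. U_s oscillates in x and t without decay, and
  finite measure puts it into \<open>S1 \<Omega>\<close>. Its Gaussian factor requires \<mu> > 0; as
  a set of finite measure can be unbounded in every direction, positivity comes from a Poincare
  inequality whose weight decays at infinity. In the equality case nothing is known about the
  interior of the complement of \<Omega>. The dilations avoid looking there: they use only the
  scaling of the equation, and they exclude square-integrable eigenfunctions on the whole group. On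
  the formal side, functions equal almost everywhere are not identified, so all forms are merely
  semidefinite; and the list of eigenvalues is a definite description, so a complete system of
  eigenfunctions has to be constructed for each of the two form domains.\<close>

lemma homogeneous_system_nontrivial:
  fixes M :: "nat \<Rightarrow> nat \<Rightarrow> complex"
  assumes "m < n"
  shows "\<exists>c. (\<exists>j<n. c j \<noteq> 0) \<and> (\<forall>i<m. (\<Sum>j<n. M i j * c j) = 0)"
  using assms
proof (induction m arbitrary: M n)
  case 0
  then show ?case by (intro exI[of _ "\<lambda>_. 1"]) auto
next
  case (Suc m)
  show ?case
  proof (cases "\<exists>j<n. M m j \<noteq> 0")
    case False
    obtain c where c: "\<exists>j<n. c j \<noteq> 0" "\<forall>i<m. (\<Sum>j<n. M i j * c j) = 0"
      using Suc.IH[of n M] Suc.prems by auto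
    have "(\<Sum>j<n. M m j * c j) = 0" using False by (intro sum.neutral) auto
    with c show ?thesis by (intro exI[of _ c]) (auto simp: less_Suc_eq)
  next
    case True
    then obtain q where q: "q < n" "M m q \<noteq> 0" by auto
    \<comment> \<open>Gaussian elimination: equation m, whose coefficient at q is nonzero, gives
      unknown q the value -s in terms of the others. \<open>M'\<close> is the system left after this
      substitution, and \<sigma> enumerates the indices other than q.\<close>
    define n' where "n' = n - 1"
    have n': "n = Suc n'" "m < n'" using Suc.prems n'_def by auto
    define \<sigma> where "\<sigma> = (\<lambda>j. if j < q then j else Suc j)"
    define M' where "M' = (\<lambda>i j. M i (\<sigma> j) - M i q * M m (\<sigma> j) / M m q)"
    obtain c where c: "\<exists>j<n'. c j \<noteq> 0" "\<forall>i<m. (\<Sum>j<n'. M' i j * c j) = 0"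
      using Suc.IH[of n' M'] n' by auto
    define s where "s = (\<Sum>j<n'. M m (\<sigma> j) * c j) / M m q"
    define d where "d = (\<lambda>j. if j < q then c j else if j = q then - s else c (j - 1))"
    have d\<sigma>: "d (\<sigma> j) = c j" for j by (auto simp: d_def \<sigma>_def)
    have bij: "bij_betw \<sigma> {..<n'} ({..<n} - {q})"
    proof (rule bij_betw_byWitness[where f' = "\<lambda>j. if j < q then j else j - 1"])
    qed (use q n' in \<open>auto simp: \<sigma>_def\<close>)
    have split: "(\<Sum>j<n. f j * d j) = (\<Sum>j<n'. f (\<sigma> j) * c j) - f q * s" for f :: "nat \<Rightarrow> complex"
    proof -
      have "(\<Sum>j<n. f j * d j) = f q * d q + (\<Sum>j\<in>{..<n} - {q}. f j * d j)"
        using q by (intro sum.remove) auto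
      also have "(\<Sum>j\<in>{..<n} - {q}. f j * d j) = (\<Sum>j<n'. f (\<sigma> j) * d (\<sigma> j))"
        by (rule sum.reindex_bij_betw[OF bij, symmetric])
      finally show ?thesis by (simp add: d\<sigma>) (simp add: d_def)
    qed
    have "(\<Sum>j<n. M i j * d j) = 0" if "i < Suc m" for i
    proof (cases "i = m")
      case True
      then show ?thesis using q by (simp add: split s_def)
    next
      case False
      then have "(\<Sum>j<n'. M' i j * c j) = 0" using c(2) that by simp
      moreover have "(\<Sum>j<n'. M' i j * c j) = (\<Sum>j<n'. M i (\<sigma> j) * c j) - M i q * s"
        by (simp add: M'_def s_def sum_subtractf sum_distrib_left sum_divide_distrib algebra_simps)
      ultimately show ?thesis by (simp add: split)
    qed
    moreover have "\<exists>j<n. d j \<noteq> 0"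
    proof -
      obtain j where "j < n'" "c j \<noteq> 0" using c(1) by auto
      then show ?thesis using n' by (intro exI[of _ "\<sigma> j"]) (auto simp: d\<sigma>, auto simp: \<sigma>_def)
    qed
    ultimately show ?thesis by blast
  qed
qed

section \<open>Positive semidefinite Hermitian forms\<close>

text \<open>The form is only semidefinite, because its vectors will be functions not identified
  almost everywhere. Scaling is a parameter, since functions carry it only pointwise;
  \<open>sc_minus_one\<close> links it to the additive group, and all further linearity is required
  of \<open>h\<close> alone.\<close>

locale semi_inner =
  fixes V :: "'v::ab_group_add set" and sc :: "complex \<Rightarrow> 'v \<Rightarrow> 'v" and h :: "'v \<Rightarrow> 'v \<Rightarrow> complex"
  assumes zero_mem [simp]: "0 \<in> V"
    and add_mem [simp]: "\<lbrakk>u \<in> V; v \<in> V\<rbrakk> \<Longrightarrow> u + v \<in> V"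
    and sc_mem [simp]: "u \<in> V \<Longrightarrow> sc c u \<in> V"
    and sc_minus_one: "sc (- 1) u = - u"
    and add_left: "\<lbrakk>u \<in> V; v \<in> V; w \<in> V\<rbrakk> \<Longrightarrow> h (u + v) w = h u w + h v w"
    and sc_left: "\<lbrakk>u \<in> V; w \<in> V\<rbrakk> \<Longrightarrow> h (sc c u) w = c * h u w"
    and herm: "\<lbrakk>u \<in> V; v \<in> V\<rbrakk> \<Longrightarrow> h v u = cnj (h u v)"
    and nonneg: "u \<in> V \<Longrightarrow> 0 \<le> Re (h u u)"
begin

definition sq :: "'v \<Rightarrow> real" where "sq u = Re (h u u)"

lemma minus_mem [simp]: "u \<in> V \<Longrightarrow> - u \<in> V"
  using sc_mem[of u "-1"] by (simp add: sc_minus_one)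

lemma diff_mem [simp]: "\<lbrakk>u \<in> V; v \<in> V\<rbrakk> \<Longrightarrow> u - v \<in> V"
  using add_mem[of u "- v"] by simp

lemma sum_mem [simp]: "(\<And>i. i \<in> I \<Longrightarrow> f i \<in> V) \<Longrightarrow> sum f I \<in> V"
  by (induction I rule: infinite_finite_induct) auto

lemma add_right: "\<lbrakk>u \<in> V; v \<in> V; w \<in> V\<rbrakk> \<Longrightarrow> h w (u + v) = h w u + h w v"
  using herm[of "u + v" w] herm[of u w] herm[of v w] by (simp add: add_left)

lemma sc_right: "\<lbrakk>u \<in> V; w \<in> V\<rbrakk> \<Longrightarrow> h w (sc c u) = cnj c * h w u"
  using herm[of "sc c u" w] herm[of u w] by (simp add: sc_left)

lemma minus_left: "\<lbrakk>u \<in> V; w \<in> V\<rbrakk> \<Longrightarrow> h (- u) w = - h u w"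
  using sc_left[of u w "-1"] by (simp add: sc_minus_one)

lemma minus_right: "\<lbrakk>u \<in> V; w \<in> V\<rbrakk> \<Longrightarrow> h w (- u) = - h w u"
  using sc_right[of u w "-1"] by (simp add: sc_minus_one)

lemma diff_left: "\<lbrakk>u \<in> V; v \<in> V; w \<in> V\<rbrakk> \<Longrightarrow> h (u - v) w = h u w - h v w"
  using add_left[of u "- v" w] by (simp add: minus_left)

lemma diff_right: "\<lbrakk>u \<in> V; v \<in> V; w \<in> V\<rbrakk> \<Longrightarrow> h w (u - v) = h w u - h w v"
  using add_right[of u "- v" w] by (simp add: minus_right)

lemma zero_left [simp]: "w \<in> V \<Longrightarrow> h 0 w = 0"
  using add_left[of 0 0 w] by simp

lemma sum_left: "\<lbrakk>\<And>i. i \<in> I \<Longrightarrow> f i \<in> V; w \<in> V\<rbrakk> \<Longrightarrow> h (sum f I) w = (\<Sum>i\<in>I. h (f i) w)"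
  by (induction I rule: infinite_finite_induct) (auto simp: add_left)

lemma sq_nonneg [simp]: "u \<in> V \<Longrightarrow> 0 \<le> sq u"
  using nonneg by (simp add: sq_def)

lemma h_self: "u \<in> V \<Longrightarrow> h u u = of_real (sq u)"
  using herm[of u u] by (simp add: sq_def complex_eq_iff)

lemma sq_add: "\<lbrakk>u \<in> V; v \<in> V\<rbrakk> \<Longrightarrow> sq (u + v) = sq u + sq v + 2 * Re (h u v)"
  using herm[of u v] by (simp add: sq_def add_left add_right)

lemma sq_diff: "\<lbrakk>u \<in> V; v \<in> V\<rbrakk> \<Longrightarrow> sq (u - v) = sq u + sq v - 2 * Re (h u v)"
  using herm[of u v] by (simp add: sq_def diff_left diff_right)

lemma sq_sc: "u \<in> V \<Longrightarrow> sq (sc c u) = (cmod c)\<^sup>2 * sq u"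
  by (simp add: sq_def sc_left sc_right cmod_power2 complex_mult_cnj flip: mult.assoc)
     (simp add: h_self power2_eq_square algebra_simps)

text \<open>Positivity of \<open>sq\<close> at u minus s times \<open>h u v\<close> times v, for
  real s: the factor \<open>h u v\<close> absorbs the phase, leaving a real quadratic in s.
  Semidefiniteness makes \<open>sq v = 0\<close> a separate case, where the quadratic becomes
  affine.\<close>

lemma cauchy_schwarz_sq:
  assumes [simp]: "u \<in> V" "v \<in> V"
  shows "(cmod (h u v))\<^sup>2 \<le> sq u * sq v"
proof -
  define c where "c = h u v"
  have *: "0 \<le> sq u - 2 * s * (cmod c)\<^sup>2 + s\<^sup>2 * (cmod c)\<^sup>2 * sq v" for s :: real
  proof -
    have "0 \<le> sq (u - sc (of_real s * c) v)" by simp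
    also have "\<dots> = sq u + (cmod (of_real s * c))\<^sup>2 * sq v - 2 * Re (cnj (of_real s * c) * c)"
      by (subst sq_diff) (simp_all add: sq_sc sc_right c_def[symmetric])
    also have "(cmod (of_real s * c))\<^sup>2 = s\<^sup>2 * (cmod c)\<^sup>2" by (simp add: norm_mult power_mult_distrib)
    also have "Re (cnj (of_real s * c) * c) = s * (cmod c)\<^sup>2"
      unfolding cmod_power2 by (simp add: power2_eq_square algebra_simps)
    also have "sq u + s\<^sup>2 * (cmod c)\<^sup>2 * sq v - 2 * (s * (cmod c)\<^sup>2) = sq u - 2 * s * (cmod c)\<^sup>2 + s\<^sup>2 * (cmod c)\<^sup>2 * sq v"
      by simp
    finally show ?thesis .
  qed
  show ?thesis
  proof (cases "sq v = 0")
    case True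
    have "c = 0"
    proof (rule ccontr)
      assume "c \<noteq> 0"
      \<comment> \<open>This value of s makes the affine expression equal to -1.\<close>
      then show False using *[of "(sq u + 1) / (2 * (cmod c)\<^sup>2)"] True by simp
    qed
    then show ?thesis by (simp add: c_def[symmetric])
  next
    case False
    then have "sq v > 0" using sq_nonneg[OF assms(2)] by linarith
    then show ?thesis using *[of "1 / sq v"]
      by (simp add: c_def[symmetric] field_simps power2_eq_square)
  qed
qed

lemma cauchy_schwarz:
  assumes "u \<in> V" "v \<in> V"
  shows "cmod (h u v) \<le> sqrt (sq u) * sqrt (sq v)"
  using cauchy_schwarz_sq[OF assms] by (simp add: real_le_rsqrt flip: real_sqrt_mult)

text \<open>A vector of norm zero pairs to zero with every vector. Applied to a shifted form, this
  turns minimality into an eigenvalue equation.\<close>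

lemma null_left: "\<lbrakk>u \<in> V; v \<in> V; sq u = 0\<rbrakk> \<Longrightarrow> h u v = 0"
  using cauchy_schwarz_sq[of u v] by simp

lemma norm_triangle:
  assumes [simp]: "u \<in> V" "v \<in> V"
  shows "sqrt (sq (u + v)) \<le> sqrt (sq u) + sqrt (sq v)"
proof (rule real_le_lsqrt)
  have "Re (h u v) \<le> sqrt (sq u) * sqrt (sq v)"
    using cauchy_schwarz[of u v] complex_Re_le_cmod[of "h u v"] by simp
  then show "sq (u + v) \<le> (sqrt (sq u) + sqrt (sq v))\<^sup>2"
    by (simp add: sq_add power2_sum)
qed auto

lemma sq_add_le: "\<lbrakk>u \<in> V; v \<in> V\<rbrakk> \<Longrightarrow> sq (u + v) \<le> 2 * sq u + 2 * sq v"
  using sq_nonneg[of "u - v"] by (simp add: sq_add sq_diff)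

lemma norm_diff_triangle:
  assumes [simp]: "u \<in> V" "v \<in> V"
  shows "\<bar>sqrt (sq u) - sqrt (sq v)\<bar> \<le> sqrt (sq (u - v))"
proof -
  have "sq (v - u) = sq (u - v)" by (simp add: sq_diff herm[of u v])
  then show ?thesis
    using norm_triangle[of "u - v" v] norm_triangle[of "v - u" u] by simp
qed

lemma sq_tendsto:
  assumes [simp]: "\<And>n. u n \<in> V" "v \<in> V" and lim: "(\<lambda>n. sq (u n - v)) \<longlonglongrightarrow> 0"
  shows "(\<lambda>n. sq (u n)) \<longlonglongrightarrow> sq v"
proof -
  have "(\<lambda>n. sqrt (sq (u n)) - sqrt (sq v)) \<longlonglongrightarrow> 0"
  proof (rule Lim_null_comparison)
    show "\<forall>\<^sub>F n in sequentially. norm (sqrt (sq (u n)) - sqrt (sq v)) \<le> sqrt (sq (u n - v))"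
      using norm_diff_triangle by simp
    show "(\<lambda>n. sqrt (sq (u n - v))) \<longlonglongrightarrow> 0" using tendsto_real_sqrt[OF lim] by simp
  qed
  then have "(\<lambda>n. (sqrt (sq (u n)))\<^sup>2) \<longlonglongrightarrow> (sqrt (sq v))\<^sup>2"
    by (intro tendsto_power) (simp add: LIM_zero_iff)
  then show ?thesis by simp
qed

lemma h_tendsto:
  assumes [simp]: "\<And>n. u n \<in> V" "v \<in> V" "w \<in> V" and lim: "(\<lambda>n. sq (u n - v)) \<longlonglongrightarrow> 0"
  shows "(\<lambda>n. h (u n) w) \<longlonglongrightarrow> h v w"
proof -
  have "(\<lambda>n. h (u n) w - h v w) \<longlonglongrightarrow> 0"
  proof (rule Lim_null_comparison)
    show "\<forall>\<^sub>F n in sequentially. norm (h (u n) w - h v w) \<le> sqrt (sq (u n - v)) * sqrt (sq w)"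
      using cauchy_schwarz[of "u _ - v" w] by (simp add: diff_left)
    show "(\<lambda>n. sqrt (sq (u n - v)) * sqrt (sq w)) \<longlonglongrightarrow> 0"
      using tendsto_mult_left_zero[OF tendsto_real_sqrt[OF lim, simplified]] by simp
  qed
  then show ?thesis by (simp add: LIM_zero_iff)
qed

end

lemma semi_inner_add:
  assumes "semi_inner V sc h" "semi_inner V sc a"
  shows "semi_inner V sc (\<lambda>u v. a u v + h u v)"
proof -
  interpret h: semi_inner V sc h by fact
  interpret a: semi_inner V sc a by fact
  show ?thesis
    by unfold_locales
      (auto simp: h.sc_minus_one h.add_left a.add_left h.sc_left a.sc_left algebra_simps h.nonneg a.nonneg
        h.herm[symmetric] a.herm[symmetric])
qed

section \<open>Eigenvalues of a form with compact embedding\<close>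

text \<open>The form domain V with its two forms. Compactness asks only for a subsequence that is
  Cauchy for \<open>h\<close>, so that it does not refer to limits outside V; closedness of the form
  is \<open>completeness\<close>. By \<open>infinite_dim\<close> the successive minimisation never
  stops, and the eigenvalues are indexed by all natural numbers.\<close>

locale compact_form = h: semi_inner V sc h + a: semi_inner V sc a
  for V :: "'v::ab_group_add set" and sc h a +
  assumes compactness: "\<lbrakk>\<And>n. u n \<in> V; \<And>n::nat. a.sq (u n) + h.sq (u n) \<le> C\<rbrakk> \<Longrightarrow>
      \<exists>r::nat\<Rightarrow>nat. strict_mono r \<and> (\<forall>\<epsilon>>0. \<exists>N. \<forall>m\<ge>N. \<forall>n\<ge>N. h.sq (u (r m) - u (r n)) < \<epsilon>)"
    and completeness: "\<lbrakk>\<And>n. u n \<in> V;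
        \<And>\<epsilon>. \<epsilon> > 0 \<Longrightarrow> \<exists>N. \<forall>m\<ge>N. \<forall>n\<ge>N::nat. a.sq (u m - u n) + h.sq (u m - u n) < \<epsilon>\<rbrakk> \<Longrightarrow>
      \<exists>v\<in>V. (\<lambda>n. a.sq (u n - v)) \<longlonglongrightarrow> 0 \<and> (\<lambda>n. h.sq (u n - v)) \<longlonglongrightarrow> 0"
    and infinite_dim: "\<exists>f :: nat \<Rightarrow> 'v. (\<forall>i<n. f i \<in> V) \<and>
        (\<forall>c. h.sq (\<Sum>i<n. sc (c i) (f i)) = 0 \<longrightarrow> (\<forall>i<n. c i = 0))"
begin

definition orth :: "(nat \<Rightarrow> 'v) \<Rightarrow> nat \<Rightarrow> 'v set" where
  "orth f k = {v \<in> V. \<forall>i<k. h v (f i) = 0}"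

text \<open>Among \<open>Suc k\<close> vectors independent modulo null vectors, k linear conditions
  leave a nontrivial combination; it is not null and can be normalised.\<close>

lemma orth_unit_exists:
  assumes f: "\<And>i. i < k \<Longrightarrow> f i \<in> V"
  shows "\<exists>w \<in> orth f k. h.sq w = 1"
proof -
  obtain g where g: "\<And>i. i < Suc k \<Longrightarrow> g i \<in> V"
      "\<And>c. h.sq (\<Sum>i<Suc k. sc (c i) (g i)) = 0 \<Longrightarrow> (\<forall>i<Suc k. c i = 0)"
    using infinite_dim[of "Suc k"] by blast
  obtain c where c: "\<exists>j<Suc k. c j \<noteq> 0" "\<And>i. i < k \<Longrightarrow> (\<Sum>j<Suc k. h (g j) (f i) * c j) = 0"
    using homogeneous_system_nontrivial[of k "Suc k" "\<lambda>i j. h (g j) (f i)"] by auto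
  define w where "w = (\<Sum>j<Suc k. sc (c j) (g j))"
  have w [simp]: "w \<in> V" unfolding w_def using g(1) by (intro h.sum_mem h.sc_mem) auto
  have "h w (f i) = 0" if "i < k" for i
  proof -
    have "h w (f i) = (\<Sum>j<Suc k. h (sc (c j) (g j)) (f i))"
      unfolding w_def using g(1) f[OF that] by (intro h.sum_left) auto
    also have "\<dots> = (\<Sum>j<Suc k. h (g j) (f i) * c j)"
      using g(1) f[OF that] by (intro sum.cong) (auto simp: h.sc_left)
    finally show ?thesis using c(2)[OF that] by simp
  qed
  moreover have "h.sq w \<noteq> 0" using g(2)[of c] c(1) w_def by blast
  moreover have "h.sq w \<ge> 0" by simp
  ultimately have "sc (of_real (1 / sqrt (h.sq w))) w \<in> orth f k"
      "h.sq (sc (of_real (1 / sqrt (h.sq w))) w) = 1"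
    using f by (auto simp: orth_def h.sc_left h.sq_sc norm_divide power_divide)
  then show ?thesis by blast
qed

text \<open>The direct method for the Rayleigh quotient: compactness makes a minimising sequence
  Cauchy for \<open>h\<close>, the parallelogram identity upgrades this to \<open>a\<close>, and the
  orthogonality conditions survive the limit.\<close>

lemma orth_minimiser:
  assumes f: "\<And>i. i < k \<Longrightarrow> f i \<in> V"
  shows "\<exists>e \<in> orth f k. h.sq e = 1 \<and> (\<forall>v\<in>orth f k. a.sq e * h.sq v \<le> a.sq v)"
proof -
  define S where "S = a.sq ` {v \<in> orth f k. h.sq v = 1}"
  define m where "m = Inf S"
  have ne: "S \<noteq> {}" using orth_unit_exists[of k f] f by (auto simp: S_def)
  have bdd: "bdd_below S" by (rule bdd_belowI[of _ 0]) (auto simp: S_def orth_def)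
  have m0: "m \<ge> 0" unfolding m_def by (rule cInf_greatest[OF ne]) (auto simp: S_def orth_def)
  have orthV: "v \<in> V" if "v \<in> orth f k" for v using that by (simp add: orth_def)
  have min: "m * h.sq v \<le> a.sq v" if v: "v \<in> orth f k" for v
  proof (cases "h.sq v = 0")
    case True
    then show ?thesis using orthV[OF v] by simp
  next
    case False
    have vV [simp]: "v \<in> V" by (rule orthV[OF v])
    have pos: "h.sq v > 0" using False h.sq_nonneg[OF vV] by linarith
    let ?w = "sc (of_real (1 / sqrt (h.sq v))) v"
    have "?w \<in> orth f k" using v f by (auto simp: orth_def h.sc_left)
    moreover have "h.sq ?w = 1" using pos by (simp add: h.sq_sc norm_divide power_divide)
    ultimately have "m \<le> a.sq ?w" unfolding m_def by (intro cInf_lower[OF _ bdd]) (auto simp: S_def)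
    then show ?thesis using pos by (simp add: a.sq_sc norm_divide power_divide field_simps)
  qed
  have "\<exists>v. v \<in> orth f k \<and> h.sq v = 1 \<and> a.sq v < m + 1 / Suc n" for n
  proof -
    have "\<exists>x\<in>S. x < m + 1 / Suc n" unfolding m_def by (rule cInf_lessD[OF ne]) simp
    then show ?thesis by (auto simp: S_def)
  qed
  then obtain u where u: "\<And>n. u n \<in> orth f k" "\<And>n. h.sq (u n) = 1" "\<And>n. a.sq (u n) < m + 1 / Suc n"
    by metis
  have uV [simp]: "u n \<in> V" for n using u(1) orthV by blast
  obtain r :: "nat \<Rightarrow> nat" where r: "strict_mono r"
      "\<And>\<epsilon>. \<epsilon> > 0 \<Longrightarrow> \<exists>N. \<forall>i\<ge>N. \<forall>j\<ge>N. h.sq (u (r i) - u (r j)) < \<epsilon>"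
  proof -
    have "a.sq (u n) + h.sq (u n) \<le> m + 2" for n
    proof -
      have "1 / real (Suc n) \<le> 1" by simp
      then show ?thesis using u(2,3)[of n] by linarith
    qed
    from compactness[of u "m + 2", OF uV this] that show ?thesis by blast
  qed
  define w where "w = u \<circ> r"
  have wV [simp]: "w n \<in> V" for n by (simp add: w_def)
  have w_orth: "w n \<in> orth f k" for n using u(1) by (simp add: w_def)
  have w1: "h.sq (w n) = 1" for n using u(2) by (simp add: w_def)
  have wa: "a.sq (w n) \<le> m + 1 / Suc n" for n
  proof -
    have "a.sq (w n) < m + 1 / Suc (r n)" using u(3) by (simp add: w_def)
    also have "1 / real (Suc (r n)) \<le> 1 / Suc n" using seq_suble[OF r(1), of n] by (simp add: frac_le)
    finally show ?thesis by simp
  qed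
  \<comment> \<open>Parallelogram identity, with \<open>min\<close> applied to
    \<open>w i + w j\<close>: sums of near-minimisers still obey the lower bound m, so closeness in
    \<open>h\<close> forces closeness in \<open>a\<close>.\<close>
  have par: "a.sq (w i - w j) \<le> 2 / Suc i + 2 / Suc j + m * h.sq (w i - w j)" for i j
  proof -
    have "w i + w j \<in> orth f k" using w_orth f by (auto simp: orth_def h.add_left)
    then have "m * h.sq (w i + w j) \<le> a.sq (w i + w j)" by (rule min)
    moreover have "a.sq (w i - w j) = 2 * a.sq (w i) + 2 * a.sq (w j) - a.sq (w i + w j)"
      by (simp add: a.sq_add a.sq_diff)
    moreover have "h.sq (w i + w j) = 4 - h.sq (w i - w j)"
      by (simp add: h.sq_add h.sq_diff w1)
    ultimately show ?thesis using wa[of i] wa[of j] by (simp add: algebra_simps)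
  qed
  have "\<exists>N. \<forall>i\<ge>N. \<forall>j\<ge>N. a.sq (w i - w j) + h.sq (w i - w j) < \<epsilon>" if "\<epsilon> > 0" for \<epsilon>
  proof -
    \<comment> \<open>By \<open>par\<close> the quantity to be bounded is at most a vanishing term
      plus (m+1) times the \<open>h\<close>-distance; each of the two gets \<epsilon>/2.\<close>
    define \<delta> where "\<delta> = \<epsilon> / (2 * (m + 1))"
    have "\<delta> > 0" using that m0 by (simp add: \<delta>_def)
    then obtain N1 where N1: "\<And>i j. i \<ge> N1 \<Longrightarrow> j \<ge> N1 \<Longrightarrow> h.sq (w i - w j) < \<delta>"
      using r(2)[of \<delta>] by (auto simp: w_def)
    obtain N2 :: nat where N2: "N2 > 8 / \<epsilon>" using reals_Archimedean2 by blast
    show ?thesis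
    proof (intro exI[of _ "max N1 N2"] allI impI)
      fix i j assume ij: "i \<ge> max N1 N2" "j \<ge> max N1 N2"
      have small: "2 / Suc n \<le> \<epsilon> / 4" if "n \<ge> N2" for n :: nat
      proof -
        have "8 / \<epsilon> \<le> Suc n" using N2 that by linarith
        then show ?thesis using \<open>\<epsilon> > 0\<close> by (simp add: field_simps)
      qed
      have "2 / Suc i + 2 / Suc j \<le> \<epsilon> / 2" using small[of i] small[of j] ij by simp
      moreover have "(m + 1) * h.sq (w i - w j) < (m + 1) * \<delta>"
        using N1[of i j] ij m0 by (intro mult_strict_left_mono) auto
      moreover have "(m + 1) * \<delta> = \<epsilon> / 2" using m0 by (simp add: \<delta>_def field_simps)
      ultimately show "a.sq (w i - w j) + h.sq (w i - w j) < \<epsilon>"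
        using par[of i j] by (simp add: algebra_simps)
    qed
  qed
  from completeness[of w, OF wV this] obtain e where
    eV [simp]: "e \<in> V" and e: "(\<lambda>n. a.sq (w n - e)) \<longlonglongrightarrow> 0" "(\<lambda>n. h.sq (w n - e)) \<longlonglongrightarrow> 0" by auto
  have "h e (f i) = 0" if "i < k" for i
  proof -
    have "(\<lambda>n. h (w n) (f i)) \<longlonglongrightarrow> h e (f i)" using f[OF that] e(2) by (intro h.h_tendsto) auto
    moreover have "h (w n) (f i) = 0" for n using w_orth[of n] that by (simp add: orth_def)
    ultimately show ?thesis by (simp add: LIMSEQ_const_iff)
  qed
  then have e_orth: "e \<in> orth f k" by (simp add: orth_def)
  have e1: "h.sq e = 1" using h.sq_tendsto[OF wV eV e(2)] w1 by (simp add: LIMSEQ_const_iff)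
  have "a.sq e \<le> m"
  proof (rule LIMSEQ_le[OF a.sq_tendsto[OF wV eV e(1)]])
    have "(\<lambda>n. m + 1 / Suc n) \<longlonglongrightarrow> m + 0" by (intro tendsto_intros LIMSEQ_Suc lim_1_over_n)
    then show "(\<lambda>n. m + 1 / Suc n) \<longlonglongrightarrow> m" by simp
  qed (use wa in auto)
  moreover have "m \<le> a.sq e" using min[OF e_orth] e1 by simp
  ultimately have "a.sq e = m" by simp
  then show ?thesis using e_orth e1 min by auto
qed

text \<open>Completeness of the e k is encoded in the last clause together with the divergence of l:
  a vector orthogonal to all e k has \<open>l k * h.sq v \<le> a.sq v\<close> for every k, hence is
  null.\<close>

definition eigensystem :: "(nat \<Rightarrow> 'v) \<Rightarrow> (nat \<Rightarrow> real) \<Rightarrow> bool" where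
  "eigensystem e l \<longleftrightarrow> (\<forall>k. e k \<in> V) \<and> (\<forall>i k. h (e i) (e k) = (if i = k then 1 else 0)) \<and>
     incseq l \<and> filterlim l at_top sequentially \<and>
     (\<forall>k. \<forall>v\<in>V. a (e k) v = of_real (l k) * h (e k) v) \<and>
     (\<forall>k. \<forall>v\<in>orth e k. l k * h.sq v \<le> a.sq v)"

text \<open>A minimiser of the Rayleigh quotient is a null vector of the non-negative form $a - m h$, so the
  Cauchy--Schwarz inequality for that form yields the eigenvalue equation.\<close>

lemma critical_eq:
  assumes f: "\<And>i. i < k \<Longrightarrow> f i \<in> V" "\<And>i j. i < k \<Longrightarrow> j < k \<Longrightarrow> h (f i) (f j) = (if i = j then 1 else 0)"
    and f_eig: "\<And>i v. i < k \<Longrightarrow> v \<in> V \<Longrightarrow> a (f i) v = of_real (l i) * h (f i) v"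
    and min: "\<And>v. v \<in> orth f k \<Longrightarrow> m * h.sq v \<le> a.sq v"
    and w: "w \<in> orth f k" "a.sq w = m * h.sq w"
    and v: "v \<in> V"
  shows "a w v = of_real m * h w v"
proof -
  have wV [simp]: "w \<in> V" using w by (simp add: orth_def)
  interpret q: semi_inner "orth f k" sc "\<lambda>u v. a u v - of_real m * h u v"
  proof
    show "0 \<le> Re (a u u - of_real m * h u u)" if "u \<in> orth f k" for u
      using min[OF that] by (simp add: a.sq_def h.sq_def)
  qed (use f in \<open>auto simp: orth_def h.add_left a.add_left h.sc_left a.sc_left algebra_simps
        h.sc_minus_one h.herm[symmetric] a.herm[symmetric]\<close>)
  have w_fi: "a w (f i) = of_real m * h w (f i)" if "i < k" for i
    using f_eig[OF that wV] w(1) that f(1)[OF that] a.herm[OF f(1)[OF that] wV] h.herm[OF f(1)[OF that] wV]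
    by (simp add: orth_def)
  \<comment> \<open>The null-vector argument reaches only \<open>orth f k\<close>. The rest of v is
    its projection p onto the span of f, against which both forms vanish at w, by orthogonality and
    the eigenvalue equations of the f i.\<close>
  define p where "p = (\<Sum>i<k. sc (h v (f i)) (f i))"
  have pV [simp]: "p \<in> V" unfolding p_def by (intro h.sum_mem h.sc_mem f) auto
  have "h p (f j) = h v (f j)" if "j < k" for j
  proof -
    have "h p (f j) = (\<Sum>i<k. h (sc (h v (f i)) (f i)) (f j))"
      unfolding p_def using f that by (intro h.sum_left) auto
    also have "\<dots> = (\<Sum>i<k. if i = j then h v (f j) else 0)"
      using f that by (intro sum.cong) (auto simp: h.sc_left)
    finally show ?thesis using that by simp
  qed
  then have "v - p \<in> orth f k" using v f by (auto simp: orth_def h.diff_left)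
  then have 1: "a w (v - p) - of_real m * h w (v - p) = 0"
    using w by (intro q.null_left) (auto simp: q.sq_def a.sq_def h.sq_def)
  have "a p w - of_real m * h p w = (\<Sum>i<k. a (sc (h v (f i)) (f i)) w - of_real m * h (sc (h v (f i)) (f i)) w)"
    unfolding p_def using f by (subst a.sum_left h.sum_left, auto)+ (simp add: sum_subtractf sum_distrib_left)
  also have "\<dots> = 0"
  proof (intro sum.neutral ballI)
    fix i assume "i \<in> {..<k}"
    then have i: "i < k" by simp
    have "h (f i) w = 0" using w(1) i h.herm[OF wV f(1)[OF i]] by (simp add: orth_def)
    then show "a (sc (h v (f i)) (f i)) w - of_real m * h (sc (h v (f i)) (f i)) w = 0"
      using f_eig[OF i wV] f(1)[OF i] by (simp add: a.sc_left h.sc_left)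
  qed
  finally have "cnj (a p w - of_real m * h p w) = 0" by simp
  then have 2: "a w p - of_real m * h w p = 0" by (simp add: a.herm[of p w] h.herm[of p w])
  show ?thesis using 1 2 v by (simp add: a.diff_right h.diff_right algebra_simps)
qed

text \<open>Each e k minimises the Rayleigh quotient on the orthogonal complement of its
  predecessors. The l k increase because these complements shrink, and they diverge because an
  orthonormal sequence has no Cauchy subsequence.\<close>

theorem eigensystem_exists: "\<exists>e l. eigensystem e l"
proof -
  define P where "P = (\<lambda>f k e. e \<in> orth f k \<and> h.sq e = 1 \<and> (\<forall>v\<in>orth f k. a.sq e * h.sq v \<le> a.sq v))"
  have "\<exists>f. \<forall>k. P f k (f k)"
  proof (rule dependent_wellorder_choice)
    fix r :: 'v and f g :: "nat \<Rightarrow> 'v" and x assume "\<And>y. y < x \<Longrightarrow> f y = g y"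
    then show "P f x r = P g x r" by (simp add: P_def orth_def)
  next
    fix x and f :: "nat \<Rightarrow> 'v" assume "\<And>y. y < x \<Longrightarrow> P f y (f y)"
    then have "\<And>i. i < x \<Longrightarrow> f i \<in> V" by (auto simp: P_def orth_def)
    from orth_minimiser[of x f, OF this] show "\<exists>r. P f x r" by (auto simp: P_def)
  qed
  then obtain e where e: "\<And>k. e k \<in> orth e k" "\<And>k. h.sq (e k) = 1"
     "\<And>k v. v \<in> orth e k \<Longrightarrow> a.sq (e k) * h.sq v \<le> a.sq v"
    by (auto simp: P_def)
  define l where "l = (\<lambda>k. a.sq (e k))"
  have eV [simp]: "e k \<in> V" for k using e(1)[of k] by (simp add: orth_def)
  have lt0: "h (e i) (e k) = 0" if "k < i" for i k using e(1)[of i] that by (simp add: orth_def)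
  have on: "h (e i) (e k) = (if i = k then 1 else 0)" for i k
    using lt0[of k i] lt0[of i k] h.herm[of "e k" "e i"] e(2)[of i] h.h_self[of "e i"]
    by (cases i k rule: linorder_cases) auto
  have inc: "incseq l"
  proof (rule incseq_SucI)
    fix n have "e (Suc n) \<in> orth e n" using e(1)[of "Suc n"] by (simp add: orth_def)
    from e(3)[OF this] show "l n \<le> l (Suc n)" by (simp add: l_def e(2))
  qed
  have eig: "a (e k) v = of_real (l k) * h (e k) v" if "v \<in> V" for k v
    using that
  proof (induction k arbitrary: v rule: less_induct)
    case (less k)
    show ?case
    proof (rule critical_eq[of k e l])
      show "l k * h.sq v \<le> a.sq v" if "v \<in> orth e k" for v using e(3)[OF that] by (simp add: l_def)
      show "a (e i) v = of_real (l i) * h (e i) v" if "i < k" "v \<in> V" for i v using less.IH that .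
    qed (use on e less.prems in \<open>simp_all add: l_def\<close>)
  qed
  have "filterlim l at_top sequentially"
  proof (rule ccontr)
    assume not: "\<not> filterlim l at_top sequentially"
    have "\<exists>C. \<forall>n. l n \<le> C"
    proof (rule ccontr)
      assume unb: "\<nexists>C. \<forall>n. l n \<le> C"
      have "filterlim l at_top sequentially"
        unfolding filterlim_at_top eventually_sequentially
      proof
        fix Z obtain N where "l N > Z" using unb by (meson not_le)
        then show "\<exists>N. \<forall>n\<ge>N. Z \<le> l n"
          by (intro exI[of _ N]) (use inc in \<open>auto simp: incseq_def intro: order.trans less_imp_le\<close>)
      qed
      with not show False by simp
    qed
    then obtain C where "\<And>n. l n \<le> C" by blast
    \<comment> \<open>If l were bounded, compactness would bring two distinct members of the
      orthonormal sequence to squared distance below 1; it is always 2.\<close>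
    then have "a.sq (e n) + h.sq (e n) \<le> C + 1" for n using e(2) by (simp add: l_def)
    from compactness[of e "C + 1", OF eV this] obtain r :: "nat \<Rightarrow> nat" where
      r: "strict_mono r" "\<forall>\<epsilon>>0. \<exists>N. \<forall>m\<ge>N. \<forall>n\<ge>N. h.sq (e (r m) - e (r n)) < \<epsilon>" by auto
    then obtain N where "\<And>m n. m \<ge> N \<Longrightarrow> n \<ge> N \<Longrightarrow> h.sq (e (r m) - e (r n)) < 1"
      by (meson zero_less_one)
    then have "h.sq (e (r N) - e (r (Suc N))) < 1" by simp
    moreover have "r N \<noteq> r (Suc N)" using r(1) strict_mono_Suc_iff[of r] by (metis less_irrefl)
    ultimately show False by (simp add: h.sq_diff e(2) on)
  qed
  then have "eigensystem e l"
    using on inc eig e(3) by (auto simp: eigensystem_def l_def)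
  then show ?thesis by blast
qed

lemma eigensystem_fibre_finite:
  assumes "eigensystem e l"
  shows "finite {k. l k = \<mu>}"
proof -
  have "eventually (\<lambda>k. \<mu> + 1 \<le> l k) sequentially"
    using assms by (auto simp: eigensystem_def filterlim_at_top)
  then obtain N where "\<And>k. k \<ge> N \<Longrightarrow> \<mu> + 1 \<le> l k" by (auto simp: eventually_sequentially)
  then have "{k. l k = \<mu>} \<subseteq> {..<N}" by (force simp: not_less[symmetric])
  then show ?thesis by (rule finite_subset) simp
qed

text \<open>The remainder w is again an eigenvector for \<mu>. It is orthogonal to every e k: by
  construction if \<open>l k = \<mu>\<close>, otherwise because the eigenvalues differ. Then
  \<open>l k * h.sq w \<le> \<mu> * h.sq w\<close> for all k, and the divergence of l makes w
  null.\<close>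

lemma eigenvector_expansion:
  assumes es: "eigensystem e l" and u: "u \<in> V" "\<And>v. v \<in> V \<Longrightarrow> a u v = of_real \<mu> * h u v"
  shows "h.sq (u - (\<Sum>k | l k = \<mu>. sc (h u (e k)) (e k))) = 0"
proof -
  let ?K = "{k. l k = \<mu>}"
  define p where "p = (\<Sum>k\<in>?K. sc (h u (e k)) (e k))"
  have fin: "finite ?K" by (rule eigensystem_fibre_finite[OF es])
  have eV [simp]: "e k \<in> V" and on: "h (e i) (e k) = (if i = k then 1 else 0)"
    and lim: "filterlim l at_top sequentially"
    and eig: "\<And>v. v \<in> V \<Longrightarrow> a (e k) v = of_real (l k) * h (e k) v"
    and min: "\<And>v. v \<in> orth e k \<Longrightarrow> l k * h.sq v \<le> a.sq v" for i k
    using es by (auto simp: eigensystem_def)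
  have pV [simp]: "p \<in> V" unfolding p_def by (intro h.sum_mem h.sc_mem) auto
  have [simp]: "u \<in> V" by fact
  have ap: "a p v = of_real \<mu> * h p v" if "v \<in> V" for v
    unfolding p_def using that
    by (subst a.sum_left h.sum_left, auto simp: sum_distrib_left a.sc_left h.sc_left eig intro!: sum.cong)+
  define w where "w = u - p"
  have wV [simp]: "w \<in> V" by (simp add: w_def)
  have aw: "a w v = of_real \<mu> * h w v" if "v \<in> V" for v
    using ap[OF that] u(2)[OF that] that by (simp add: w_def a.diff_left h.diff_left algebra_simps)
  have hw: "h w (e k) = 0" for k
  proof (cases "l k = \<mu>")
    case True
    have "h p (e k) = (\<Sum>i\<in>?K. h (sc (h u (e i)) (e i)) (e k))" unfolding p_def by (intro h.sum_left) auto
    also have "\<dots> = (\<Sum>i\<in>?K. if i = k then h u (e k) else 0)"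
      by (intro sum.cong) (auto simp: h.sc_left on)
    finally show ?thesis using True fin by (simp add: w_def h.diff_left)
  next
    case False
    have "a w (e k) = cnj (of_real (l k) * h (e k) w)" using eig[of w k] a.herm[of "e k" w] by simp
    also have "\<dots> = of_real (l k) * h w (e k)" using h.herm[of "e k" w] by simp
    finally have "of_real \<mu> * h w (e k) = of_real (l k) * h w (e k)" using aw[of "e k"] by simp
    then show ?thesis using False by (metis mult_cancel_right of_real_eq_iff)
  qed
  have "h.sq w = 0"
  proof -
    have le: "l k * h.sq w \<le> \<mu> * h.sq w" for k
      using min[of w k] hw aw[of w] by (simp add: orth_def a.sq_def h.sq_def)
    have "eventually (\<lambda>k. \<mu> + 1 \<le> l k) sequentially" using lim by (auto simp: filterlim_at_top)
    then obtain k where "\<mu> + 1 \<le> l k" by (auto simp: eventually_sequentially)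
    then have "(\<mu> + 1) * h.sq w \<le> l k * h.sq w" by (intro mult_right_mono) auto
    then have "h.sq w \<le> 0" using le[of k] by (simp add: algebra_simps)
    then show ?thesis using h.sq_nonneg[OF wV] by linarith
  qed
  then show ?thesis by (simp add: w_def p_def)
qed

end


section \<open>Square-integrable functions and the Riesz--Fischer theorem\<close>

text \<open>\<open>L2\<close> for an arbitrary measure, so that the Hilbert space facts are
  independent of the group and of \<Omega>.\<close>

definition sqint :: "'a measure \<Rightarrow> ('a \<Rightarrow> complex) set" where
  "sqint M = {u \<in> borel_measurable M. integrable M (\<lambda>p. (cmod (u p))\<^sup>2)}"

lemma sqintI: "\<lbrakk>u \<in> borel_measurable M; integrable M (\<lambda>p. (cmod (u p))\<^sup>2)\<rbrakk> \<Longrightarrow> u \<in> sqint M"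
  by (simp add: sqint_def)

lemma sqint_meas [measurable_dest]: "u \<in> sqint M \<Longrightarrow> u \<in> borel_measurable M"
  by (simp add: sqint_def)

lemma sqint_integrable: "u \<in> sqint M \<Longrightarrow> integrable M (\<lambda>p. (cmod (u p))\<^sup>2)"
  by (simp add: sqint_def)

lemma sqint_bound:
  assumes "u \<in> sqint M" "v \<in> borel_measurable M" "AE p in M. cmod (v p) \<le> C * cmod (u p)"
  shows "v \<in> sqint M"
proof (rule sqintI)
  show "integrable M (\<lambda>p. (cmod (v p))\<^sup>2)"
  proof (rule Bochner_Integration.integrable_bound)
    show "integrable M (\<lambda>p. C\<^sup>2 * (cmod (u p))\<^sup>2)" using sqint_integrable[OF assms(1)] by simp
    show "AE p in M. norm ((cmod (v p))\<^sup>2) \<le> norm (C\<^sup>2 * (cmod (u p))\<^sup>2)"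
      using assms(3)
    proof eventually_elim
      case (elim p)
      then have "(cmod (v p))\<^sup>2 \<le> (C * cmod (u p))\<^sup>2" by (intro power_mono) auto
      then show ?case by (simp add: power_mult_distrib)
    qed
  qed (use assms(2) in measurable)
qed fact

lemma sqint_add: 
  assumes [measurable]: "u \<in> sqint M" "v \<in> sqint M"
  shows "(\<lambda>p. u p + v p) \<in> sqint M"
proof (rule sqintI)
  show "integrable M (\<lambda>p. (cmod (u p + v p))\<^sup>2)"
  proof (rule Bochner_Integration.integrable_bound)
    show "integrable M (\<lambda>p. 2 * (cmod (u p))\<^sup>2 + 2 * (cmod (v p))\<^sup>2)"
      using assms[THEN sqint_integrable] by simp
    have "(cmod (u p + v p))\<^sup>2 \<le> 2 * (cmod (u p))\<^sup>2 + 2 * (cmod (v p))\<^sup>2" for p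
    proof -
      have "(cmod (u p + v p))\<^sup>2 \<le> (cmod (u p) + cmod (v p))\<^sup>2"
        by (intro power_mono norm_triangle_ineq) auto
      also have "\<dots> \<le> 2 * (cmod (u p))\<^sup>2 + 2 * (cmod (v p))\<^sup>2"
        using sum_squares_bound[of "cmod (u p)" "cmod (v p)"] by (simp add: power2_sum)
      finally show ?thesis .
    qed
    then show "AE p in M. norm ((cmod (u p + v p))\<^sup>2) \<le> norm (2 * (cmod (u p))\<^sup>2 + 2 * (cmod (v p))\<^sup>2)"
      by simp
  qed measurable
qed measurable

lemma sqint_scale: "u \<in> sqint M \<Longrightarrow> (\<lambda>p. c * u p) \<in> sqint M"
  by (rule sqint_bound[of u M _ "cmod c"]) (auto simp: norm_mult)

lemma sqint_diff: "u \<in> sqint M \<Longrightarrow> v \<in> sqint M \<Longrightarrow> (\<lambda>p. u p - v p) \<in> sqint M"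
  using sqint_add[of u M "\<lambda>p. (-1) * v p"] sqint_scale[of v M "-1"] by simp

lemma sqint_mult_integrable:
  assumes [measurable]: "u \<in> sqint M" "v \<in> sqint M"
  shows "integrable M (\<lambda>p. u p * v p)"
proof (rule Bochner_Integration.integrable_bound)
  show "integrable M (\<lambda>p. (cmod (u p))\<^sup>2 + (cmod (v p))\<^sup>2)"
    using assms[THEN sqint_integrable] by simp
  have "cmod (u p * v p) \<le> (cmod (u p))\<^sup>2 + (cmod (v p))\<^sup>2" for p
    using sum_squares_bound[of "cmod (u p)" "cmod (v p)"]
      mult_nonneg_nonneg[OF norm_ge_zero[of "u p"] norm_ge_zero[of "v p"]] unfolding norm_mult by linarith
  then show "AE p in M. norm (u p * v p) \<le> norm ((cmod (u p))\<^sup>2 + (cmod (v p))\<^sup>2)"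
    by simp
qed measurable

lemma sqint_cnj: "u \<in> sqint M \<Longrightarrow> (\<lambda>p. cnj (u p)) \<in> sqint M"
  by (rule sqint_bound[of u M _ 1])
     (auto intro: measurable_compose[OF sqint_meas borel_measurable_continuous_onI] continuous_intros)

lemma sqint_zero: "(\<lambda>p. 0) \<in> sqint M"
  by (auto simp: sqint_def)

definition fscale :: "complex \<Rightarrow> ('a \<Rightarrow> complex) \<Rightarrow> 'a \<Rightarrow> complex" where
  "fscale c u = (\<lambda>p. c * u p)"

definition sip :: "'a measure \<Rightarrow> ('a \<Rightarrow> complex) \<Rightarrow> ('a \<Rightarrow> complex) \<Rightarrow> complex" where
  "sip M u v = (LINT p|M. u p * cnj (v p))"

lemma sip_self: "u \<in> sqint M \<Longrightarrow> Re (sip M u u) = (LINT p|M. (cmod (u p))\<^sup>2)"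
proof -
  assume "u \<in> sqint M"
  have "sip M u u = (LINT p|M. complex_of_real ((cmod (u p))\<^sup>2))"
    unfolding sip_def by (simp only: complex_norm_square)
  then show ?thesis by (simp only: integral_complex_of_real Re_complex_of_real)
qed

lemma semi_inner_sqint: "semi_inner (sqint M) fscale (sip M)"
proof
  show "0 \<in> sqint M" unfolding zero_fun_def by (rule sqint_zero)
  fix u v w assume u: "u \<in> sqint M"
  show "fscale c u \<in> sqint M" for c unfolding fscale_def by (rule sqint_scale[OF u])
  show "0 \<le> Re (sip M u u)" using sip_self[OF u] by simp
  assume v: "v \<in> sqint M"
  show "u + v \<in> sqint M" unfolding plus_fun_def by (rule sqint_add[OF u v])
  show "sip M v u = cnj (sip M u v)"
    using Bochner_Integration.integral_cnj[of M "\<lambda>p. u p * cnj (v p)"] by (simp add: sip_def mult.commute)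
  note i = sqint_mult_integrable[OF u sqint_cnj[OF v]]
  show "sip M (fscale c u) v = c * sip M u v" for c
    unfolding sip_def fscale_def using i by (simp add: mult.assoc)
  assume w: "w \<in> sqint M"
  show "sip M (u + v) w = sip M u w + sip M v w"
    unfolding sip_def plus_fun_def
    using sqint_mult_integrable[OF u sqint_cnj[OF w]] sqint_mult_integrable[OF v sqint_cnj[OF w]]
    by (simp add: distrib_right)
qed (auto simp: fscale_def)

interpretation sq: semi_inner "sqint M" fscale "sip M" for M
  by (rule semi_inner_sqint)

lemma sq_sq: "u \<in> sqint M \<Longrightarrow> sq.sq M u = (LINT p|M. (cmod (u p))\<^sup>2)"
  by (simp add: sq.sq_def sip_self)

lemma sq_eq_0_iff: "u \<in> sqint M \<Longrightarrow> sq.sq M u = 0 \<longleftrightarrow> (AE p in M. u p = 0)"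
  by (subst sq_sq, simp, subst integral_nonneg_eq_0_iff_AE) (auto simp: sqint_def)

lemma nn_integral_sq: "u \<in> sqint M \<Longrightarrow> (\<integral>\<^sup>+p. ennreal ((cmod (u p))\<^sup>2) \<partial>M) = ennreal (sq.sq M u)"
  by (subst nn_integral_eq_integral) (auto simp: sq_sq sqint_def)

text \<open>A rapidly converging subsequence has almost everywhere summable increments, hence a
  pointwise limit; Fatou then transfers the Cauchy estimate to that limit.\<close>

theorem riesz_fischer:
  assumes u: "\<And>n. u n \<in> sqint M"
    and cauchy: "\<And>\<epsilon>. \<epsilon> > 0 \<Longrightarrow> \<exists>N. \<forall>m\<ge>N. \<forall>n\<ge>N::nat. sq.sq M (u m - u n) < \<epsilon>"
  shows "\<exists>v\<in>sqint M. (\<lambda>n. sq.sq M (u n - v)) \<longlonglongrightarrow> 0"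
proof -
  have [measurable]: "u n \<in> borel_measurable M" for n using u by (rule sqint_meas)
  \<comment> \<open>The rate 16^-k leaves room for a weight 4^k on the squared increments: the
    weighted integrals are still summable, and a weighted square below 1 means an increment below
    2^-k.\<close>
  have "\<exists>N. \<forall>k. \<forall>m\<ge>N k. \<forall>n\<ge>N k. sq.sq M (u m - u n) < (1/16) ^ k"
    by (intro choice allI cauchy) simp
  then obtain N where N: "\<And>k m n. m \<ge> N k \<Longrightarrow> n \<ge> N k \<Longrightarrow> sq.sq M (u m - u n) < (1/16) ^ k" by blast
  \<comment> \<open>Adding up the N i keeps r k above the threshold N k and makes r monotone; the
    summand k sends it to infinity.\<close>
  define r where "r = (\<lambda>k. k + (\<Sum>i\<le>k. N i))"
  have rN: "r k \<ge> N k" "r k \<ge> k" for k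
    unfolding r_def using member_le_sum[of k "{..k}" N] by auto
  have rS: "r (Suc k) \<ge> N k" for k
    using rN(1)[of k] by (simp add: r_def)
  define d where "d = (\<lambda>k. u (r (Suc k)) - u (r k))"
  have dS: "d k \<in> sqint M" for k using u by (simp add: d_def)
  have [measurable]: "d k \<in> borel_measurable M" for k using dS by (rule sqint_meas)
  have d: "sq.sq M (d k) < (1/16)^k" for k unfolding d_def using N rN rS by blast
  have "(\<integral>\<^sup>+p. (\<Sum>k. ennreal (4^k * (cmod (d k p))\<^sup>2)) \<partial>M) = (\<Sum>k. \<integral>\<^sup>+p. ennreal (4^k * (cmod (d k p))\<^sup>2) \<partial>M)"
    by (rule nn_integral_suminf) measurable
  also have "\<dots> = (\<Sum>k. ennreal (4^k * sq.sq M (d k)))"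
    by (intro suminf_cong) (simp add: ennreal_mult' nn_integral_cmult nn_integral_sq[OF dS])
  also have "\<dots> \<le> (\<Sum>k. ennreal ((1/4)^k))"
  proof (intro suminf_le ennreal_leI)
    fix k
    have "4^k * sq.sq M (d k) \<le> 4^k * (1/16::real)^k" using d[of k] by (intro mult_left_mono) auto
    also have "\<dots> = (1/4)^k" by (simp add: power_mult_distrib[symmetric])
    finally show "4^k * sq.sq M (d k) \<le> (1/4)^k" .
  qed auto
  also have "\<dots> = ennreal (\<Sum>k. (1/4)^k)" by (intro suminf_ennreal2) (auto simp: summable_geometric)
  finally have "(\<integral>\<^sup>+p. (\<Sum>k. ennreal (4^k * (cmod (d k p))\<^sup>2)) \<partial>M) \<noteq> \<infinity>"
    by (metis ennreal_less_top infinity_ennreal_def leD)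
  then have "AE p in M. (\<Sum>k. ennreal (4^k * (cmod (d k p))\<^sup>2)) \<noteq> \<infinity>"
    by (intro nn_integral_PInf_AE) measurable
  then have conv: "AE p in M. (\<lambda>k. u (r k) p) \<longlonglongrightarrow> lim (\<lambda>k. u (r k) p)"
  proof eventually_elim
    case (elim p)
    then have "summable (\<lambda>k. 4^k * (cmod (d k p))\<^sup>2)"
      by (intro summable_suminf_not_top) auto
    then have "(\<lambda>k. 4^k * (cmod (d k p))\<^sup>2) \<longlonglongrightarrow> 0" by (rule summable_LIMSEQ_zero)
    then have "\<forall>\<^sub>F k in sequentially. 4^k * (cmod (d k p))\<^sup>2 < 1" by (rule order_tendstoD) simp
    then have ev: "\<forall>\<^sub>F k in sequentially. norm (d k p) \<le> (1/2)^k"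
    proof eventually_elim
      case (elim k)
      have "(2^k * cmod (d k p))\<^sup>2 = 4^k * (cmod (d k p))\<^sup>2"
        by (simp add: power_mult_distrib) (simp add: power2_eq_square flip: power_mult_distrib)
      with elim have "(2^k * cmod (d k p))\<^sup>2 < 1\<^sup>2" by simp
      then have "2^k * cmod (d k p) < 1" by (rule power_less_imp_less_base) simp
      then show ?case by (simp add: field_simps)
    qed
    have "summable (\<lambda>k. d k p)"
      by (rule summable_comparison_test_ev[OF ev]) (simp add: summable_geometric)
    then have "(\<lambda>n. (\<Sum>k<n. d k p)) \<longlonglongrightarrow> (\<Sum>k. d k p)" by (rule summable_LIMSEQ)
    moreover have "(\<Sum>k<n. d k p) = u (r n) p - u (r 0) p" for n
      using sum_lessThan_telescope[of "\<lambda>k. u (r k) p"] by (simp add: d_def)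
    ultimately have "(\<lambda>n. (u (r n) p - u (r 0) p) + u (r 0) p) \<longlonglongrightarrow> (\<Sum>k. d k p) + u (r 0) p"
      by (intro tendsto_add) auto
    then have "convergent (\<lambda>n. u (r n) p)" by (auto simp: convergent_def)
    then show ?case by (simp add: convergent_LIMSEQ_iff)
  qed
  define v where "v = (\<lambda>p. lim (\<lambda>k. u (r k) p))"
  have [measurable]: "v \<in> borel_measurable M" unfolding v_def by measurable
  \<comment> \<open>The estimate for \<open>u n - u (r k)\<close> passes to \<open>u n - v\<close>.
    It serves twice: with the bound 1 it shows that v is square-integrable, with \<epsilon>/2 it
    gives convergence.\<close>
  have fatou: "(\<integral>\<^sup>+p. ennreal ((cmod (u n p - v p))\<^sup>2) \<partial>M) \<le> ennreal \<epsilon>"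
    if N: "\<And>m. m \<ge> N \<Longrightarrow> sq.sq M (u n - u m) < \<epsilon>" for N n \<epsilon>
  proof -
    have "(\<integral>\<^sup>+p. ennreal ((cmod (u n p - v p))\<^sup>2) \<partial>M) =
        (\<integral>\<^sup>+p. liminf (\<lambda>k. ennreal ((cmod (u n p - u (r k) p))\<^sup>2)) \<partial>M)"
    proof (rule nn_integral_cong_AE, use conv in eventually_elim)
      case (elim p)
      have "(\<lambda>k. ennreal ((cmod (u n p - u (r k) p))\<^sup>2)) \<longlonglongrightarrow> ennreal ((cmod (u n p - v p))\<^sup>2)"
        using elim unfolding v_def by (intro tendsto_ennrealI tendsto_intros)
      then show ?case by (metis lim_imp_Liminf trivial_limit_sequentially)
    qed
    also have "\<dots> \<le> liminf (\<lambda>k. \<integral>\<^sup>+p. ennreal ((cmod (u n p - u (r k) p))\<^sup>2) \<partial>M)"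
      by (rule nn_integral_liminf) measurable
    also have "\<dots> \<le> limsup (\<lambda>k. \<integral>\<^sup>+p. ennreal ((cmod (u n p - u (r k) p))\<^sup>2) \<partial>M)"
      by (rule Liminf_le_Limsup) simp
    also have "\<dots> \<le> ennreal \<epsilon>"
    proof (rule Limsup_bounded)
      show "\<forall>\<^sub>F k in sequentially. (\<integral>\<^sup>+p. ennreal ((cmod (u n p - u (r k) p))\<^sup>2) \<partial>M) \<le> ennreal \<epsilon>"
        using eventually_ge_at_top[of N]
      proof eventually_elim
        case (elim k)
        then have "sq.sq M (u n - u (r k)) < \<epsilon>" using N[of "r k"] rN(2)[of k] by linarith
        then show ?case using nn_integral_sq[of "u n - u (r k)" M] u by (simp add: ennreal_leI)
      qed
    qed
    finally show ?thesis .
  qed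
  have diff: "u n - v \<in> sqint M" if "\<And>m. m \<ge> N \<Longrightarrow> sq.sq M (u n - u m) < \<epsilon>" for N n \<epsilon>
  proof (rule sqintI)
    show "u n - v \<in> borel_measurable M" unfolding fun_diff_def by measurable
    show "integrable M (\<lambda>p. (cmod ((u n - v) p))\<^sup>2)"
      unfolding fun_diff_def
      using le_less_trans[OF fatou[of N n \<epsilon>, OF that] ennreal_less_top]
      by (intro integrableI_nonneg) auto
  qed
  obtain N0 where N0: "\<And>m n. m \<ge> N0 \<Longrightarrow> n \<ge> N0 \<Longrightarrow> sq.sq M (u m - u n) < 1" using cauchy[of 1] by auto
  have "u N0 - v \<in> sqint M" by (rule diff[of N0 N0 1]) (use N0 in auto)
  from sq.diff_mem[OF u[of N0] this] have v: "v \<in> sqint M" by simp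
  have "(\<lambda>n. sq.sq M (u n - v)) \<longlonglongrightarrow> 0"
  proof (rule LIMSEQ_I)
    fix \<epsilon> :: real assume "\<epsilon> > 0"
    then obtain N where N: "\<And>m n. m \<ge> N \<Longrightarrow> n \<ge> N \<Longrightarrow> sq.sq M (u m - u n) < \<epsilon> / 2"
      using cauchy[of "\<epsilon>/2"] by auto
    have "norm (sq.sq M (u n - v) - 0) < \<epsilon>" if "n \<ge> N" for n
    proof -
      have "ennreal (sq.sq M (u n - v)) \<le> ennreal (\<epsilon>/2)"
        using fatou[of N n "\<epsilon>/2"] N that nn_integral_sq[of "u n - v" M] u v by simp
      then have "sq.sq M (u n - v) \<le> \<epsilon>/2" using \<open>\<epsilon> > 0\<close> by (simp add: ennreal_le_iff)
      moreover have "0 \<le> sq.sq M (u n - v)" using u v by simp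
      ultimately show ?thesis using \<open>\<epsilon> > 0\<close> by simp
    qed
    then show "\<exists>no. \<forall>n\<ge>no. norm (sq.sq M (u n - v) - 0) < \<epsilon>" by blast
  qed
  with v show ?thesis by blast
qed


section \<open>Integration by parts\<close>

lemma frechet_derivative_eqI: "(f has_derivative f') (at p) \<Longrightarrow> frechet_derivative f (at p) = f'"
  by (rule frechet_derivative_at[symmetric])

lemma has_vector_derivative_quotient:
  assumes "(h has_vector_derivative D) (at 0)"
  shows "((\<lambda>s. (h s - h 0) /\<^sub>R s) \<longlongrightarrow> D) (at 0)"
proof -
  have "((\<lambda>s. norm (h s - h 0 - s *\<^sub>R D) / norm s) \<longlongrightarrow> 0) (at 0)"
    using assms by (simp add: has_vector_derivative_def has_derivative_iff_norm)
  moreover have "\<forall>\<^sub>F s in at 0. norm (h s - h 0 - s *\<^sub>R D) / norm s = norm ((h s - h 0) /\<^sub>R s - D)"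
    unfolding eventually_at_filter
  proof (intro always_eventually allI impI)
    fix s :: real assume "s \<noteq> 0"
    then have "(h s - h 0) /\<^sub>R s - D = (h s - h 0 - s *\<^sub>R D) /\<^sub>R s" by (simp add: scaleR_diff_right)
    then show "norm (h s - h 0 - s *\<^sub>R D) / norm s = norm ((h s - h 0) /\<^sub>R s - D)"
      by (simp add: divide_inverse mult.commute)
  qed
  ultimately have "((\<lambda>s. norm ((h s - h 0) /\<^sub>R s - D)) \<longlongrightarrow> 0) (at 0)"
    by (rule Lim_transform_eventually)
  then show ?thesis by (simp add: tendsto_norm_zero_iff LIM_zero_iff)
qed

section \<open>Continuously differentiable functions of bounded support\<close>

definition C1fun :: "('a::euclidean_space \<Rightarrow> complex) \<Rightarrow> bool" where
  "C1fun f \<longleftrightarrow> (\<forall>p. f differentiable (at p)) \<and>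
     (\<forall>v. continuous_on UNIV (\<lambda>p. frechet_derivative f (at p) v))"

lemma C1fun_continuous: "C1fun f \<Longrightarrow> continuous_on UNIV f"
  by (simp add: C1fun_def differentiable_imp_continuous_on differentiable_on_def)

lemma C1fun_deriv: "C1fun f \<Longrightarrow> (f has_derivative frechet_derivative f (at p)) (at p)"
  by (simp add: C1fun_def frechet_derivative_works)

lemma C1funI:
  assumes "\<And>p. (f has_derivative f' p) (at p)" "\<And>v. continuous_on UNIV (\<lambda>p. f' p v)"
  shows "C1fun f"
  using assms frechet_derivative_eqI[OF assms(1)] by (auto simp: C1fun_def differentiable_def)

lemma frechet_derivative_mult':
  fixes f g :: "'a::real_normed_vector \<Rightarrow> complex"
  assumes "f differentiable (at p)" "g differentiable (at p)"
  shows "frechet_derivative (\<lambda>p. f p * g p) (at p) v =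
    f p * frechet_derivative g (at p) v + frechet_derivative f (at p) v * g p"
  using frechet_derivative_eqI[OF has_derivative_mult[OF assms[THEN frechet_derivative_works[THEN iffD1]]]] 
  by simp

lemma frechet_derivative_cnj:
  fixes f :: "'a::real_normed_vector \<Rightarrow> complex"
  assumes "f differentiable (at p)"
  shows "frechet_derivative (\<lambda>p. cnj (f p)) (at p) v = cnj (frechet_derivative f (at p) v)"
  using frechet_derivative_eqI[OF has_derivative_cnj[OF assms[THEN frechet_derivative_works[THEN iffD1]]]] by simp

lemma C1fun_mult:
  assumes "C1fun f" "C1fun g"
  shows "C1fun (\<lambda>p. f p * g p)"
  using assms[THEN C1fun_continuous] assms
  by (auto simp: C1fun_def frechet_derivative_mult' intro!: continuous_intros differentiable_mult)

lemma C1fun_cnj: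
  assumes "C1fun f" shows "C1fun (\<lambda>p. cnj (f p))"
proof (rule C1funI)
  show "((\<lambda>p. cnj (f p)) has_derivative (\<lambda>v. cnj (frechet_derivative f (at p) v))) (at p)" for p
    by (intro has_derivative_cnj C1fun_deriv assms)
  show "continuous_on UNIV (\<lambda>p. cnj (frechet_derivative f (at p) v))" for v
    using assms by (auto simp: C1fun_def intro!: continuous_intros)
qed

definition bounded_support :: "('a::real_normed_vector \<Rightarrow> complex) \<Rightarrow> bool" where
  "bounded_support f \<longleftrightarrow> bounded {p. f p \<noteq> 0}"

lemma frechet_derivative_outside_support:
  fixes f :: "'a::real_normed_vector \<Rightarrow> complex"
  assumes "p \<notin> closure {q. f q \<noteq> 0}"
  shows "frechet_derivative f (at p) v = 0"
proof -
  have "((\<lambda>q. 0) has_derivative (\<lambda>v. 0)) (at p)" by simp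
  moreover have "open (- closure {q. f q \<noteq> 0})" "p \<in> - closure {q. f q \<noteq> 0}" using assms by auto
  moreover have "0 = f q" if "q \<in> - closure {q. f q \<noteq> 0}" for q
    using that closure_subset[of "{q. f q \<noteq> 0}"] by auto
  ultimately have "(f has_derivative (\<lambda>v. 0)) (at p)"
    by (rule has_derivative_transform_within_open)
  then show ?thesis by (simp add: frechet_derivative_eqI)
qed

lemma continuous_bounded_support_bounded:
  fixes f :: "'a::euclidean_space \<Rightarrow> complex"
  assumes "continuous_on UNIV f" "bounded_support f"
  obtains B where "B \<ge> 0" "\<And>p. cmod (f p) \<le> B"
proof -
  let ?K = "closure {p. f p \<noteq> 0}"
  have "compact ?K" using assms(2) by (simp add: bounded_support_def compact_closure)
  then have "compact (f ` ?K)" by (rule compact_continuous_image[rotated]) (rule continuous_on_subset[OF assms(1)], simp)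
  then have "bounded (f ` ?K)" by (rule compact_imp_bounded)
  then obtain B where B: "\<And>p. p \<in> ?K \<Longrightarrow> cmod (f p) \<le> B" by (auto simp: bounded_iff)
  have "cmod (f p) \<le> max B 0" for p
    using B[of p] closure_subset[of "{p. f p \<noteq> 0}"] by (cases "f p = 0") (auto simp: le_max_iff_disj)
  then show ?thesis using that[of "max B 0"] by simp
qed

lemma integrable_cball_indicator:
  "integrable lborel (\<lambda>p. B * indicator (cball (0::'a::euclidean_space) R) p :: real)"
proof -
  have "emeasure lborel (cball (0::'a) R) < \<infinity>" by (rule emeasure_bounded_finite) simp
  then show ?thesis by (intro integrable_mult_right integrable_real_indicator) auto
qed

lemma integrable_bounded_support:
  fixes f :: "'a::euclidean_space \<Rightarrow> complex"
  assumes "continuous_on UNIV f" "bounded_support f"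
  shows "integrable lborel f"
proof -
  obtain B where B: "B \<ge> 0" "\<And>p. cmod (f p) \<le> B" using continuous_bounded_support_bounded[OF assms] by blast
  obtain R where R: "\<And>p. f p \<noteq> 0 \<Longrightarrow> norm p \<le> R" using assms(2) by (auto simp: bounded_support_def bounded_iff)
  show ?thesis
  proof (rule Bochner_Integration.integrable_bound)
    show "integrable lborel (\<lambda>p. B * indicator (cball (0::'a) R) p :: real)"
      by (rule integrable_cball_indicator)
    show "f \<in> borel_measurable lborel" using borel_measurable_continuous_onI[OF assms(1)] by simp
    show "AE p in lborel. norm (f p) \<le> norm (B * indicator (cball (0::'a) R) p :: real)"
    proof (rule AE_I2)
      fix p show "norm (f p) \<le> norm (B * indicator (cball (0::'a) R) p :: real)"
        using B R[of p] by (cases "f p = 0") (auto simp: indicator_def)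
    qed
  qed
qed

lemma C1fun_deriv_bounded_support:
  assumes "bounded_support f" shows "bounded_support (\<lambda>p. frechet_derivative f (at p) v)"
  unfolding bounded_support_def
proof (rule bounded_subset)
  show "bounded (closure {p. f p \<noteq> 0})" using assms by (auto simp: bounded_support_def)
  show "{p. frechet_derivative f (at p) v \<noteq> 0} \<subseteq> closure {p. f p \<noteq> 0}"
    using frechet_derivative_outside_support by blast
qed

lemma increment_bound:
  assumes f: "C1fun f" and B: "\<And>p. cmod (frechet_derivative f (at p) v) \<le> B"
  shows "cmod (f (p + s *\<^sub>R v) - f p) \<le> B * \<bar>s\<bar>"
proof -
  have "norm (f (p + s *\<^sub>R v) - f (p + 0 *\<^sub>R v)) \<le> B * norm (s - 0)"
  proof (rule differentiable_bound[of UNIV "\<lambda>s. f (p + s *\<^sub>R v)" "\<lambda>s d. d *\<^sub>R frechet_derivative f (at (p + s *\<^sub>R v)) v"])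
    fix t :: real
    have "((\<lambda>s. f (p + s *\<^sub>R v)) has_derivative (\<lambda>d. frechet_derivative f (at (p + t *\<^sub>R v)) (d *\<^sub>R v))) (at t)"
      by (rule has_derivative_compose[OF _ C1fun_deriv[OF f]]) (auto intro!: derivative_eq_intros)
    moreover have "linear (frechet_derivative f (at (p + t *\<^sub>R v)))"
      using C1fun_deriv[OF f] by (rule has_derivative_linear)
    ultimately show "((\<lambda>s. f (p + s *\<^sub>R v)) has_derivative (\<lambda>d. d *\<^sub>R frechet_derivative f (at (p + t *\<^sub>R v)) v)) (at t within UNIV)"
      by (simp add: linear_scale)
    show "onorm (\<lambda>d. d *\<^sub>R frechet_derivative f (at (p + t *\<^sub>R v)) v) \<le> B"
    proof (rule onorm_le)
      fix d :: real
      show "norm (d *\<^sub>R frechet_derivative f (at (p + t *\<^sub>R v)) v) \<le> B * norm d"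
        using mult_right_mono[OF B[of "p + t *\<^sub>R v"], of "\<bar>d\<bar>"] by (simp add: mult.commute)
    qed
  qed auto
  then show ?thesis by simp
qed

text \<open>By translation invariance of Lebesgue measure every difference quotient of f has
  integral zero; dominated convergence passes to the derivative. The direction v is arbitrary and no
  coordinates enter.\<close>

theorem integral_derivative_eq_0:
  fixes f :: "'a::euclidean_space \<Rightarrow> complex"
  assumes f: "C1fun f" and supp: "bounded_support f"
  shows "(LINT p|lborel. frechet_derivative f (at p) v) = 0"
proof -
  let ?D = "\<lambda>p. frechet_derivative f (at p) v"
  have contD: "continuous_on UNIV ?D" using f by (simp add: C1fun_def)
  obtain B where B: "B \<ge> 0" "\<And>p. cmod (?D p) \<le> B"
    using continuous_bounded_support_bounded[OF contD C1fun_deriv_bounded_support[OF supp]] by blast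
  obtain R where R: "\<And>p. f p \<noteq> 0 \<Longrightarrow> norm p \<le> R" using supp by (auto simp: bounded_support_def bounded_iff)
  define s where "s = (\<lambda>n. 1 / real (Suc n))"
  define g where "g = (\<lambda>n p. (f (p + s n *\<^sub>R v) - f p) /\<^sub>R s n)"
  have s: "s n > 0" "s n \<le> 1" for n by (auto simp: s_def)
  have fm [measurable]: "f \<in> borel_measurable borel"
    by (rule borel_measurable_continuous_onI[OF C1fun_continuous[OF f]])
  have Dm [measurable]: "?D \<in> borel_measurable borel" by (rule borel_measurable_continuous_onI[OF contD])
  have fi: "integrable lborel f" by (rule integrable_bounded_support[OF C1fun_continuous[OF f] supp])
  have tr: "integrable lborel (\<lambda>p. f (p + w))" "(LINT p|lborel. f (p + w)) = integral\<^sup>L lborel f" for w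
  proof -
    have "integrable (distr lborel borel ((+) w)) f" using fi by (simp add: lborel_distr_plus)
    then show "integrable lborel (\<lambda>p. f (p + w))" by (subst (asm) integrable_distr_eq) (auto simp: add.commute)
    have "integral\<^sup>L lborel f = integral\<^sup>L (distr lborel borel ((+) w)) f" by (simp add: lborel_distr_plus)
    also have "\<dots> = (LINT p|lborel. f (p + w))" by (subst integral_distr) (auto simp: add.commute)
    finally show "(LINT p|lborel. f (p + w)) = integral\<^sup>L lborel f" by simp
  qed
  have g0: "integral\<^sup>L lborel (g n) = 0" for n
    unfolding g_def using tr fi by simp
  have "(\<lambda>n. integral\<^sup>L lborel (g n)) \<longlonglongrightarrow> integral\<^sup>L lborel ?D"
  proof (rule integral_dominated_convergence)
    \<comment> \<open>As \<open>s n \<le> 1\<close>, all difference quotients vanish outside this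
      ball; inside, B bounds them by the mean value inequality.\<close>
    show "integrable lborel (\<lambda>p. B * indicator (cball (0::'a) (R + norm v)) p :: real)"
      by (rule integrable_cball_indicator)
    show "AE p in lborel. (\<lambda>n. g n p) \<longlonglongrightarrow> ?D p"
    proof (rule AE_I2)
      fix p
      have "((\<lambda>s. f (p + s *\<^sub>R v)) has_derivative (\<lambda>d. frechet_derivative f (at (p + 0 *\<^sub>R v)) (d *\<^sub>R v))) (at 0)"
        by (rule has_derivative_compose[OF _ C1fun_deriv[OF f]]) (auto intro!: derivative_eq_intros)
      moreover have "linear (frechet_derivative f (at p))"
        using C1fun_deriv[OF f] by (rule has_derivative_linear)
      ultimately have "((\<lambda>s. f (p + s *\<^sub>R v)) has_vector_derivative ?D p) (at 0)"
        by (simp add: linear_scale has_vector_derivative_def)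
      from has_vector_derivative_quotient[OF this]
      have "((\<lambda>s. (f (p + s *\<^sub>R v) - f p) /\<^sub>R s) \<longlongrightarrow> ?D p) (at 0)" by simp
      moreover have "filterlim s (at 0) sequentially"
        unfolding s_def filterlim_at using LIMSEQ_Suc[OF lim_1_over_n] by auto
      ultimately show "(\<lambda>n. g n p) \<longlonglongrightarrow> ?D p" unfolding g_def by (rule filterlim_compose)
    qed
    show "AE p in lborel. norm (g n p) \<le> B * indicator (cball (0::'a) (R + norm v)) p" for n
    proof (rule AE_I2)
      fix p
      show "norm (g n p) \<le> B * indicator (cball (0::'a) (R + norm v)) p"
      proof (cases "norm p \<le> R + norm v")
        case True
        then show ?thesis
          using increment_bound[OF f B(2), of p "s n"] s[of n] by (simp add: g_def divide_simps mult.commute)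
      next
        case False
        have "norm (s n *\<^sub>R v) \<le> norm v" using s[of n] by (simp add: mult_left_le_one_le)
        then have "norm (p + s n *\<^sub>R v) > R" using False norm_diff_ineq[of p "s n *\<^sub>R v"] by linarith
        moreover have "norm p > R" using False norm_ge_zero[of v] by linarith
        ultimately have "f p = 0" "f (p + s n *\<^sub>R v) = 0" using R[of p] R[of "p + s n *\<^sub>R v"] by linarith+
        then show ?thesis using B by (simp add: g_def)
      qed
    qed
  qed (auto simp: g_def)
  then show ?thesis by (simp add: g0 LIMSEQ_const_iff)
qed

lemma integral_by_parts:
  fixes f g :: "'a::euclidean_space \<Rightarrow> complex"
  assumes f: "C1fun f" and g: "C1fun g" and supp: "bounded_support g"
  shows "(LINT p|lborel. frechet_derivative f (at p) v * g p) =
       - (LINT p|lborel. f p * frechet_derivative g (at p) v)"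
proof -
  have s: "bounded_support (\<lambda>p. h p * g p)" "bounded_support (\<lambda>p. h p * frechet_derivative g (at p) v)" for h
    using supp C1fun_deriv_bounded_support[OF supp, of v]
    by (auto simp: bounded_support_def elim: bounded_subset)
  note c = C1fun_continuous[OF f] C1fun_continuous[OF g]
  have c': "continuous_on UNIV (\<lambda>p. frechet_derivative f (at p) v)" "continuous_on UNIV (\<lambda>p. frechet_derivative g (at p) v)"
    using f g by (simp_all add: C1fun_def)
  have i: "integrable lborel (\<lambda>p. frechet_derivative f (at p) v * g p)" "integrable lborel (\<lambda>p. f p * frechet_derivative g (at p) v)"
    by (intro integrable_bounded_support s continuous_on_mult c c')+
  have "0 = (LINT p|lborel. frechet_derivative (\<lambda>p. f p * g p) (at p) v)"
    by (rule integral_derivative_eq_0[symmetric]) (intro C1fun_mult f g s)+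
  also have "\<dots> = (LINT p|lborel. f p * frechet_derivative g (at p) v + frechet_derivative f (at p) v * g p)"
    using f g by (intro Bochner_Integration.integral_cong) (auto simp: frechet_derivative_mult' C1fun_def)
  finally show ?thesis using i by (simp add: add_eq_0_iff)
qed


section \<open>Smooth bump functions and the fundamental lemma\<close>

text \<open>Powers of 1/s are included to make the family closed under differentiation: exp(-1/s)
  contributes s^-2 and s^-n contributes -n/s.\<close>

definition bump :: "nat \<Rightarrow> real \<Rightarrow> real" where
  "bump n s = (if s \<le> 0 then 0 else exp (- (1 / s)) / s ^ n)"

lemma bump_tendsto_0: "(bump n \<longlongrightarrow> 0) (at 0)"
proof -
  have "((\<lambda>s. inverse s ^ n / exp (inverse s)) \<longlongrightarrow> (0::real)) (at_right 0)"
    using filterlim_compose[OF tendsto_power_div_exp_0 filterlim_inverse_at_top_right] by simp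
  moreover have "eventually (\<lambda>s. inverse s ^ n / exp (inverse s) = bump n s) (at_right (0::real))"
    by (auto simp: eventually_at_filter bump_def exp_minus field_simps)
  ultimately have "(bump n \<longlongrightarrow> 0) (at_right 0)" by (rule Lim_transform_eventually)
  moreover have "(bump n \<longlongrightarrow> 0) (at_left 0)"
    by (rule Lim_transform_eventually[OF tendsto_const]) (auto simp: eventually_at_filter bump_def)
  ultimately show ?thesis by (simp add: filterlim_at_split)
qed

lemma bump_has_derivative:
  "(bump n has_real_derivative (bump (n + 2) s - real n * bump (n + 1) s)) (at s)"
proof (cases s "0::real" rule: linorder_cases)
  case less
  have "((\<lambda>s. 0) has_real_derivative 0) (at s)" by simp
  then have "(bump n has_real_derivative 0) (at s)"
    by (rule has_field_derivative_transform_within_open[of _ _ _ "{..<0}"]) (use less in \<open>auto simp: bump_def\<close>)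
  then show ?thesis using less by (simp add: bump_def)
next
  case equal
  \<comment> \<open>At the origin the difference quotient is itself \<open>bump (Suc n)\<close>, so
    flatness of every member gives the derivative 0.\<close>
  have "((\<lambda>h. (bump n (0 + h) - bump n 0) / h) \<longlongrightarrow> 0) (at 0)"
    by (rule Lim_transform_eventually[OF bump_tendsto_0[of "Suc n"]])
       (auto simp: eventually_at_filter bump_def)
  then have "(bump n has_real_derivative 0) (at 0)" by (simp add: DERIV_def)
  then show ?thesis using equal by (simp add: bump_def)
next
  case greater
  have "((\<lambda>s. exp (- (1 / s)) / s ^ n) has_real_derivative
     exp (- (1 / s)) / s ^ (n + 2) - real n * (exp (- (1 / s)) / s ^ (n + 1))) (at s)"
    using greater
    by (auto intro!: derivative_eq_intros simp: power2_eq_square field_simps)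
       (cases n; simp add: field_simps)
  then have "(bump n has_real_derivative
     exp (- (1 / s)) / s ^ (n + 2) - real n * (exp (- (1 / s)) / s ^ (n + 1))) (at s)"
    by (rule has_field_derivative_transform_within_open[of _ _ _ "{0<..}"]) (use greater in \<open>auto simp: bump_def\<close>)
  then show ?thesis using greater by (simp add: bump_def)
qed

lemma bump_0_bounds: "0 \<le> bump 0 s" "bump 0 s \<le> 1"
  by (auto simp: bump_def)

lemma bump_0_eq_0_iff: "bump 0 s = 0 \<longleftrightarrow> s \<le> 0"
  by (auto simp: bump_def)

lemma bump_0_scaled_tendsto: "(\<lambda>m. bump 0 (real (Suc m) * s)) \<longlonglongrightarrow> (if s \<le> 0 then 0 else 1)"
proof (cases "s \<le> 0")
  case True
  then have "bump 0 (real (Suc m) * s) = 0" for m by (auto simp: bump_def mult_le_0_iff)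
  then show ?thesis using True by simp
next
  case False
  have "(\<lambda>m. exp (- ((1 / s) * (1 / real (Suc m))))) \<longlonglongrightarrow> exp (- ((1 / s) * 0))"
    by (intro tendsto_intros LIMSEQ_Suc lim_1_over_n)
  moreover have "bump 0 (real (Suc m) * s) = exp (- ((1 / s) * (1 / real (Suc m))))" for m
    using False by (auto simp: bump_def mult_le_0_iff)
  ultimately show ?thesis using False by simp
qed

text \<open>An algebra of functions that is closed under directional derivatives; all its members are therefore smooth.\<close>

inductive bump_algebra :: "('a::real_inner \<Rightarrow> complex) \<Rightarrow> bool" where
  const: "bump_algebra (\<lambda>p. c)"
| bump: "bump_algebra (\<lambda>p. of_real (bump n (p \<bullet> b + t)))"
| add: "bump_algebra f \<Longrightarrow> bump_algebra g \<Longrightarrow> bump_algebra (\<lambda>p. f p + g p)"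
| mult: "bump_algebra f \<Longrightarrow> bump_algebra g \<Longrightarrow> bump_algebra (\<lambda>p. f p * g p)"

lemma bump_algebra_deriv:
  "bump_algebra f \<Longrightarrow> \<exists>f'. (\<forall>p. (f has_derivative f' p) (at p)) \<and> (\<forall>v. bump_algebra (\<lambda>p. f' p v))"
proof (induction rule: bump_algebra.induct)
  case (const c)
  show ?case by (intro exI[of _ "\<lambda>p v. 0"]) (auto intro: bump_algebra.const)
next
  case (bump n b t)
  let ?f' = "\<lambda>p v. of_real (v \<bullet> b) * (of_real (bump (n + 2) (p \<bullet> b + t)) + of_real (- real n) * of_real (bump (n + 1) (p \<bullet> b + t))) :: complex"
  have "((\<lambda>p. complex_of_real (bump n (p \<bullet> b + t))) has_derivative ?f' p) (at p)" for p
  proof -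
    have "((\<lambda>p. bump n (p \<bullet> b + t)) has_derivative
        (\<lambda>v. (bump (n + 2) (p \<bullet> b + t) - real n * bump (n + 1) (p \<bullet> b + t)) * (v \<bullet> b))) (at p)"
      by (rule has_derivative_compose[of "\<lambda>p. p \<bullet> b + t" "\<lambda>v. v \<bullet> b" p UNIV "bump n",
            OF _ bump_has_derivative[unfolded has_field_derivative_def]])
         (auto intro!: derivative_eq_intros)
    from has_derivative_of_real[OF this, where 'a = complex] show ?thesis
      by (simp add: algebra_simps)
  qed
  moreover have "bump_algebra (\<lambda>p. ?f' p v)" for v
    by (intro bump_algebra.intros)
  ultimately show ?case by (intro exI[of _ ?f'] conjI allI) 
next
  case (add f g)
  then obtain f' g' where
    "\<And>p. (f has_derivative f' p) (at p)" "\<And>v. bump_algebra (\<lambda>p. f' p v)"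
    "\<And>p. (g has_derivative g' p) (at p)" "\<And>v. bump_algebra (\<lambda>p. g' p v)" by blast
  then show ?case
    by (intro exI[of _ "\<lambda>p v. f' p v + g' p v"] conjI allI has_derivative_add bump_algebra.intros)
next
  case (mult f g)
  then obtain f' g' where
    "\<And>p. (f has_derivative f' p) (at p)" "\<And>v. bump_algebra (\<lambda>p. f' p v)"
    "\<And>p. (g has_derivative g' p) (at p)" "\<And>v. bump_algebra (\<lambda>p. g' p v)" by blast
  then show ?case using mult.hyps
    by (intro exI[of _ "\<lambda>p v. f p * g' p v + f' p v * g p"] conjI allI has_derivative_mult bump_algebra.intros)
qed

lemma bump_algebra_Ck: "bump_algebra f \<Longrightarrow> Ck k f"
proof (induction k arbitrary: f)
  case 0
  then obtain f' where "\<And>p. (f has_derivative f' p) (at p)" using bump_algebra_deriv by blast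
  then show ?case by (auto intro!: continuous_at_imp_continuous_on has_derivative_continuous)
next
  case (Suc k)
  then obtain f' where f': "\<And>p. (f has_derivative f' p) (at p)" "\<And>v. bump_algebra (\<lambda>p. f' p v)"
    using bump_algebra_deriv by blast
  have eq: "frechet_derivative f (at p) = f' p" for p by (rule frechet_derivative_eqI[OF f'(1)])
  have "f differentiable (at p)" for p using f'(1) by (rule differentiableI)
  then show ?case using Suc.IH[OF f'(2)] unfolding Ck.simps eq by blast
qed

section \<open>Smooth bumps on boxes\<close>

text \<open>Two one-sided bumps per coordinate: the product is smooth, positive exactly on the open
  box, and tends pointwise to the indicator of the box as m grows.\<close>

definition box_bump :: "real \<Rightarrow> 'a::euclidean_space \<Rightarrow> 'a \<Rightarrow> 'a \<Rightarrow> real" where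
  "box_bump m a c p = (\<Prod>b\<in>Basis. bump 0 (m * (p \<bullet> b - a \<bullet> b)) * bump 0 (m * (c \<bullet> b - p \<bullet> b)))"

lemma bump_algebra_prod:
  "finite B \<Longrightarrow> (\<And>b. b \<in> B \<Longrightarrow> bump_algebra (f b)) \<Longrightarrow> bump_algebra (\<lambda>p. \<Prod>b\<in>B. f b p)"
  by (induction B rule: finite_induct) (auto intro: bump_algebra.intros)

lemma bump_algebra_box_bump: "bump_algebra (\<lambda>p. of_real (box_bump m a c p))"
proof -
  have "bump_algebra (\<lambda>p. \<Prod>b\<in>Basis. of_real (bump 0 (p \<bullet> (m *\<^sub>R b) + - (m * (a \<bullet> b)))) *
      of_real (bump 0 (p \<bullet> ((- m) *\<^sub>R b) + m * (c \<bullet> b))))"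
    by (intro bump_algebra_prod bump_algebra.intros) auto
  then show ?thesis by (simp add: box_bump_def algebra_simps)
qed

lemma box_bump_nonzero: "m > 0 \<Longrightarrow> box_bump m a c p \<noteq> 0 \<longleftrightarrow> p \<in> box a c"
  by (auto simp: box_bump_def bump_0_eq_0_iff mem_box mult_le_0_iff not_le)

lemma box_bump_bounds: "0 \<le> box_bump m a c p" "box_bump m a c p \<le> 1"
  unfolding box_bump_def
  by (auto intro!: prod_nonneg prod_le_1 mult_nonneg_nonneg mult_le_one simp: bump_0_bounds)

lemma box_bump_tendsto: "(\<lambda>m. box_bump (real (Suc m)) a c p) \<longlonglongrightarrow> indicator (box a c) p"
proof -
  have "(\<lambda>m. box_bump (real (Suc m)) a c p) \<longlonglongrightarrow>
      (\<Prod>b\<in>Basis. (if p \<bullet> b - a \<bullet> b \<le> 0 then 0 else 1) * (if c \<bullet> b - p \<bullet> b \<le> 0 then 0 else 1))"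
    unfolding box_bump_def by (intro tendsto_prod tendsto_mult bump_0_scaled_tendsto)
  also have "(\<Prod>b\<in>Basis. (if p \<bullet> b - a \<bullet> b \<le> 0 then 0 else 1) * (if c \<bullet> b - p \<bullet> b \<le> 0 then 0 else 1))
      = (indicator (box a c) p :: real)"
    by (auto simp: indicator_def mem_box intro!: prod.neutral) (force simp: not_le)+
  finally show ?thesis .
qed

lemma box_bump_test_function:
  assumes "m > 0" "cbox a c \<subseteq> \<Omega>"
  shows "(\<lambda>p. complex_of_real (box_bump m a c p)) \<in> test_functions \<Omega>"
proof -
  have eq: "{p. complex_of_real (box_bump m a c p) \<noteq> 0} = box a c"
    using box_bump_nonzero[OF assms(1)] by auto
  have sub: "closure (box a c) \<subseteq> cbox a c" by (rule closure_minimal[OF box_subset_cbox closed_cbox])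
  then have "compact (closure {p. complex_of_real (box_bump m a c p) \<noteq> 0})"
    unfolding eq by (simp only: compact_closure bounded_box)
  moreover have "closure {p. complex_of_real (box_bump m a c p) \<noteq> 0} \<subseteq> \<Omega>"
    unfolding eq using sub assms(2) by blast
  ultimately show ?thesis
    unfolding test_functions_def using bump_algebra_Ck[OF bump_algebra_box_bump] by blast
qed

section \<open>Functions with vanishing integrals over boxes\<close>

lemma sigma_finite_lebesgue: "sigma_finite_measure (lebesgue :: 'a::euclidean_space measure)"
proof
  obtain A :: "'a set set" where A: "countable A" "A \<subseteq> sets lborel" "\<Union>A = space lborel" "\<forall>a\<in>A. emeasure lborel a \<noteq> \<infinity>"
    using lborel.sigma_finite_countable by blast
  then have "emeasure lebesgue a \<noteq> \<infinity>" if "a \<in> A" for a using that by (auto simp: subset_eq)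
  then show "\<exists>A. countable A \<and> A \<subseteq> sets (lebesgue :: 'a measure) \<and> \<Union>A = space (lebesgue :: 'a measure) \<and>
      (\<forall>a\<in>A. emeasure lebesgue a \<noteq> \<infinity>)"
    using A by (intro exI[of _ A]) auto
qed

text \<open>Open boxes are stable under intersection and generate the Borel sets, so Dynkin's
  argument extends the vanishing to all Borel sets, and null sets extend it to Lebesgue sets. Then h
  has the same set integrals as 0.\<close>

lemma AE_zero_if_box_integrals_zero:
  fixes h :: "'a::euclidean_space \<Rightarrow> complex"
  assumes h: "integrable lebesgue h" and box: "\<And>a b. (LINT p:box a b|lebesgue. h p) = 0"
  shows "AE p in lebesgue. h p = 0"
proof -
  have si: "set_integrable lebesgue A h" if "A \<in> sets lebesgue" for A
    unfolding set_integrable_def using h that by (rule integrable_mult_indicator[rotated])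
  have all: "(LINT p|lebesgue. h p) = 0"
  proof -
    let ?B = "\<lambda>i::nat. box (- (real i *\<^sub>R One)) (real i *\<^sub>R One) :: 'a set"
    have "(\<lambda>i. LINT p:?B i|lebesgue. h p) \<longlonglongrightarrow> (LINT p:(\<Union>i. ?B i)|lebesgue. h p)"
    proof (intro set_integral_cont_up si)
      show "incseq ?B"
      proof (rule incseq_SucI)
        fix i show "?B i \<le> ?B (Suc i)" by (force simp: mem_box)
      qed
      show "(\<Union>i. ?B i) \<in> sets lebesgue" by (simp only: UN_box_eq_UNIV) simp
    qed simp
    then show ?thesis using box by (simp add: UN_box_eq_UNIV LIMSEQ_const_iff set_lebesgue_integral_def)
  qed
  have borel: "(LINT p:A|lebesgue. h p) = 0" if "A \<in> sets borel" for A :: "'a set"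
  proof -
    have "Int_stable (range (\<lambda>(a, b). box a b :: 'a set))" by (auto simp: Int_stable_def box_Int_box)
    moreover have "range (\<lambda>(a, b). box a b :: 'a set) \<subseteq> Pow UNIV" by simp
    moreover have "A \<in> sigma_sets UNIV (range (\<lambda>(a, b). box a b :: 'a set))"
      using that by (simp add: borel_eq_box)
    ultimately show ?thesis
    proof (induction rule: sigma_sets_induct_disjoint)
      case (basic A)
      then show ?case using box by auto
    next
      case empty
      then show ?case by (simp add: set_lebesgue_integral_def)
    next
      case (compl A)
      then have A: "A \<in> sets lebesgue" by (simp add: borel_eq_box)
      have "(LINT p:A \<union> (UNIV - A)|lebesgue. h p) = (LINT p:A|lebesgue. h p) + (LINT p:UNIV - A|lebesgue. h p)"
        using si[OF A] si[OF sets.compl_sets[OF A]] by (intro set_integral_Un) auto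
      moreover have "A \<union> (UNIV - A) = UNIV" by auto
      ultimately show ?case using compl.IH all by (simp add: set_lebesgue_integral_def)
    next
      case (union A)
      then have "A i \<in> sets borel" for i unfolding borel_eq_box by auto
      then have A: "A i \<in> sets lebesgue" for i by simp
      have "(LINT p:(\<Union>i. A i)|lebesgue. h p) = (\<Sum>i. LINT p:A i|lebesgue. h p)"
        by (rule lebesgue_integral_countable_add) (use A si union in \<open>auto simp: disjoint_family_on_def\<close>)
      then show ?case using union by simp
    qed
  qed
  have "(LINT p:A|lebesgue. h p) = 0" if A: "A \<in> sets lebesgue" for A
  proof -
    obtain S N N' where S: "A = S \<union> N" "N \<subseteq> N'" "N' \<in> null_sets lborel" "S \<in> sets lborel"
      using A by (rule sets_completionE)
    have ae: "AE p in lebesgue. p \<notin> N'" using S(3) by (intro AE_not_in null_sets_completionI)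
    have "(LINT p:A|lebesgue. h p) = (LINT p:S|lebesgue. h p)"
      unfolding set_lebesgue_integral_def
    proof (intro integral_cong_AE)
      show "(\<lambda>p. indicator A p *\<^sub>R h p) \<in> borel_measurable lebesgue"
        "(\<lambda>p. indicator S p *\<^sub>R h p) \<in> borel_measurable lebesgue"
        using si[of A] si[of S] A S(4) by (simp_all add: set_integrable_def borel_measurable_integrable)
      show "AE p in lebesgue. indicator A p *\<^sub>R h p = indicator S p *\<^sub>R h p"
        using ae
      proof eventually_elim
        case (elim p)
        then have "p \<in> A \<longleftrightarrow> p \<in> S" using S(1,2) by blast
        then show ?case by (simp add: indicator_def)
      qed
    qed
    then show ?thesis using borel[of S] S(4) by simp
  qed
  then show ?thesis
    using sigma_finite_measure.density_unique_banach[OF sigma_finite_lebesgue h, of "\<lambda>p. 0"]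
    by (simp add: set_lebesgue_integral_def)
qed

lemma L2_eq_sqint: "L2 \<Omega> = sqint (lebesgue_on \<Omega>)"
  by (simp add: L2_def sqint_def)

lemma integral_lebesgue_on:
  fixes f :: "'a::euclidean_space \<Rightarrow> 'b::{banach, second_countable_topology}"
  shows "open \<Omega> \<Longrightarrow> (LINT p|lebesgue_on \<Omega>. f p) = (LINT p|lebesgue. indicator \<Omega> p *\<^sub>R f p)"
  by (rule integral_restrict_space) simp

lemma AE_lebesgue_on_iff: "open \<Omega> \<Longrightarrow> (AE p in lebesgue_on \<Omega>. P p) \<longleftrightarrow> (AE p in lebesgue. p \<in> \<Omega> \<longrightarrow> P p)"
  by (rule AE_restrict_space_iff) simp

lemma indicator_sqint:
  assumes "open \<Omega>" "S \<in> sets lebesgue" "emeasure lebesgue S < \<infinity>"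
  shows "(\<lambda>p. indicator S p) \<in> sqint (lebesgue_on \<Omega>)"
proof (rule sqintI)
  have eq: "(cmod (indicator S p))\<^sup>2 = indicator S p" for p by (auto simp: indicator_def)
  have "integrable lebesgue (indicator S :: _ \<Rightarrow> real)"
    using assms by (intro integrable_real_indicator) auto
  then have "integrable lebesgue (\<lambda>p. indicator \<Omega> p *\<^sub>R (indicator S p :: real))"
    using assms(1) by (intro integrable_mult_indicator) auto
  then show "integrable (lebesgue_on \<Omega>) (\<lambda>p. (cmod (indicator S p))\<^sup>2)"
    unfolding eq using assms(1) by (subst integrable_restrict_space) auto
  show "indicator S \<in> borel_measurable (lebesgue_on \<Omega>)"
    using assms by (intro measurable_restrict_space1) auto
qed

lemma emeasure_lebesgue_cbox_finite: "emeasure lebesgue (cbox a b) < \<infinity>"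
  using emeasure_bounded_finite[OF bounded_cbox[of a b]] by simp

text \<open>Testing with box bumps and letting them sharpen shows that g has integral zero over
  every box with closure in \<Omega>. As g is only square-integrable, the conclusion is drawn on one
  closed box at a time, and countably many of these exhaust \<Omega>.\<close>

theorem fundamental_lemma_calculus_of_variations:
  assumes "open \<Omega>" and g: "g \<in> L2 \<Omega>"
    and zero: "\<And>\<phi>. \<phi> \<in> test_functions \<Omega> \<Longrightarrow> (LINT p|lebesgue_on \<Omega>. g p * \<phi> p) = 0"
  shows "AE p in lebesgue_on \<Omega>. g p = 0"
proof -
  let ?M = "lebesgue_on \<Omega>"
  have gS: "g \<in> sqint ?M" using g by (simp add: L2_eq_sqint)
  have [measurable]: "g \<in> borel_measurable ?M" using gS by (rule sqint_meas)
  have int: "integrable ?M (\<lambda>p. g p * indicator (cbox a b) p)" for a b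
    by (intro sqint_mult_integrable[OF gS] indicator_sqint emeasure_lebesgue_cbox_finite assms(1)) simp
  have box0: "(LINT p|?M. g p * indicator (box a b) p) = 0" if K: "cbox a b \<subseteq> \<Omega>" for a b
  proof -
    have [measurable]: "(\<lambda>p. indicator (box a b) p :: complex) \<in> borel_measurable ?M"
      by (intro measurable_restrict_space1 borel_measurable_indicator) simp
    have "(\<lambda>m. LINT p|?M. g p * of_real (box_bump (real (Suc m)) a b p)) \<longlonglongrightarrow>
        (LINT p|?M. g p * indicator (box a b) p)"
    proof (rule integral_dominated_convergence)
      show "integrable ?M (\<lambda>p. cmod (g p * indicator (cbox a b) p))" by (intro integrable_norm int)
      show "(\<lambda>p. g p * indicator (box a b) p) \<in> borel_measurable ?M"
        by measurable
      show "(\<lambda>p. g p * of_real (box_bump (real (Suc m)) a b p)) \<in> borel_measurable ?M" for m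
      proof (intro borel_measurable_times)
        have "continuous_on UNIV (\<lambda>p::heis. complex_of_real (box_bump (real (Suc m)) a b p))"
          using bump_algebra_Ck[OF bump_algebra_box_bump, where k = 0] by simp
        then show "(\<lambda>p. complex_of_real (box_bump (real (Suc m)) a b p)) \<in> borel_measurable ?M"
          by (intro measurable_restrict_space1 measurable_completion) (simp add: borel_measurable_continuous_onI)
      qed simp
      show "AE p in ?M. (\<lambda>m. g p * of_real (box_bump (real (Suc m)) a b p)) \<longlonglongrightarrow> g p * indicator (box a b) p"
      proof (rule AE_I2)
        fix p
        have "(\<lambda>m. g p * of_real (box_bump (real (Suc m)) a b p)) \<longlonglongrightarrow> g p * of_real (indicator (box a b) p)"
          by (intro tendsto_intros box_bump_tendsto)
        then show "(\<lambda>m. g p * of_real (box_bump (real (Suc m)) a b p)) \<longlonglongrightarrow> g p * indicator (box a b) p"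
          by (simp add: indicator_def of_bool_def split: if_splits)
      qed
      show "AE p in ?M. cmod (g p * of_real (box_bump (real (Suc m)) a b p)) \<le> cmod (g p * indicator (cbox a b) p)" for m
      proof (rule AE_I2)
        fix p
        show "cmod (g p * of_real (box_bump (real (Suc m)) a b p)) \<le> cmod (g p * indicator (cbox a b) p)"
          using box_bump_nonzero[of "real (Suc m)" a b p] box_bump_bounds[of "real (Suc m)" a b p] box_subset_cbox[of a b]
          by (cases "p \<in> box a b") (auto simp: norm_mult mult_left_le)
      qed
    qed
    then show ?thesis
      using zero[OF box_bump_test_function[OF _ K]] by (simp add: LIMSEQ_const_iff)
  qed
  have K0: "AE p in lebesgue. p \<in> cbox a b \<longrightarrow> g p = 0" if K: "cbox a b \<subseteq> \<Omega>" for a b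
  proof -
    have ind: "indicator \<Omega> p *\<^sub>R (g p * indicator S p) = g p * indicator S p" if "S \<subseteq> \<Omega>" for S p
      using that by (auto simp: indicator_def)
    define h where "h = (\<lambda>p. g p * indicator (cbox a b) p)"
    have "integrable lebesgue (\<lambda>p. indicator \<Omega> p *\<^sub>R (g p * indicator (cbox a b) p))"
      using int[of a b] assms(1) by (subst (asm) integrable_restrict_space) auto
    then have hi: "integrable lebesgue h" using ind[OF K] by (simp add: h_def)
    have "AE p in lebesgue. h p = 0"
    proof (rule AE_zero_if_box_integrals_zero[OF hi])
      fix u v :: heis
      \<comment> \<open>The integral of h over \<open>box u v\<close> is that of g over this smaller
        box, up to the null boundary of \<open>cbox a b\<close>. Unless it is empty, the closure of
        the smaller box lies in \<Omega>, as \<open>box0\<close> demands.\<close>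
      obtain u' v' where uv: "box u v \<inter> box a b = box u' v'" by (simp add: box_Int_box)
      have "cbox u' v' \<subseteq> \<Omega> \<or> box u' v' = {}"
      proof (cases "box u' v' = {}")
        case False
        then have "cbox u' v' = closure (box u' v')" by simp
        also have "\<dots> \<subseteq> cbox a b" using uv box_subset_cbox[of a b] by (intro closure_minimal) auto
        finally show ?thesis using K by blast
      qed simp
      have box_sub: "box u' v' \<subseteq> \<Omega>" using uv box_subset_cbox[of a b] K by blast
      have ae: "AE p in lebesgue. p \<notin> cbox a b - box a b"
      proof (intro AE_not_in)
        have "negligible (cbox a b - box a b)" by (rule negligible_frontier_interval)
        then show "cbox a b - box a b \<in> null_sets lebesgue" by (simp add: negligible_iff_null_sets)
      qed
      have "(LINT p:box u v|lebesgue. h p) = (LINT p|lebesgue. indicator \<Omega> p *\<^sub>R (g p * indicator (box u' v') p))"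
        unfolding set_lebesgue_integral_def ind[OF box_sub]
      proof (intro integral_cong_AE)
        show "(\<lambda>p. indicator (box u v) p *\<^sub>R h p) \<in> borel_measurable lebesgue"
          using hi by (intro borel_measurable_scaleR borel_measurable_indicator) auto
        have "(\<lambda>p. indicator (box u' v') p *\<^sub>R h p) \<in> borel_measurable lebesgue"
          using hi by (intro borel_measurable_scaleR borel_measurable_indicator) auto
        moreover have "indicator (box u' v') p *\<^sub>R h p = g p * indicator (box u' v') p" for p
          using uv box_subset_cbox[of a b] by (auto simp: h_def indicator_def)
        ultimately show "(\<lambda>p. g p * indicator (box u' v') p) \<in> borel_measurable lebesgue" by simp
        show "AE p in lebesgue. indicator (box u v) p *\<^sub>R h p = g p * indicator (box u' v') p"
          using ae
        proof eventually_elim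
          case (elim p)
          have "p \<in> box u' v' \<longleftrightarrow> p \<in> box u v \<and> p \<in> box a b" using uv by blast
          then show ?case using elim box_subset_cbox[of a b] by (auto simp: h_def indicator_def)
        qed
      qed
      also have "\<dots> = (LINT p|?M. g p * indicator (box u' v') p)"
        by (rule integral_lebesgue_on[OF assms(1), symmetric])
      also have "\<dots> = 0" using box0[of u' v'] \<open>cbox u' v' \<subseteq> \<Omega> \<or> box u' v' = {}\<close> by auto
      finally show "(LINT p:box u v|lebesgue. h p) = 0" .
    qed
    then show ?thesis
    proof eventually_elim
      case (elim p)
      then show ?case by (cases "p \<in> cbox a b") (simp_all add: h_def)
    qed
  qed
  obtain \<D> :: "heis set set" where D: "countable \<D>" "\<D> \<subseteq> Pow \<Omega>" "\<And>X. X \<in> \<D> \<Longrightarrow> \<exists>a b. X = cbox a b" "\<Union>\<D> = \<Omega>"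
    by (rule open_countable_Union_open_cbox[OF assms(1)]) blast
  have "AE p in lebesgue. \<forall>X\<in>\<D>. p \<in> X \<longrightarrow> g p = 0"
  proof (subst AE_ball_countable[OF D(1)], intro ballI)
    fix X assume "X \<in> \<D>"
    then obtain a b where "X = cbox a b" "cbox a b \<subseteq> \<Omega>" using D(2,3) by blast
    then show "AE p in lebesgue. p \<in> X \<longrightarrow> g p = 0" using K0 by simp
  qed
  then have "AE p in lebesgue. p \<in> \<Omega> \<longrightarrow> g p = 0"
    using D(4) by (elim eventually_mono) blast
  then show ?thesis by (simp add: AE_lebesgue_on_iff[OF assms(1)])
qed

text \<open>A box inside \<Omega> is cut into n slabs along the first coordinate:
  \<open>a' i\<close> moves the lower face up to the fraction i/n, \<open>b' i\<close> moves the
  upper face down to (i+1)/n. Bumps on disjoint slabs are independent, since each is nonzero on a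
  set of positive measure where the others vanish.\<close>

lemma test_functions_infinite_dimensional:
  assumes "open \<Omega>" "\<Omega> \<noteq> {}"
  shows "\<exists>f :: nat \<Rightarrow> heis \<Rightarrow> complex. (\<forall>i<n. f i \<in> test_functions \<Omega>) \<and>
     (\<forall>c. (AE p in lebesgue_on \<Omega>. (\<Sum>i<n. c i * f i p) = 0) \<longrightarrow> (\<forall>i<n. c i = 0))"
proof -
  obtain a b where ab: "box a b \<noteq> {}" "cbox a b \<subseteq> \<Omega>"
    using assms by (metis open_contains_cbox empty_iff ex_in_conv)
  define e :: heis where "e = (1, 0, 0)"
  have e: "e \<in> Basis" by (simp add: e_def Basis_prod_def zero_prod_def)
  have eb: "e \<bullet> k = (if k = e then 1 else 0)" if "k \<in> Basis" for k using that e by (simp add: inner_Basis)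
  define L where "L = (b - a) \<bullet> e"
  have lt: "a \<bullet> k < b \<bullet> k" if "k \<in> Basis" for k using ab(1) that by (simp add: box_ne_empty)
  have L: "L > 0" using lt[OF e] by (simp add: L_def inner_diff_left)
  define a' where "a' = (\<lambda>i. a + (real i / n * L) *\<^sub>R e)"
  define b' where "b' = (\<lambda>i. b - ((1 - real (Suc i) / n) * L) *\<^sub>R e)"
  have a'_in: "a' i \<bullet> k = a \<bullet> k + (if k = e then real i / n * L else 0)" if "k \<in> Basis" for i k
    using that by (simp add: a'_def inner_add_left eb)
  have b'_in: "b' i \<bullet> k = (if k = e then a \<bullet> e + real (Suc i) / n * L else b \<bullet> k)" if "k \<in> Basis" for i k
    using that by (simp add: b'_def inner_diff_left eb L_def algebra_simps)
  define f where "f = (\<lambda>i p. complex_of_real (box_bump 1 (a' i) (b' i) p))"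
  have ne: "box (a' i) (b' i) \<noteq> {}" if "i < n" for i
    using lt L that by (auto simp: box_ne_empty a'_in b'_in divide_strict_right_mono)
  have sub: "cbox (a' i) (b' i) \<subseteq> \<Omega>" if "i < n" for i
  proof -
    have "real (Suc i) / n * L \<le> 1 * L" using that L by (intro mult_right_mono) auto
    then have "cbox (a' i) (b' i) \<subseteq> cbox a b"
      using L e by (intro subset_box_imp) (auto simp: a'_in b'_in L_def inner_diff_left)
    with ab show ?thesis by blast
  qed
  have disj: "i = j" if p: "p \<in> box (a' i) (b' i)" "p \<in> box (a' j) (b' j)" and "i < n" for i j p
  proof -
    have n0: "n > 0" using \<open>i < n\<close> by simp
    have *: "real i / n * L < real (Suc j) / n * L" if "p \<in> box (a' i) (b' i)" "p \<in> box (a' j) (b' j)" for i j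
    proof -
      have "a' i \<bullet> e < p \<bullet> e" "p \<bullet> e < b' j \<bullet> e" using that e by (auto simp: mem_box)
      then show ?thesis using e by (simp add: a'_in b'_in)
    qed
    have "i < Suc j" if "real i / n * L < real (Suc j) / n * L" for i j :: nat
      using that L n0 by (simp add: divide_less_cancel mult_less_cancel_right)
    then show ?thesis using *[OF p] *[OF p(2,1)] by (metis less_Suc_eq_le order_antisym)
  qed
  have "c i = 0" if c: "AE p in lebesgue_on \<Omega>. (\<Sum>i<n. c i * f i p) = 0" and i: "i < n" for c i
  proof (rule ccontr)
    assume "c i \<noteq> 0"
    have "AE p in lebesgue. p \<in> \<Omega> \<longrightarrow> (\<Sum>i<n. c i * f i p) = 0"
      using c by (simp add: AE_lebesgue_on_iff[OF assms(1)])
    then have "AE p in lebesgue. p \<notin> box (a' i) (b' i)"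
    proof eventually_elim
      case (elim p)
      show ?case
      proof
        assume p: "p \<in> box (a' i) (b' i)"
        have "f j p = 0" if "j < n" "j \<noteq> i" for j
          using box_bump_nonzero[of 1 "a' j" "b' j" p] disj[OF p _ i, of j] that by (auto simp: f_def)
        then have "(\<Sum>j<n. c j * f j p) = (\<Sum>j\<in>{i}. c j * f j p)"
          using i by (intro sum.mono_neutral_right) auto
        moreover have "f i p \<noteq> 0" using box_bump_nonzero[of 1 "a' i" "b' i" p] p by (auto simp: f_def)
        moreover have "p \<in> \<Omega>" using p sub[OF i] box_subset_cbox by blast
        ultimately show False using elim \<open>c i \<noteq> 0\<close> by simp
      qed
    qed
    then have "box (a' i) (b' i) \<in> null_sets lebesgue" by (subst AE_iff_null_sets) auto
    then show False
      using open_not_negligible[OF open_box ne[OF i]] by (simp add: negligible_iff_null_sets)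
  qed
  moreover have "f i \<in> test_functions \<Omega>" if "i < n" for i
    unfolding f_def by (rule box_bump_test_function) (use sub[OF that] in auto)
  ultimately show ?thesis by blast
qed


section \<open>Weak derivatives along the two fields\<close>

text \<open>The condition $b \cdot w = 0$ makes the field divergence-free.\<close>

definition shear_field :: "(heis \<Rightarrow> heis) \<Rightarrow> bool" where
  "shear_field V \<longleftrightarrow> (\<exists>a b w. (\<forall>p. V p = a + (p \<bullet> w) *\<^sub>R b) \<and> b \<bullet> w = 0)"

lemma shear_field_X: "shear_field field_X"
  unfolding shear_field_def
  by (rule exI[of _ "(1, 0, 0)"], rule exI[of _ "(0, 0, 1)"], rule exI[of _ "(0, 2, 0)"]) auto

lemma shear_field_Y: "shear_field field_Y"
  unfolding shear_field_def
  by (rule exI[of _ "(0, 1, 0)"], rule exI[of _ "(0, 0, 1)"], rule exI[of _ "(- 2, 0, 0)"]) auto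

lemma C1fun_differentiable: "C1fun f \<Longrightarrow> f differentiable (at p)"
  unfolding C1fun_def by blast

lemma C1fun_deriv_continuous: "C1fun f \<Longrightarrow> continuous_on UNIV (\<lambda>p. frechet_derivative f (at p) v)"
  unfolding C1fun_def by blast

lemma C1fun_coordinate: "C1fun (\<lambda>p. complex_of_real (p \<bullet> w))"
  and frechet_derivative_coordinate: "frechet_derivative (\<lambda>p. complex_of_real (p \<bullet> w)) (at p) v = of_real (v \<bullet> w)"
proof -
  have d: "((\<lambda>p. complex_of_real (p \<bullet> w)) has_derivative (\<lambda>v. of_real (v \<bullet> w))) (at p)" for p
    by (auto intro!: derivative_eq_intros)
  show "C1fun (\<lambda>p. complex_of_real (p \<bullet> w))" by (rule C1funI[OF d]) simp
  show "frechet_derivative (\<lambda>p. complex_of_real (p \<bullet> w)) (at p) v = of_real (v \<bullet> w)"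
    by (simp add: frechet_derivative_eqI[OF d])
qed

definition field_deriv :: "(heis \<Rightarrow> heis) \<Rightarrow> (heis \<Rightarrow> complex) \<Rightarrow> heis \<Rightarrow> complex" where
  "field_deriv V f = (\<lambda>p. frechet_derivative f (at p) (V p))"

lemma field_deriv_expand:
  assumes "C1fun f" "\<And>p. V p = a + (p \<bullet> w) *\<^sub>R b"
  shows "field_deriv V f p = frechet_derivative f (at p) a + of_real (p \<bullet> w) * frechet_derivative f (at p) b"
proof -
  have "linear (frechet_derivative f (at p))" using C1fun_deriv[OF assms(1)] by (rule has_derivative_linear)
  then show ?thesis by (simp add: field_deriv_def assms(2) linear_add linear_scale scaleR_conv_of_real)
qed

lemma field_deriv_continuous:
  assumes "shear_field V" "C1fun f"
  shows "continuous_on UNIV (field_deriv V f)"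
proof -
  obtain a b w where V: "\<And>p. V p = a + (p \<bullet> w) *\<^sub>R b" using assms(1) by (auto simp: shear_field_def)
  have "field_deriv V f = (\<lambda>p. frechet_derivative f (at p) a + of_real (p \<bullet> w) * frechet_derivative f (at p) b)"
    using field_deriv_expand[OF assms(2) V] by auto
  then show ?thesis by (simp add: continuous_intros C1fun_deriv_continuous[OF assms(2)])
qed

lemma field_deriv_bounded_support:
  assumes "bounded_support f" shows "bounded_support (field_deriv V f)"
  unfolding bounded_support_def field_deriv_def
proof (rule bounded_subset)
  show "bounded (closure {p. f p \<noteq> 0})" using assms by (auto simp: bounded_support_def)
  show "{p. frechet_derivative f (at p) (V p) \<noteq> 0} \<subseteq> closure {p. f p \<noteq> 0}"
    using frechet_derivative_outside_support by blast
qed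

lemma bounded_support_mult: "bounded_support g \<Longrightarrow> bounded_support (\<lambda>p. f p * g p)"
  unfolding bounded_support_def by (erule bounded_subset) auto

lemma bounded_support_mult_left: "bounded_support g \<Longrightarrow> bounded_support (\<lambda>p. g p * f p)"
  unfolding bounded_support_def by (erule bounded_subset) auto

lemma field_deriv_mult:
  assumes "C1fun f" "C1fun g"
  shows "field_deriv V (\<lambda>p. f p * g p) p = f p * field_deriv V g p + field_deriv V f p * g p"
  using assms[THEN C1fun_differentiable] by (simp add: field_deriv_def frechet_derivative_mult')

lemma field_deriv_cnj:
  "C1fun f \<Longrightarrow> field_deriv V (\<lambda>p. cnj (f p)) p = cnj (field_deriv V f p)"
  by (simp add: field_deriv_def C1fun_differentiable frechet_derivative_cnj)

text \<open>Along constant directions this is \<open>integral_by_parts\<close>. The coefficient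
  \<open>p \<bullet> w\<close> is moved onto g; its derivative along b is
  \<open>b \<bullet> w = 0\<close>, so no zero-order term appears.\<close>

lemma field_by_parts:
  assumes V: "shear_field V" and f: "C1fun f" and g: "C1fun g" and supp: "bounded_support g"
  shows "(LINT p|lborel. field_deriv V f p * g p) = - (LINT p|lborel. f p * field_deriv V g p)"
proof -
  obtain a b w where V: "\<And>p. V p = a + (p \<bullet> w) *\<^sub>R b" and bw: "b \<bullet> w = 0"
    using V by (auto simp: shear_field_def)
  let ?c = "\<lambda>p. complex_of_real (p \<bullet> w)"
  let ?Da = "\<lambda>f p. frechet_derivative f (at p) a" and ?Db = "\<lambda>f p. frechet_derivative f (at p) b"
  have cg: "C1fun (\<lambda>p. ?c p * g p)" "bounded_support (\<lambda>p. ?c p * g p)"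
    by (intro C1fun_mult C1fun_coordinate g bounded_support_mult supp)+
  have Dcg: "?Db (\<lambda>p. ?c p * g p) p = ?c p * ?Db g p" for p
    using g by (simp add: frechet_derivative_mult' C1fun_differentiable C1fun_coordinate frechet_derivative_coordinate bw)
  have cont: "continuous_on UNIV f" "continuous_on UNIV g" "continuous_on UNIV (?Da f)" "continuous_on UNIV (?Db f)"
     "continuous_on UNIV (?Da g)" "continuous_on UNIV (?Db g)"
    by (intro C1fun_continuous C1fun_deriv_continuous f g)+
  have int: "integrable lborel (\<lambda>p. ?Da f p * g p)" "integrable lborel (\<lambda>p. ?Db f p * (?c p * g p))"
    "integrable lborel (\<lambda>p. f p * ?Da g p)" "integrable lborel (\<lambda>p. f p * (?c p * ?Db g p))"
    by (intro integrable_bounded_support continuous_intros cont bounded_support_mult supp C1fun_deriv_bounded_support)+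
  have "(LINT p|lborel. field_deriv V f p * g p) = (LINT p|lborel. ?Da f p * g p + ?Db f p * (?c p * g p))"
    by (intro Bochner_Integration.integral_cong refl) (simp add: field_deriv_expand[OF f V] algebra_simps)
  also have "\<dots> = (LINT p|lborel. ?Da f p * g p) + (LINT p|lborel. ?Db f p * (?c p * g p))"
    using int by simp
  also have "\<dots> = - (LINT p|lborel. f p * ?Da g p) - (LINT p|lborel. f p * (?c p * ?Db g p))"
    using integral_by_parts[OF f g supp, of a] integral_by_parts[OF f cg, of b] by (simp add: Dcg)
  also have "\<dots> = - (LINT p|lborel. f p * ?Da g p + f p * (?c p * ?Db g p))" using int by simp
  also have "(LINT p|lborel. f p * ?Da g p + f p * (?c p * ?Db g p)) = (LINT p|lborel. f p * field_deriv V g p)"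
    by (intro Bochner_Integration.integral_cong refl) (simp add: field_deriv_expand[OF g V] algebra_simps)
  finally show ?thesis .
qed

section \<open>Test functions and classical derivatives as weak ones\<close>

lemma test_function_C1: "\<phi> \<in> test_functions \<Omega> \<Longrightarrow> C1fun \<phi>"
proof -
  assume "\<phi> \<in> test_functions \<Omega>"
  then have "Ck (Suc 0) \<phi>" by (simp add: test_functions_def)
  then show ?thesis unfolding C1fun_def Ck.simps by blast
qed

lemma test_function_bounded_support: "\<phi> \<in> test_functions \<Omega> \<Longrightarrow> bounded_support \<phi>"
  unfolding test_functions_def bounded_support_def
  by (auto intro: bounded_subset[OF compact_imp_bounded closure_subset])

lemma test_function_outside:
  assumes "\<phi> \<in> test_functions \<Omega>" "p \<notin> \<Omega>"
  shows "\<phi> p = 0" "field_deriv V \<phi> p = 0"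
proof -
  have "p \<notin> closure {q. \<phi> q \<noteq> 0}" using assms unfolding test_functions_def by blast
  then show "\<phi> p = 0" "field_deriv V \<phi> p = 0"
    using closure_subset[of "{q. \<phi> q \<noteq> 0}"] by (auto simp: field_deriv_def frechet_derivative_outside_support)
qed

text \<open>Integration by parts is available for Borel functions on the whole space, while
  \<open>L2\<close> refers to the completed measure on \<Omega>. The integrands concerned contain a
  test function, so they vanish outside \<Omega>.\<close>

lemma integral_lebesgue_on_eq_lborel:
  fixes F :: "'a::euclidean_space \<Rightarrow> complex"
  assumes "open \<Omega>" "F \<in> borel_measurable borel" "\<And>p. p \<notin> \<Omega> \<Longrightarrow> F p = 0"
  shows "(LINT p|lebesgue_on \<Omega>. F p) = (LINT p|lborel. F p)"
proof -
  have "indicator \<Omega> p *\<^sub>R F p = F p" for p using assms(3) by (auto simp: indicator_def)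
  then show ?thesis using assms(2) by (simp add: integral_lebesgue_on[OF assms(1)] integral_completion)
qed

lemma bounded_support_sqint:
  fixes f :: "'a::euclidean_space \<Rightarrow> complex"
  assumes "open \<Omega>" "continuous_on UNIV f" "bounded_support f"
  shows "f \<in> sqint (lebesgue_on \<Omega>)"
proof (rule sqintI)
  have m: "f \<in> borel_measurable borel" by (rule borel_measurable_continuous_onI[OF assms(2)])
  then show "f \<in> borel_measurable (lebesgue_on \<Omega>)"
    by (intro measurable_restrict_space1 measurable_completion) simp
  have "integrable lborel (\<lambda>p. f p * cnj (f p))"
    by (intro integrable_bounded_support continuous_intros assms(2) bounded_support_mult_left assms(3))
  then have "integrable lborel (\<lambda>p. complex_of_real ((cmod (f p))\<^sup>2))" by (simp only: complex_norm_square)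
  then have "integrable lborel (\<lambda>p. (cmod (f p))\<^sup>2)" by (simp only: complex_of_real_integrable_eq)
  then have "integrable lebesgue (\<lambda>p. (cmod (f p))\<^sup>2)" using m by (subst integrable_completion) auto
  then have "integrable lebesgue (\<lambda>p. indicator \<Omega> p *\<^sub>R (cmod (f p))\<^sup>2)"
    using assms(1) by (intro integrable_mult_indicator) auto
  then show "integrable (lebesgue_on \<Omega>) (\<lambda>p. (cmod (f p))\<^sup>2)"
    using assms(1) by (subst integrable_restrict_space) auto
qed

lemma test_function_sqint:
  assumes "open \<Omega>" "\<phi> \<in> test_functions \<Omega>"
  shows "\<phi> \<in> sqint (lebesgue_on \<Omega>)"
    and "shear_field V \<Longrightarrow> field_deriv V \<phi> \<in> sqint (lebesgue_on \<Omega>)"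
proof -
  note C1 = test_function_C1[OF assms(2)] and supp = test_function_bounded_support[OF assms(2)]
  show "\<phi> \<in> sqint (lebesgue_on \<Omega>)"
    by (rule bounded_support_sqint[OF assms(1) C1fun_continuous[OF C1] supp])
  show "field_deriv V \<phi> \<in> sqint (lebesgue_on \<Omega>)" if "shear_field V"
    by (rule bounded_support_sqint[OF assms(1) field_deriv_continuous[OF that C1] field_deriv_bounded_support[OF supp]])
qed

lemma has_weak_deriv_iff: "has_weak_deriv \<Omega> V u g \<longleftrightarrow>
   (\<forall>\<phi>\<in>test_functions \<Omega>. (LINT p|lebesgue_on \<Omega>. g p * \<phi> p) = - (LINT p|lebesgue_on \<Omega>. u p * field_deriv V \<phi> p))"
  by (simp add: has_weak_deriv_def field_deriv_def)

lemma C1fun_has_weak_deriv: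
  assumes "open \<Omega>" "shear_field V" "C1fun f"
  shows "has_weak_deriv \<Omega> V f (field_deriv V f)"
  unfolding has_weak_deriv_iff
proof
  fix \<phi> assume \<phi>: "\<phi> \<in> test_functions \<Omega>"
  note c = C1fun_continuous[OF assms(3)] C1fun_continuous[OF test_function_C1[OF \<phi>]]
    field_deriv_continuous[OF assms(2,3)] field_deriv_continuous[OF assms(2) test_function_C1[OF \<phi>]]
  have "(LINT p|lebesgue_on \<Omega>. field_deriv V f p * \<phi> p) = (LINT p|lborel. field_deriv V f p * \<phi> p)"
    by (intro integral_lebesgue_on_eq_lborel assms(1) borel_measurable_continuous_onI continuous_intros c)
       (simp add: test_function_outside[OF \<phi>])
  also have "\<dots> = - (LINT p|lborel. f p * field_deriv V \<phi> p)"
    by (rule field_by_parts[OF assms(2,3) test_function_C1[OF \<phi>] test_function_bounded_support[OF \<phi>]])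
  also have "(LINT p|lborel. f p * field_deriv V \<phi> p) = (LINT p|lebesgue_on \<Omega>. f p * field_deriv V \<phi> p)"
    by (intro integral_lebesgue_on_eq_lborel[symmetric] assms(1) borel_measurable_continuous_onI continuous_intros c)
       (simp add: test_function_outside[OF \<phi>])
  finally show "(LINT p|lebesgue_on \<Omega>. field_deriv V f p * \<phi> p) = - (LINT p|lebesgue_on \<Omega>. f p * field_deriv V \<phi> p)" .
qed

lemma L2_inner_eq_sip: "L2_inner \<Omega> = sip (lebesgue_on \<Omega>)"
  by (simp add: L2_inner_def sip_def fun_eq_iff)

lemma L2_norm_eq: "u \<in> L2 \<Omega> \<Longrightarrow> L2_norm \<Omega> u = sqrt (sq.sq (lebesgue_on \<Omega>) u)"
  by (simp add: L2_norm_def sq_sq L2_eq_sqint)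

lemma borel_measurable_cnj: "f \<in> borel_measurable M \<Longrightarrow> (\<lambda>p. cnj (f p)) \<in> borel_measurable M"
  by (erule measurable_compose) (intro borel_measurable_continuous_onI continuous_intros)

lemma sip_cong_AE:
  assumes "AE p in M. u p = u' p" "AE p in M. v p = v' p"
    "u \<in> borel_measurable M" "u' \<in> borel_measurable M" "v \<in> borel_measurable M" "v' \<in> borel_measurable M"
  shows "sip M u v = sip M u' v'"
  unfolding sip_def
proof (rule integral_cong_AE)
  show "AE p in M. u p * cnj (v p) = u' p * cnj (v' p)" using assms(1,2) by eventually_elim simp
qed (use assms in \<open>simp_all add: borel_measurable_times borel_measurable_cnj\<close>)

section \<open>Functions with one weak derivative in \<open>L2\<close>\<close>

text \<open>One field at a time, so that X and Y share all proofs; \<open>S1 \<Omega>\<close> is the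
  intersection.\<close>

definition W1 :: "heis set \<Rightarrow> (heis \<Rightarrow> heis) \<Rightarrow> (heis \<Rightarrow> complex) set" where
  "W1 \<Omega> V = {u \<in> L2 \<Omega>. \<exists>g\<in>L2 \<Omega>. has_weak_deriv \<Omega> V u g}"

lemma S1_eq: "S1 \<Omega> = W1 \<Omega> field_X \<inter> W1 \<Omega> field_Y"
  by (auto simp: S1_def W1_def)

lemma weak_deriv_W1:
  assumes "u \<in> W1 \<Omega> V"
  shows "weak_deriv \<Omega> V u \<in> L2 \<Omega>" "has_weak_deriv \<Omega> V u (weak_deriv \<Omega> V u)"
proof -
  have "\<exists>g. g \<in> L2 \<Omega> \<and> has_weak_deriv \<Omega> V u g" using assms by (auto simp: W1_def)
  from someI_ex[OF this] show "weak_deriv \<Omega> V u \<in> L2 \<Omega>" "has_weak_deriv \<Omega> V u (weak_deriv \<Omega> V u)"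
    by (simp_all add: weak_deriv_def)
qed

lemma weak_deriv_unique:
  assumes "open \<Omega>" "g \<in> L2 \<Omega>" "g' \<in> L2 \<Omega>" "has_weak_deriv \<Omega> V u g" "has_weak_deriv \<Omega> V u g'"
  shows "AE p in lebesgue_on \<Omega>. g p = g' p"
proof -
  have "AE p in lebesgue_on \<Omega>. g p - g' p = 0"
  proof (rule fundamental_lemma_calculus_of_variations[OF assms(1)])
    show "(\<lambda>p. g p - g' p) \<in> L2 \<Omega>" using assms(2,3) by (simp add: L2_eq_sqint sqint_diff)
    fix \<phi> assume \<phi>: "\<phi> \<in> test_functions \<Omega>"
    have "integrable (lebesgue_on \<Omega>) (\<lambda>p. g p * \<phi> p)" "integrable (lebesgue_on \<Omega>) (\<lambda>p. g' p * \<phi> p)"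
      using assms test_function_sqint(1)[OF assms(1) \<phi>] by (auto simp: L2_eq_sqint intro!: sqint_mult_integrable)
    then show "(LINT p|lebesgue_on \<Omega>. (g p - g' p) * \<phi> p) = 0"
      using assms(4,5) \<phi> by (simp add: has_weak_deriv_iff left_diff_distrib)
  qed
  then show ?thesis by simp
qed

lemma weak_deriv_eq:
  assumes "open \<Omega>" "u \<in> L2 \<Omega>" "g \<in> L2 \<Omega>" "has_weak_deriv \<Omega> V u g"
  shows "u \<in> W1 \<Omega> V" "AE p in lebesgue_on \<Omega>. weak_deriv \<Omega> V u p = g p"
proof -
  show *: "u \<in> W1 \<Omega> V" using assms by (auto simp: W1_def)
  show "AE p in lebesgue_on \<Omega>. weak_deriv \<Omega> V u p = g p"
    by (rule weak_deriv_unique[OF assms(1) weak_deriv_W1(1)[OF *] assms(3) weak_deriv_W1(2)[OF *] assms(4)])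
qed

lemma has_weak_deriv_add:
  assumes "open \<Omega>" "shear_field V" "u \<in> L2 \<Omega>" "u' \<in> L2 \<Omega>" "g \<in> L2 \<Omega>" "g' \<in> L2 \<Omega>"
    "has_weak_deriv \<Omega> V u g" "has_weak_deriv \<Omega> V u' g'"
  shows "has_weak_deriv \<Omega> V (\<lambda>p. u p + u' p) (\<lambda>p. g p + g' p)"
  unfolding has_weak_deriv_iff
proof
  fix \<phi> assume \<phi>: "\<phi> \<in> test_functions \<Omega>"
  have "integrable (lebesgue_on \<Omega>) (\<lambda>p. g p * \<phi> p)" "integrable (lebesgue_on \<Omega>) (\<lambda>p. g' p * \<phi> p)"
    "integrable (lebesgue_on \<Omega>) (\<lambda>p. u p * field_deriv V \<phi> p)" "integrable (lebesgue_on \<Omega>) (\<lambda>p. u' p * field_deriv V \<phi> p)"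
    using assms test_function_sqint[OF assms(1) \<phi>] by (auto simp: L2_eq_sqint intro!: sqint_mult_integrable)
  then show "(LINT p|lebesgue_on \<Omega>. (g p + g' p) * \<phi> p) = - (LINT p|lebesgue_on \<Omega>. (u p + u' p) * field_deriv V \<phi> p)"
    using assms(7,8) \<phi> by (simp add: has_weak_deriv_iff distrib_right)
qed

lemma has_weak_deriv_scale:
  assumes "open \<Omega>" "has_weak_deriv \<Omega> V u g"
  shows "has_weak_deriv \<Omega> V (\<lambda>p. c * u p) (\<lambda>p. c * g p)"
  using assms(2) by (simp add: has_weak_deriv_iff mult.assoc)

lemma weak_deriv_add:
  assumes "open \<Omega>" "shear_field V" "u \<in> W1 \<Omega> V" "v \<in> W1 \<Omega> V"
  shows "u + v \<in> W1 \<Omega> V" "AE p in lebesgue_on \<Omega>. weak_deriv \<Omega> V (u + v) p = weak_deriv \<Omega> V u p + weak_deriv \<Omega> V v p"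
proof -
  have uv: "u \<in> L2 \<Omega>" "v \<in> L2 \<Omega>" using assms by (auto simp: W1_def)
  note u = weak_deriv_W1[OF assms(3)] and v = weak_deriv_W1[OF assms(4)]
  have "(\<lambda>p. u p + v p) \<in> L2 \<Omega>" "(\<lambda>p. weak_deriv \<Omega> V u p + weak_deriv \<Omega> V v p) \<in> L2 \<Omega>"
    using uv u v by (auto simp: L2_eq_sqint sqint_add)
  note * = weak_deriv_eq[OF assms(1) this has_weak_deriv_add[OF assms(1,2) uv u(1) v(1) u(2) v(2)]]
  show "u + v \<in> W1 \<Omega> V" "AE p in lebesgue_on \<Omega>. weak_deriv \<Omega> V (u + v) p = weak_deriv \<Omega> V u p + weak_deriv \<Omega> V v p"
    using * by (simp_all add: plus_fun_def)
qed

lemma weak_deriv_scale: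
  assumes "open \<Omega>" "u \<in> W1 \<Omega> V"
  shows "fscale c u \<in> W1 \<Omega> V" "AE p in lebesgue_on \<Omega>. weak_deriv \<Omega> V (fscale c u) p = c * weak_deriv \<Omega> V u p"
proof -
  have u: "u \<in> L2 \<Omega>" using assms by (auto simp: W1_def)
  note w = weak_deriv_W1[OF assms(2)]
  have "(\<lambda>p. c * u p) \<in> L2 \<Omega>" "(\<lambda>p. c * weak_deriv \<Omega> V u p) \<in> L2 \<Omega>"
    using u w by (auto simp: L2_eq_sqint sqint_scale)
  note * = weak_deriv_eq[OF assms(1) this has_weak_deriv_scale[OF assms(1) w(2)]]
  show "fscale c u \<in> W1 \<Omega> V" "AE p in lebesgue_on \<Omega>. weak_deriv \<Omega> V (fscale c u) p = c * weak_deriv \<Omega> V u p"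
    using * by (simp_all add: fscale_def)
qed

text \<open>\<open>weak_deriv\<close> picks a representative and is therefore linear only almost
  everywhere, by uniqueness; the inner product does not see the difference.\<close>

lemma semi_inner_W1:
  assumes "open \<Omega>" "shear_field V"
  shows "semi_inner (W1 \<Omega> V) fscale (\<lambda>u v. L2_inner \<Omega> (weak_deriv \<Omega> V u) (weak_deriv \<Omega> V v))"
  unfolding L2_inner_eq_sip
proof
  let ?M = "lebesgue_on \<Omega>" and ?W = "weak_deriv \<Omega> V"
  have WS: "?W u \<in> sqint ?M" if "u \<in> W1 \<Omega> V" for u using weak_deriv_W1(1)[OF that] by (simp add: L2_eq_sqint)
  note Wm = sqint_meas[OF WS]
  have "C1fun (\<lambda>p. 0)" by (rule C1funI[of _ "\<lambda>p v. 0"]) auto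
  from C1fun_has_weak_deriv[OF assms this] have "has_weak_deriv \<Omega> V (\<lambda>p. 0) (\<lambda>p. 0)"
    by (simp add: field_deriv_def)
  then show "0 \<in> W1 \<Omega> V" using sqint_zero[of ?M] by (auto simp: W1_def L2_eq_sqint zero_fun_def)
  show "fscale (- 1) u = - u" for u :: "heis \<Rightarrow> complex" by (simp add: fscale_def fun_eq_iff)
  fix u assume u: "u \<in> W1 \<Omega> V"
  note Wu = WS[OF u]
  show "fscale c u \<in> W1 \<Omega> V" for c by (rule weak_deriv_scale(1)[OF assms(1) u])
  show "0 \<le> Re (sip ?M (?W u) (?W u))" using sq.nonneg[OF Wu] .
  fix v assume v: "v \<in> W1 \<Omega> V"
  note Wv = WS[OF v]
  show "u + v \<in> W1 \<Omega> V" by (rule weak_deriv_add(1)[OF assms u v])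
  show "sip ?M (?W v) (?W u) = cnj (sip ?M (?W u) (?W v))" by (rule sq.herm[OF Wu Wv])
  show "sip ?M (?W (fscale c u)) (?W v) = c * sip ?M (?W u) (?W v)" for c
  proof -
    have "sip ?M (?W (fscale c u)) (?W v) = sip ?M (fscale c (?W u)) (?W v)"
      using weak_deriv_scale[OF assms(1) u, of c] Wm sqint_meas[OF sq.sc_mem[OF Wu, of c]] Wv v
      by (intro sip_cong_AE) (auto simp: fscale_def)
    then show ?thesis by (simp add: sq.sc_left[OF Wu Wv])
  qed
  fix w assume w: "w \<in> W1 \<Omega> V"
  note Ww = WS[OF w]
  show "sip ?M (?W (u + v)) (?W w) = sip ?M (?W u) (?W w) + sip ?M (?W v) (?W w)"
  proof -
    have "sip ?M (?W (u + v)) (?W w) = sip ?M (?W u + ?W v) (?W w)"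
      using weak_deriv_add[OF assms u v] Wm sqint_meas[OF sq.add_mem[OF Wu Wv]] w
      by (intro sip_cong_AE) auto
    then show ?thesis by (simp add: sq.add_left[OF Wu Wv Ww])
  qed
qed


section \<open>The Sobolev spaces\<close>

lemma semi_inner_subspace:
  assumes "semi_inner V sc h" "V' \<subseteq> V" "0 \<in> V'" "\<And>u v. u \<in> V' \<Longrightarrow> v \<in> V' \<Longrightarrow> u + v \<in> V'"
    "\<And>c u. u \<in> V' \<Longrightarrow> sc c u \<in> V'"
  shows "semi_inner V' sc h"
proof -
  interpret semi_inner V sc h by fact
  show ?thesis
    by unfold_locales (use assms(2-5) in \<open>auto simp: sc_minus_one subset_eq intro!: add_left sc_left herm nonneg\<close>)
qed

lemma sum_fun_apply: "(sum f I) p = (\<Sum>i\<in>I. f i p)" for f :: "'i \<Rightarrow> 'a \<Rightarrow> 'b::comm_monoid_add"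
  by (induction I rule: infinite_finite_induct) auto

lemma sq_cong_AE:
  assumes "AE p in M. u p = v p" "u \<in> sqint M" "v \<in> sqint M"
  shows "sq.sq M u = sq.sq M v"
  unfolding sq.sq_def
  by (intro arg_cong[where f = Re] sip_cong_AE sqint_meas assms)

lemma closed_subset_of_compact:
  fixes K :: "'a::heine_borel set"
  assumes "compact K" "closure S \<subseteq> K" shows "compact (closure S)"
  unfolding compact_eq_bounded_closed
  using bounded_subset[OF compact_imp_bounded[OF assms(1)] assms(2)] closed_closure by (rule conjI)

lemma sq_diff_cong_AE:
  assumes "AE p in M. u p = u' p" "AE p in M. v p = v' p" "u \<in> sqint M" "u' \<in> sqint M" "v \<in> sqint M" "v' \<in> sqint M"
  shows "sq.sq M (u - v) = sq.sq M (u' - v')"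
proof (rule sq_cong_AE)
  show "AE p in M. (u - v) p = (u' - v') p" using assms(1,2) by eventually_elim simp
qed (use assms in simp_all)

lemma weak_deriv_diff:
  assumes "open \<Omega>" "shear_field V" "u \<in> W1 \<Omega> V" "v \<in> W1 \<Omega> V"
  shows "sq.sq (lebesgue_on \<Omega>) (weak_deriv \<Omega> V (u - v)) = sq.sq (lebesgue_on \<Omega>) (weak_deriv \<Omega> V u - weak_deriv \<Omega> V v)"
proof (rule sq_cong_AE)
  interpret semi_inner "W1 \<Omega> V" fscale "\<lambda>u v. L2_inner \<Omega> (weak_deriv \<Omega> V u) (weak_deriv \<Omega> V v)"
    by (rule semi_inner_W1[OF assms(1,2)])
  have eq: "u - v = u + fscale (- 1) v" by (simp add: fscale_def fun_eq_iff)
  show "AE p in lebesgue_on \<Omega>. weak_deriv \<Omega> V (u - v) p = (weak_deriv \<Omega> V u - weak_deriv \<Omega> V v) p"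
    using weak_deriv_add(2)[OF assms(1-3) weak_deriv_scale(1)[OF assms(1,4), of "-1"]]
      weak_deriv_scale(2)[OF assms(1,4), of "-1"] unfolding eq
    by eventually_elim simp
  show "weak_deriv \<Omega> V (u - v) \<in> sqint (lebesgue_on \<Omega>)"
    using weak_deriv_W1(1)[OF diff_mem[OF assms(3,4)]] by (simp add: L2_eq_sqint)
  show "weak_deriv \<Omega> V u - weak_deriv \<Omega> V v \<in> sqint (lebesgue_on \<Omega>)"
    using weak_deriv_W1(1)[OF assms(3)] weak_deriv_W1(1)[OF assms(4)] by (simp add: L2_eq_sqint)
qed

text \<open>For a fixed test function both sides of the defining identity are pairings with fixed
  square-integrable functions, hence continuous in \<open>L2\<close>. So the weak derivative is a
  closed operator.\<close>

lemma weak_deriv_limit: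
  assumes "open \<Omega>" "shear_field V" and L2: "\<And>n. u n \<in> L2 \<Omega>" "\<And>n. g n \<in> L2 \<Omega>" "v \<in> L2 \<Omega>" "k \<in> L2 \<Omega>"
    and wd: "\<And>n. has_weak_deriv \<Omega> V (u n) (g n)"
    and lim: "(\<lambda>n. sq.sq (lebesgue_on \<Omega>) (u n - v)) \<longlonglongrightarrow> 0" "(\<lambda>n. sq.sq (lebesgue_on \<Omega>) (g n - k)) \<longlonglongrightarrow> 0"
  shows "has_weak_deriv \<Omega> V v k"
  unfolding has_weak_deriv_iff
proof
  fix \<phi> assume \<phi>: "\<phi> \<in> test_functions \<Omega>"
  let ?M = "lebesgue_on \<Omega>"
  note L = L2[unfolded L2_eq_sqint]
  have eq: "(LINT p|?M. f p * \<psi> p) = sip ?M f (\<lambda>p. cnj (\<psi> p))" for f \<psi> by (simp add: sip_def)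
  have "(\<lambda>n. sip ?M (g n) (\<lambda>p. cnj (\<phi> p))) \<longlonglongrightarrow> sip ?M k (\<lambda>p. cnj (\<phi> p))"
    by (rule sq.h_tendsto[OF L(2,4) sqint_cnj[OF test_function_sqint(1)[OF assms(1) \<phi>]] lim(2)])
  moreover have "(\<lambda>n. - sip ?M (u n) (\<lambda>p. cnj (field_deriv V \<phi> p))) \<longlonglongrightarrow> - sip ?M v (\<lambda>p. cnj (field_deriv V \<phi> p))"
    by (intro tendsto_minus sq.h_tendsto[OF L(1,3) sqint_cnj[OF test_function_sqint(2)[OF assms(1) \<phi> assms(2)]] lim(1)])
  moreover have "sip ?M (g n) (\<lambda>p. cnj (\<phi> p)) = - sip ?M (u n) (\<lambda>p. cnj (field_deriv V \<phi> p))" for n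
    using wd[of n] \<phi> by (simp add: has_weak_deriv_iff eq)
  ultimately show "(LINT p|?M. k p * \<phi> p) = - (LINT p|?M. v p * field_deriv V \<phi> p)"
    by (simp add: eq LIMSEQ_unique)
qed

locale heis_open =
  fixes \<Omega> :: "heis set"
  assumes open_\<Omega>: "open \<Omega>"
begin

abbreviation "M \<equiv> lebesgue_on \<Omega>"
abbreviation "X \<equiv> weak_deriv \<Omega> field_X"
abbreviation "Y \<equiv> weak_deriv \<Omega> field_Y"

lemma S1_sqint: "u \<in> S1 \<Omega> \<Longrightarrow> u \<in> sqint M" "u \<in> S1 \<Omega> \<Longrightarrow> X u \<in> sqint M" "u \<in> S1 \<Omega> \<Longrightarrow> Y u \<in> sqint M"
  using weak_deriv_W1(1) by (auto simp: S1_eq W1_def L2_eq_sqint[symmetric])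

lemma semi_inner_L2_inner: "semi_inner (S1 \<Omega>) fscale (L2_inner \<Omega>)"
  and semi_inner_sub_form: "semi_inner (S1 \<Omega>) fscale (sub_form \<Omega>)"
proof -
  interpret X: semi_inner "W1 \<Omega> field_X" fscale "\<lambda>u v. L2_inner \<Omega> (X u) (X v)"
    by (rule semi_inner_W1[OF open_\<Omega> shear_field_X])
  interpret Y: semi_inner "W1 \<Omega> field_Y" fscale "\<lambda>u v. L2_inner \<Omega> (Y u) (Y v)"
    by (rule semi_inner_W1[OF open_\<Omega> shear_field_Y])
  have sub: "0 \<in> S1 \<Omega>" "\<And>u v. u \<in> S1 \<Omega> \<Longrightarrow> v \<in> S1 \<Omega> \<Longrightarrow> u + v \<in> S1 \<Omega>" "\<And>c u. u \<in> S1 \<Omega> \<Longrightarrow> fscale c u \<in> S1 \<Omega>"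
    by (auto simp: S1_eq)
  show "semi_inner (S1 \<Omega>) fscale (L2_inner \<Omega>)"
    unfolding L2_inner_eq_sip
    by (rule semi_inner_subspace[OF semi_inner_sqint]) (use sub S1_sqint in auto)
  have "semi_inner (S1 \<Omega>) fscale (\<lambda>u v. L2_inner \<Omega> (X u) (X v) + L2_inner \<Omega> (Y u) (Y v))"
    by (intro semi_inner_add semi_inner_subspace[OF X.semi_inner_axioms] semi_inner_subspace[OF Y.semi_inner_axioms] sub)
       (auto simp: S1_eq)
  then show "semi_inner (S1 \<Omega>) fscale (sub_form \<Omega>)" unfolding sub_form_def .
qed

sublocale h: semi_inner "S1 \<Omega>" fscale "L2_inner \<Omega>" by (rule semi_inner_L2_inner)
sublocale a: semi_inner "S1 \<Omega>" fscale "sub_form \<Omega>" by (rule semi_inner_sub_form)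
sublocale n: semi_inner "S1 \<Omega>" fscale "\<lambda>u v. sub_form \<Omega> u v + L2_inner \<Omega> u v"
  by (rule semi_inner_add[OF semi_inner_L2_inner semi_inner_sub_form])

lemma h_sq: "h.sq u = sq.sq M u"
  by (simp add: h.sq_def sq.sq_def L2_inner_eq_sip)

lemma a_sq: "a.sq u = sq.sq M (X u) + sq.sq M (Y u)"
  by (simp add: a.sq_def sq.sq_def L2_inner_eq_sip sub_form_def)

lemma n_sq: "n.sq u = a.sq u + h.sq u"
  by (simp add: a.sq_def n.sq_def h.sq_def)

lemma S1_norm_eq: "u \<in> S1 \<Omega> \<Longrightarrow> S1_norm \<Omega> u = sqrt (n.sq u)"
  using S1_sqint[of u] by (simp add: S1_norm_def L2_norm_eq L2_eq_sqint n_sq a_sq h_sq)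

lemma a_sq_diff:
  assumes "u \<in> S1 \<Omega>" "v \<in> S1 \<Omega>"
  shows "a.sq (u - v) = sq.sq M (X u - X v) + sq.sq M (Y u - Y v)"
  using assms by (simp add: a_sq S1_eq weak_deriv_diff[OF open_\<Omega>] shear_field_X shear_field_Y)

text \<open>Riesz-Fischer gives limits of u n, X (u n) and Y (u n) separately; closedness of the
  weak derivatives identifies the last two as derivatives of the first.\<close>

lemma S1_complete:
  assumes u: "\<And>n. u n \<in> S1 \<Omega>"
    and cauchy: "\<And>\<epsilon>. \<epsilon> > 0 \<Longrightarrow> \<exists>N. \<forall>m\<ge>N. \<forall>n\<ge>N::nat. a.sq (u m - u n) + h.sq (u m - u n) < \<epsilon>"
  shows "\<exists>v\<in>S1 \<Omega>. (\<lambda>n. a.sq (u n - v)) \<longlonglongrightarrow> 0 \<and> (\<lambda>n. h.sq (u n - v)) \<longlonglongrightarrow> 0"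
proof -
  note s = S1_sqint[OF u]
  have nn: "0 \<le> sq.sq M (X (u m) - X (u n))" "0 \<le> sq.sq M (Y (u m) - Y (u n))" "0 \<le> sq.sq M (u m - u n)" for m n
    using s by simp_all
  have *: "\<exists>N. \<forall>m\<ge>N. \<forall>n\<ge>N. sq.sq M (u m - u n) < \<epsilon> \<and> sq.sq M (X (u m) - X (u n)) < \<epsilon> \<and> sq.sq M (Y (u m) - Y (u n)) < \<epsilon>"
    if "\<epsilon> > 0" for \<epsilon>
  proof -
    obtain N where N: "\<forall>m\<ge>N. \<forall>n\<ge>N. a.sq (u m - u n) + h.sq (u m - u n) < \<epsilon>" using cauchy[OF \<open>\<epsilon> > 0\<close>] by blast
    show ?thesis
    proof (intro exI[of _ N] allI impI)
      fix m n assume "m \<ge> N" "n \<ge> N"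
      with N have "a.sq (u m - u n) + h.sq (u m - u n) < \<epsilon>" by blast
      then show "sq.sq M (u m - u n) < \<epsilon> \<and> sq.sq M (X (u m) - X (u n)) < \<epsilon> \<and> sq.sq M (Y (u m) - Y (u n)) < \<epsilon>"
        unfolding a_sq_diff[OF u u] h_sq using nn[of m n] by linarith
    qed
  qed
  obtain v where v: "v \<in> sqint M" "(\<lambda>n. sq.sq M (u n - v)) \<longlonglongrightarrow> 0"
    using riesz_fischer[of u M] s(1) * by (metis (no_types, lifting))
  obtain g where g: "g \<in> sqint M" "(\<lambda>n. sq.sq M (X (u n) - g)) \<longlonglongrightarrow> 0"
    using riesz_fischer[of "\<lambda>n. X (u n)" M] s(2) * by (metis (no_types, lifting))
  obtain k where k: "k \<in> sqint M" "(\<lambda>n. sq.sq M (Y (u n) - k)) \<longlonglongrightarrow> 0"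
    using riesz_fischer[of "\<lambda>n. Y (u n)" M] s(3) * by (metis (no_types, lifting))
  have uW: "u n \<in> W1 \<Omega> field_X" "u n \<in> W1 \<Omega> field_Y" for n using u by (auto simp: S1_eq)
  have wX: "has_weak_deriv \<Omega> field_X v g"
    by (rule weak_deriv_limit[OF open_\<Omega> shear_field_X _ _ _ _ weak_deriv_W1(2)[OF uW(1)] v(2) g(2)])
       (use s v g in \<open>simp_all add: L2_eq_sqint\<close>)
  have wY: "has_weak_deriv \<Omega> field_Y v k"
    by (rule weak_deriv_limit[OF open_\<Omega> shear_field_Y _ _ _ _ weak_deriv_W1(2)[OF uW(2)] v(2) k(2)])
       (use s v k in \<open>simp_all add: L2_eq_sqint\<close>)
  note L = v(1)[folded L2_eq_sqint] g(1)[folded L2_eq_sqint] k(1)[folded L2_eq_sqint]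
  note X' = weak_deriv_eq[OF open_\<Omega> L(1,2) wX] and Y' = weak_deriv_eq[OF open_\<Omega> L(1,3) wY]
  have vS: "v \<in> S1 \<Omega>" using X' Y' by (simp add: S1_eq)
  have "sq.sq M (X (u n) - X v) = sq.sq M (X (u n) - g)" for n
    using X'(2) s g S1_sqint[OF vS] by (intro sq_diff_cong_AE) simp_all
  moreover have "sq.sq M (Y (u n) - Y v) = sq.sq M (Y (u n) - k)" for n
    using Y'(2) s k S1_sqint[OF vS] by (intro sq_diff_cong_AE) simp_all
  ultimately have "a.sq (u n - v) = sq.sq M (X (u n) - g) + sq.sq M (Y (u n) - k)" for n
    using a_sq_diff[OF u vS] by simp
  then have "(\<lambda>n. a.sq (u n - v)) \<longlonglongrightarrow> 0" using tendsto_add[OF g(2) k(2)] by simp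
  then show ?thesis using vS v(2) by (auto simp: h_sq)
qed

lemma C1fun_weak_deriv:
  assumes "shear_field V" "C1fun f" "f \<in> sqint M" "field_deriv V f \<in> sqint M"
  shows "f \<in> W1 \<Omega> V" "AE p in M. weak_deriv \<Omega> V f p = field_deriv V f p"
  using weak_deriv_eq[OF open_\<Omega> _ _ C1fun_has_weak_deriv[OF open_\<Omega> assms(1,2)]] assms by (auto simp: L2_eq_sqint)

lemma C1fun_S1:
  assumes "C1fun f" "f \<in> sqint M" "field_deriv field_X f \<in> sqint M" "field_deriv field_Y f \<in> sqint M"
  shows "f \<in> S1 \<Omega>" 
  using C1fun_weak_deriv(1) shear_field_X shear_field_Y assms by (auto simp: S1_eq)

lemma test_function_S1: "\<phi> \<in> test_functions \<Omega> \<Longrightarrow> \<phi> \<in> S1 \<Omega>"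
  by (intro C1fun_S1 test_function_C1 test_function_sqint[OF open_\<Omega>] shear_field_X shear_field_Y)

lemma test_function_weak_deriv:
  assumes "\<phi> \<in> test_functions \<Omega>" "shear_field V"
  shows "AE p in M. weak_deriv \<Omega> V \<phi> p = field_deriv V \<phi> p"
  using assms by (intro C1fun_weak_deriv(2) test_function_C1 test_function_sqint[OF open_\<Omega>])

section \<open>The closure of the test functions\<close>

lemma S1_0_iff: "u \<in> S1_0 \<Omega> \<longleftrightarrow> u \<in> S1 \<Omega> \<and> (\<forall>\<epsilon>>0. \<exists>\<phi>\<in>test_functions \<Omega>. sqrt (n.sq (u - \<phi>)) < \<epsilon>)"
proof -
  have "S1_norm \<Omega> (\<lambda>p. u p - \<phi> p) = sqrt (n.sq (u - \<phi>))" if "u \<in> S1 \<Omega>" "\<phi> \<in> test_functions \<Omega>" for \<phi>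
    using S1_norm_eq[OF n.diff_mem[OF that(1) test_function_S1[OF that(2)]]] by (simp add: fun_diff_def)
  then show ?thesis by (auto simp: S1_0_def)
qed

lemma S1_0_sub: "u \<in> S1_0 \<Omega> \<Longrightarrow> u \<in> S1 \<Omega>"
  by (simp add: S1_0_iff)

lemma test_function_S1_0: "\<phi> \<in> test_functions \<Omega> \<Longrightarrow> \<phi> \<in> S1_0 \<Omega>"
  unfolding S1_0_iff by (auto intro!: test_function_S1 bexI[of _ \<phi>] simp: n.sq_def)

lemma test_function_sum:
  assumes "\<phi> \<in> test_functions \<Omega>" "\<psi> \<in> test_functions \<Omega>"
  shows "\<phi> + \<psi> \<in> test_functions \<Omega>"
proof -
  have Ck: "Ck k (\<lambda>p. f p + g p)" if "Ck k f" "Ck k g" for k and f g :: "heis \<Rightarrow> complex"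
    using that
  proof (induction k arbitrary: f g)
    case 0
    then show ?case by (simp add: continuous_on_add)
  next
    case (Suc k)
    have d: "f differentiable (at p)" "g differentiable (at p)" for p using Suc.prems unfolding Ck.simps by blast+
    have "frechet_derivative (\<lambda>p. f p + g p) (at p) v = frechet_derivative f (at p) v + frechet_derivative g (at p) v" for p v
      using frechet_derivative_eqI[OF has_derivative_add[OF d[THEN frechet_derivative_works[THEN iffD1]]]] by simp
    then show ?case using Suc d unfolding Ck.simps by (auto intro: differentiable_add)
  qed
  let ?K = "closure {p. \<phi> p \<noteq> 0} \<union> closure {p. \<psi> p \<noteq> 0}"
  have K: "compact ?K" "?K \<subseteq> \<Omega>" using assms unfolding test_functions_def by blast+
  have "closure {p. (\<phi> + \<psi>) p \<noteq> 0} \<subseteq> ?K"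
    unfolding closure_Un[symmetric] by (rule closure_mono) auto
  then have "compact (closure {p. (\<phi> + \<psi>) p \<noteq> 0})" "closure {p. (\<phi> + \<psi>) p \<noteq> 0} \<subseteq> \<Omega>"
    using closed_subset_of_compact[OF K(1)] K(2) by blast+
  then show ?thesis using assms Ck unfolding test_functions_def plus_fun_def by blast
qed

lemma test_function_scale:
  assumes "\<phi> \<in> test_functions \<Omega>"
  shows "fscale c \<phi> \<in> test_functions \<Omega>"
proof -
  have Ck: "Ck k (\<lambda>p. c * f p)" if "Ck k f" for k and f :: "heis \<Rightarrow> complex"
    using that
  proof (induction k arbitrary: f)
    case 0
    then show ?case by (simp add: continuous_on_mult)
  next
    case (Suc k)
    have d: "f differentiable (at p)" for p using Suc.prems unfolding Ck.simps by blast
    have d': "((\<lambda>p. c * f p) has_derivative (\<lambda>v. c * frechet_derivative f (at p) v)) (at p)" for p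
      using has_derivative_mult_right[OF d[THEN frechet_derivative_works[THEN iffD1]]] .
    have "frechet_derivative (\<lambda>p. c * f p) (at p) v = c * frechet_derivative f (at p) v" for p v
      using frechet_derivative_eqI[OF d'] by simp
    moreover have "(\<lambda>p. c * f p) differentiable (at p)" for p using d' by (rule differentiableI)
    ultimately show ?case using Suc unfolding Ck.simps by simp
  qed
  have sub: "closure {p. fscale c \<phi> p \<noteq> 0} \<subseteq> closure {p. \<phi> p \<noteq> 0}"
    by (rule closure_mono) (auto simp: fscale_def)
  moreover have K: "compact (closure {p. \<phi> p \<noteq> 0})" "closure {p. \<phi> p \<noteq> 0} \<subseteq> \<Omega>"
    using assms unfolding test_functions_def by blast+
  ultimately have "compact (closure {p. fscale c \<phi> p \<noteq> 0})" "closure {p. fscale c \<phi> p \<noteq> 0} \<subseteq> \<Omega>"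
    using closed_subset_of_compact by blast+
  then show ?thesis using assms Ck unfolding test_functions_def fscale_def by blast
qed

lemma test_function_zero: "0 \<in> test_functions \<Omega>"
proof -
  have "Ck k (\<lambda>p. 0)" for k by (rule bump_algebra_Ck) (rule bump_algebra.const)
  then show ?thesis by (simp add: test_functions_def zero_fun_def)
qed

lemma S1_0_subspace:
  "0 \<in> S1_0 \<Omega>" "u \<in> S1_0 \<Omega> \<Longrightarrow> v \<in> S1_0 \<Omega> \<Longrightarrow> u + v \<in> S1_0 \<Omega>" "u \<in> S1_0 \<Omega> \<Longrightarrow> fscale c u \<in> S1_0 \<Omega>"
proof -
  show "0 \<in> S1_0 \<Omega>" by (rule test_function_S1_0[OF test_function_zero])
  assume u: "u \<in> S1_0 \<Omega>"
  show "u + v \<in> S1_0 \<Omega>" if v: "v \<in> S1_0 \<Omega>"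
    unfolding S1_0_iff
  proof (intro conjI allI impI)
    show "u + v \<in> S1 \<Omega>" using u v by (simp add: S1_0_sub)
    fix \<epsilon> :: real assume "\<epsilon> > 0"
    then have "\<epsilon> / 2 > 0" by simp
    with u v have "\<exists>\<phi>\<in>test_functions \<Omega>. sqrt (n.sq (u - \<phi>)) < \<epsilon> / 2"
      "\<exists>\<psi>\<in>test_functions \<Omega>. sqrt (n.sq (v - \<psi>)) < \<epsilon> / 2"
      unfolding S1_0_iff by (blast, blast)
    then obtain \<phi> \<psi> where \<phi>: "\<phi> \<in> test_functions \<Omega>" "\<psi> \<in> test_functions \<Omega>"
       and lt: "sqrt (n.sq (u - \<phi>)) < \<epsilon> / 2" "sqrt (n.sq (v - \<psi>)) < \<epsilon> / 2" by blast
    have eq: "u + v - (\<phi> + \<psi>) = (u - \<phi>) + (v - \<psi>)" by simp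
    have "sqrt (n.sq (u + v - (\<phi> + \<psi>))) \<le> sqrt (n.sq (u - \<phi>)) + sqrt (n.sq (v - \<psi>))"
      unfolding eq using n.norm_triangle[of "u - \<phi>" "v - \<psi>"] u v \<phi> by (simp add: S1_0_sub test_function_S1)
    then have "sqrt (n.sq (u + v - (\<phi> + \<psi>))) < \<epsilon>" using lt by simp
    then show "\<exists>\<phi>\<in>test_functions \<Omega>. sqrt (n.sq (u + v - \<phi>)) < \<epsilon>"
      using test_function_sum[OF \<phi>] by blast
  qed
  show "fscale c u \<in> S1_0 \<Omega>"
    unfolding S1_0_iff
  proof (intro conjI allI impI)
    show "fscale c u \<in> S1 \<Omega>" using u by (simp add: S1_0_sub)
    fix \<epsilon> :: real assume "\<epsilon> > 0"
    then have "\<epsilon> / (cmod c + 1) > 0" by (simp add: add_nonneg_pos)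
    then obtain \<phi> where \<phi>: "\<phi> \<in> test_functions \<Omega>" and lt: "sqrt (n.sq (u - \<phi>)) < \<epsilon> / (cmod c + 1)"
      using u unfolding S1_0_iff by blast
    have "fscale c u - fscale c \<phi> = fscale c (u - \<phi>)" by (simp add: fscale_def fun_eq_iff algebra_simps)
    then have "sqrt (n.sq (fscale c u - fscale c \<phi>)) = cmod c * sqrt (n.sq (u - \<phi>))"
      using u \<phi> by (simp add: n.sq_sc S1_0_sub test_function_S1 real_sqrt_mult)
    also have "\<dots> \<le> cmod c * (\<epsilon> / (cmod c + 1))" using lt by (intro mult_left_mono) auto
    also have "\<dots> < \<epsilon>"
    proof -
      have "0 < 1 + cmod c" by (rule add_pos_nonneg) auto
      then show ?thesis using \<open>\<epsilon> > 0\<close> by (simp add: field_simps)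
    qed
    finally show "\<exists>\<phi>\<in>test_functions \<Omega>. sqrt (n.sq (fscale c u - \<phi>)) < \<epsilon>"
      using test_function_scale[OF \<phi>] by blast
  qed
qed

lemma S1_0_closed:
  assumes u: "\<And>n. u n \<in> S1_0 \<Omega>" and v: "v \<in> S1 \<Omega>" and lim: "(\<lambda>n. n.sq (u n - v)) \<longlonglongrightarrow> 0"
  shows "v \<in> S1_0 \<Omega>"
  unfolding S1_0_iff
proof (intro conjI allI impI v)
  fix \<epsilon> :: real assume "\<epsilon> > 0"
  have "(\<lambda>n. sqrt (n.sq (u n - v))) \<longlonglongrightarrow> 0" using tendsto_real_sqrt[OF lim] by simp
  then have "\<forall>\<^sub>F n in sequentially. sqrt (n.sq (u n - v)) < \<epsilon> / 2" by (rule order_tendstoD) (use \<open>\<epsilon> > 0\<close> in simp)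
  then obtain k where k: "sqrt (n.sq (u k - v)) < \<epsilon> / 2" by (auto simp: eventually_sequentially)
  obtain \<phi> where \<phi>: "\<phi> \<in> test_functions \<Omega>" "sqrt (n.sq (u k - \<phi>)) < \<epsilon> / 2"
    using u[of k] half_gt_zero[OF \<open>\<epsilon> > 0\<close>] unfolding S1_0_iff by blast
  have "n.sq (v - u k) = n.sq (u k - v)"
    using n.herm[of "u k" v] u[of k] v by (simp add: n.sq_diff S1_0_sub)
  moreover have "sqrt (n.sq (v - \<phi>)) \<le> sqrt (n.sq (v - u k)) + sqrt (n.sq (u k - \<phi>))"
    using n.norm_triangle[of "v - u k" "u k - \<phi>"] u[of k] v \<phi> by (simp add: S1_0_sub test_function_S1)
  ultimately show "\<exists>\<phi>\<in>test_functions \<Omega>. sqrt (n.sq (v - \<phi>)) < \<epsilon>" using \<phi> k by (intro bexI[of _ \<phi>]) auto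
qed

text \<open>The three limits are stated with the classical derivatives of the test functions,
  because integration by parts and dilation are carried out on these before passing to the
  limit.\<close>

lemma S1_0_approx:
  assumes "u \<in> S1_0 \<Omega>"
  obtains \<phi> where "\<And>n::nat. \<phi> n \<in> test_functions \<Omega>" "(\<lambda>n. sq.sq M (\<phi> n - u)) \<longlonglongrightarrow> 0"
    "(\<lambda>n. sq.sq M (field_deriv field_X (\<phi> n) - X u)) \<longlonglongrightarrow> 0"
    "(\<lambda>n. sq.sq M (field_deriv field_Y (\<phi> n) - Y u)) \<longlonglongrightarrow> 0"
proof -
  have uS: "u \<in> S1 \<Omega>" using assms by (rule S1_0_sub)
  have "\<forall>n. \<exists>\<phi>. \<phi> \<in> test_functions \<Omega> \<and> sqrt (n.sq (u - \<phi>)) < 1 / real (Suc n)"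
    using assms unfolding S1_0_iff by (simp add: Bex_def)
  from choice[OF this] obtain \<phi> where
    \<phi>: "\<And>n. \<phi> n \<in> test_functions \<Omega>" "\<And>n. sqrt (n.sq (u - \<phi> n)) < 1 / real (Suc n)" by blast
  have \<phi>S: "\<phi> n \<in> S1 \<Omega>" for n using \<phi>(1) by (rule test_function_S1)
  have "(\<lambda>n. sqrt (n.sq (u - \<phi> n))) \<longlonglongrightarrow> 0"
    by (rule tendsto_sandwich[OF _ _ tendsto_const LIMSEQ_Suc[OF lim_1_over_n]])
       (use \<phi>(2) uS \<phi>S in \<open>auto intro!: always_eventually less_imp_le\<close>)
  from tendsto_power[OF this, of 2] have n0: "(\<lambda>n. n.sq (u - \<phi> n)) \<longlonglongrightarrow> 0"
    using uS \<phi>S by simp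
  have eq: "n.sq (u - \<phi> n) = sq.sq M (\<phi> n - u) + sq.sq M (field_deriv field_X (\<phi> n) - X u) + sq.sq M (field_deriv field_Y (\<phi> n) - Y u)" for n
  proof -
    have "n.sq (u - \<phi> n) = n.sq (\<phi> n - u)"
      using n.herm[of u "\<phi> n"] uS \<phi>S[of n] by (simp add: n.sq_diff)
    moreover have "sq.sq M (X (\<phi> n) - X u) = sq.sq M (field_deriv field_X (\<phi> n) - X u)"
      using test_function_weak_deriv[OF \<phi>(1)[of n] shear_field_X] S1_sqint[OF uS] S1_sqint[OF \<phi>S[of n]]
        test_function_sqint(2)[OF open_\<Omega> \<phi>(1)[of n] shear_field_X]
      by (intro sq_diff_cong_AE) simp_all
    moreover have "sq.sq M (Y (\<phi> n) - Y u) = sq.sq M (field_deriv field_Y (\<phi> n) - Y u)"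
      using test_function_weak_deriv[OF \<phi>(1)[of n] shear_field_Y] S1_sqint[OF uS] S1_sqint[OF \<phi>S[of n]]
        test_function_sqint(2)[OF open_\<Omega> \<phi>(1)[of n] shear_field_Y]
      by (intro sq_diff_cong_AE) simp_all
    ultimately show ?thesis using a_sq_diff[OF \<phi>S[of n] uS] by (simp add: n_sq h_sq)
  qed
  have nn: "0 \<le> sq.sq M (\<phi> n - u)" "0 \<le> sq.sq M (field_deriv field_X (\<phi> n) - X u)" "0 \<le> sq.sq M (field_deriv field_Y (\<phi> n) - Y u)" for n
    using S1_sqint[OF uS] test_function_sqint[OF open_\<Omega> \<phi>(1)[of n]] shear_field_X shear_field_Y by simp_all
  show ?thesis
  proof (rule that[OF \<phi>(1)])
    show "(\<lambda>n. sq.sq M (\<phi> n - u)) \<longlonglongrightarrow> 0"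
      by (rule tendsto_sandwich[OF _ _ tendsto_const n0]) (use nn eq in \<open>auto intro!: always_eventually\<close>)
    show "(\<lambda>n. sq.sq M (field_deriv field_X (\<phi> n) - X u)) \<longlonglongrightarrow> 0"
      by (rule tendsto_sandwich[OF _ _ tendsto_const n0]) (use nn eq in \<open>auto intro!: always_eventually\<close>)
    show "(\<lambda>n. sq.sq M (field_deriv field_Y (\<phi> n) - Y u)) \<longlonglongrightarrow> 0"
      by (rule tendsto_sandwich[OF _ _ tendsto_const n0]) (use nn eq in \<open>auto intro!: always_eventually\<close>)
  qed
qed

end


section \<open>Eigenvalue enumerations\<close>

text \<open>Steinitz exchange: if m > n members of one basis are written in terms of n others, a
  nontrivial combination of them vanishes almost everywhere. This makes multiplicities well
  defined.\<close>

lemma L2_basis_card_le: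
  assumes e: "L2_basis \<Omega> E n e" and f: "L2_basis \<Omega> E m f"
  shows "m \<le> n"
proof (rule ccontr)
  let ?M = "lebesgue_on \<Omega>"
  assume "\<not> m \<le> n"
  then have nm: "n < m" by simp
  have "\<forall>j. \<exists>c. j < m \<longrightarrow> (AE p in ?M. f j p = (\<Sum>i<n. c i * e i p))"
    using e f unfolding L2_basis_def by blast
  from choice[OF this] obtain C where C: "\<And>j. j < m \<Longrightarrow> AE p in ?M. f j p = (\<Sum>i<n. C j i * e i p)" by blast
  obtain c where c: "\<exists>j<m. c j \<noteq> 0" "\<And>i. i < n \<Longrightarrow> (\<Sum>j<m. C j i * c j) = 0"
    using homogeneous_system_nontrivial[OF nm, of "\<lambda>i j. C j i"] by blast
  have "AE p in ?M. \<forall>j\<in>{..<m}. f j p = (\<Sum>i<n. C j i * e i p)"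
    using C by (subst AE_ball_countable) auto
  then have "AE p in ?M. (\<Sum>j<m. c j * f j p) = 0"
  proof eventually_elim
    case (elim p)
    have "(\<Sum>j<m. c j * f j p) = (\<Sum>j<m. \<Sum>i<n. c j * (C j i * e i p))"
      using elim by (intro sum.cong) (simp_all add: sum_distrib_left)
    also have "\<dots> = (\<Sum>i<n. \<Sum>j<m. c j * (C j i * e i p))" by (rule sum.swap)
    also have "\<dots> = (\<Sum>i<n. (\<Sum>j<m. C j i * c j) * e i p)"
      by (intro sum.cong) (simp_all add: sum_distrib_left mult_ac)
    also have "\<dots> = 0" using c(2) by (intro sum.neutral) simp
    finally show ?case .
  qed
  then show False using f c(1) unfolding L2_basis_def by blast
qed

lemma L2_has_dim_unique: "L2_has_dim \<Omega> E n \<Longrightarrow> L2_has_dim \<Omega> E m \<Longrightarrow> m = n"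
  unfolding L2_has_dim_def using L2_basis_card_le by (meson order_antisym)

text \<open>At the first index k where the sequences differ, let l k be the smaller value. By
  monotonicity l' takes this value only before k, where both agree; so its fibre under l' is a
  proper subset of that under l, against the equal cardinalities.\<close>

lemma incseq_eq_if_fibres_eq:
  fixes l l' :: "nat \<Rightarrow> real"
  assumes inc: "incseq l" "incseq l'" and fin: "\<And>\<mu>. finite {k. l k = \<mu>}" "\<And>\<mu>. finite {k. l' k = \<mu>}"
    and card: "\<And>\<mu>. card {k. l k = \<mu>} = card {k. l' k = \<mu>}"
  shows "l = l'"
proof -
  have key: "\<not> l k < l' k"
    if inc: "incseq l'" and eq: "\<And>i. i < k \<Longrightarrow> l i = l' i"
      and fin: "finite {i. l i = l k}" and card: "card {i. l i = l k} = card {i. l' i = l k}"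
    for l l' :: "nat \<Rightarrow> real" and k
  proof
    assume lt: "l k < l' k"
    have "{i. l' i = l k} \<subset> {i. l i = l k}"
    proof
      show "{i. l' i = l k} \<subseteq> {i. l i = l k}"
      proof
        fix i assume i: "i \<in> {i. l' i = l k}"
        have "i < k"
        proof (rule ccontr)
          assume "\<not> i < k"
          then have "l' k \<le> l' i" using inc by (simp add: incseq_def)
          with i lt show False by simp
        qed
        then show "i \<in> {i. l i = l k}" using i eq[of i] by simp
      qed
      show "{i. l' i = l k} \<noteq> {i. l i = l k}" using lt by (metis (mono_tags, lifting) less_irrefl mem_Collect_eq)
    qed
    from psubset_card_mono[OF fin this] card show False by simp
  qed
  have "l k = l' k" for k
  proof (induction k rule: less_induct)
    case (less k)
    show ?case
      using key[of l' k l] key[of l k l'] less inc fin card by (metis linorder_cases)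
  qed
  then show ?thesis by blast
qed

lemma eigenvalue_enumeration_unique:
  assumes "eigenvalue_enumeration \<Omega> A l" "eigenvalue_enumeration \<Omega> A l'"
  shows "l' = l"
proof (rule incseq_eq_if_fibres_eq)
  show "card {k. l' k = \<mu>} = card {k. l k = \<mu>}" for \<mu>
    using assms unfolding eigenvalue_enumeration_def by (blast intro: L2_has_dim_unique)
qed (use assms in \<open>simp_all add: eigenvalue_enumeration_def\<close>)

lemma nth_eigenvalue_eq:
  assumes "eigenvalue_enumeration \<Omega> A l"
  shows "nth_eigenvalue \<Omega> A j = l (j - 1)"
proof -
  have "(THE l. eigenvalue_enumeration \<Omega> A l) = l"
    by (intro the_equality eigenvalue_enumeration_unique[OF assms] assms)
  then show ?thesis by (simp add: nth_eigenvalue_def)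
qed

text \<open>The e k with \<open>l k = \<mu>\<close> form a basis of the eigenspace: orthonormality
  gives independence, \<open>eigenvector_expansion\<close> gives spanning. When \<mu> is not a value
  of l, this says that the eigenspace contains only null functions.\<close>

lemma eigenvalue_enumeration_form_operator:
  assumes cf: "compact_form D fscale (L2_inner \<Omega>) (sub_form \<Omega>)" and D: "D \<subseteq> L2 \<Omega>"
    and es: "compact_form.eigensystem D (L2_inner \<Omega>) (sub_form \<Omega>) e l"
  shows "eigenvalue_enumeration \<Omega> (form_operator \<Omega> D) l"
proof -
  interpret compact_form D fscale "L2_inner \<Omega>" "sub_form \<Omega>" by fact
  have eD: "e k \<in> D" and on: "L2_inner \<Omega> (e i) (e k) = (if i = k then 1 else 0)" and inc: "incseq l"
    and eig: "\<And>v. v \<in> D \<Longrightarrow> sub_form \<Omega> (e k) v = of_real (l k) * L2_inner \<Omega> (e k) v" for i k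
    using es by (auto simp: eigensystem_def)
  have DS: "u \<in> sqint (lebesgue_on \<Omega>)" if "u \<in> D" for u using D that by (auto simp: L2_eq_sqint)
  have h_sq: "h.sq u = sq.sq (lebesgue_on \<Omega>) u" for u
    by (simp add: h.sq_def sq.sq_def L2_inner_eq_sip)
  have sc: "L2_inner \<Omega> (\<lambda>p. c * u p) v = c * L2_inner \<Omega> u v" if "u \<in> D" "v \<in> D" for c u v
    using h.sc_left[of u v c] that by (auto simp: fscale_def)
  have es_iff: "u \<in> eigenspace (form_operator \<Omega> D) \<mu> \<longleftrightarrow>
      u \<in> D \<and> (\<forall>v\<in>D. sub_form \<Omega> u v = of_real \<mu> * L2_inner \<Omega> u v)" for u \<mu>
    using sc DS by (auto simp: eigenspace_def form_operator_def L2_eq_sqint sqint_scale)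
  have "L2_has_dim \<Omega> (eigenspace (form_operator \<Omega> D) \<mu>) (card {k. l k = \<mu>})" for \<mu>
  proof -
    let ?K = "{k. l k = \<mu>}"
    have fin: "finite ?K" by (rule eigensystem_fibre_finite[OF es])
    obtain b where b: "bij_betw b {0..<card ?K} ?K" using ex_bij_betw_nat_finite[OF fin] by blast
    have bK: "l (b i) = \<mu>" if "i < card ?K" for i using b that by (auto simp: bij_betw_def)
    have inj: "b i = b j \<longleftrightarrow> i = j" if "i < card ?K" "j < card ?K" for i j
      using b that by (auto simp: bij_betw_def inj_on_def)
    have reidx: "(\<Sum>k\<in>?K. g k) = (\<Sum>i<card ?K. g (b i))" for g :: "nat \<Rightarrow> complex"
      using sum.reindex_bij_betw[OF b, of g] by (simp add: lessThan_atLeast0)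
    have "L2_basis \<Omega> (eigenspace (form_operator \<Omega> D) \<mu>) (card ?K) (\<lambda>i. e (b i))"
      unfolding L2_basis_def
    proof (intro conjI allI impI ballI)
      fix i assume i: "i < card ?K"
      show "e (b i) \<in> eigenspace (form_operator \<Omega> D) \<mu>" using eD eig bK[OF i] by (simp add: es_iff)
    next
      fix c i assume ae: "AE p in lebesgue_on \<Omega>. (\<Sum>i<card ?K. c i * e (b i) p) = 0" and i: "i < card ?K"
      let ?s = "\<Sum>i<card ?K. fscale (c i) (e (b i))"
      have sD: "?s \<in> D" by (intro h.sum_mem h.sc_mem eD)
      have "h.sq ?s = 0"
        using ae DS[OF sD] by (simp add: h_sq sq_eq_0_iff sum_fun_apply fscale_def)
      then have "L2_inner \<Omega> ?s (e (b i)) = 0" by (intro h.null_left sD eD)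
      moreover have "L2_inner \<Omega> ?s (e (b i)) = (\<Sum>j<card ?K. L2_inner \<Omega> (fscale (c j) (e (b j))) (e (b i)))"
        by (rule h.sum_left) (auto intro: eD h.sc_mem)
      moreover have "\<dots> = (\<Sum>j<card ?K. if j = i then c i else 0)"
        using eD i inj by (intro sum.cong refl) (auto simp: h.sc_left on)
      ultimately show "c i = 0" using i by simp
    next
      fix u assume "u \<in> eigenspace (form_operator \<Omega> D) \<mu>"
      then have u: "u \<in> D" "\<And>v. v \<in> D \<Longrightarrow> sub_form \<Omega> u v = of_real \<mu> * L2_inner \<Omega> u v"
        by (simp_all add: es_iff)
      let ?s = "\<Sum>k\<in>?K. fscale (L2_inner \<Omega> u (e k)) (e k)"
      have sD: "u - ?s \<in> D" by (intro h.sum_mem h.diff_mem h.sc_mem eD u(1))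
      have "h.sq (u - ?s) = 0" by (rule eigenvector_expansion[OF es u])
      then have "AE p in lebesgue_on \<Omega>. (u - ?s) p = 0" using DS[OF sD] by (simp add: h_sq sq_eq_0_iff)
      then have "AE p in lebesgue_on \<Omega>. u p = (\<Sum>i<card ?K. L2_inner \<Omega> u (e (b i)) * e (b i) p)"
      proof eventually_elim
        case (elim p)
        then have "u p = (\<Sum>k\<in>?K. L2_inner \<Omega> u (e k) * e k p)"
          by (simp add: sum_fun_apply fscale_def)
        then show ?case by (simp add: reidx)
      qed
      then show "\<exists>c. AE p in lebesgue_on \<Omega>. u p = (\<Sum>i<card ?K. c i * e (b i) p)"
        by (intro exI[of _ "\<lambda>i. L2_inner \<Omega> u (e (b i))"])
    qed
    then show ?thesis unfolding L2_has_dim_def by blast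
  qed
  then show ?thesis
    unfolding eigenvalue_enumeration_def using inc eigensystem_fibre_finite[OF es] by blast
qed

section \<open>The Neumann and Dirichlet forms as compact forms\<close>

locale heis_compact = heis_open +
  assumes nonempty: "\<Omega> \<noteq> {}"
    and compact_embedding: "compact_embedding_S1_L2 \<Omega>"
begin

lemma S1_compactness:
  assumes u: "\<And>n::nat. u n \<in> S1 \<Omega>" and bd: "\<And>n. a.sq (u n) + h.sq (u n) \<le> C"
  shows "\<exists>r::nat\<Rightarrow>nat. strict_mono r \<and> (\<forall>\<epsilon>>0. \<exists>N. \<forall>m\<ge>N. \<forall>n\<ge>N. h.sq (u (r m) - u (r n)) < \<epsilon>)"
proof -
  have "S1_norm \<Omega> (u n) \<le> sqrt C" for n using bd[of n] by (simp add: S1_norm_eq[OF u] n_sq)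
  then obtain v r where v: "v \<in> L2 \<Omega>" and r: "strict_mono (r::nat \<Rightarrow> nat)"
    and lim: "(\<lambda>n. L2_norm \<Omega> (\<lambda>p. u (r n) p - v p)) \<longlonglongrightarrow> 0"
    using compact_embedding u unfolding compact_embedding_S1_L2_def by blast
  have S: "v \<in> sqint M" "u n \<in> sqint M" for n using v S1_sqint(1)[OF u] by (simp_all add: L2_eq_sqint)
  have "L2_norm \<Omega> (\<lambda>p. u n p - v p) = sqrt (sq.sq M (u n - v))" for n
    using S sqint_diff[OF S(2) S(1)] by (simp add: L2_norm_eq L2_eq_sqint fun_diff_def)
  with lim have "(\<lambda>n. (sqrt (sq.sq M (u (r n) - v)))\<^sup>2) \<longlonglongrightarrow> 0\<^sup>2" by (intro tendsto_power) simp
  then have lim: "(\<lambda>n. sq.sq M (u (r n) - v)) \<longlonglongrightarrow> 0" using S by simp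
  have "\<exists>N. \<forall>m\<ge>N. \<forall>n\<ge>N. h.sq (u (r m) - u (r n)) < \<epsilon>" if "\<epsilon> > 0" for \<epsilon>
  proof -
    have "\<forall>\<^sub>F n in sequentially. sq.sq M (u (r n) - v) < \<epsilon> / 4"
      using lim by (rule order_tendstoD) (use \<open>\<epsilon> > 0\<close> in simp)
    then obtain N where N: "\<And>n. n \<ge> N \<Longrightarrow> sq.sq M (u (r n) - v) < \<epsilon> / 4" by (auto simp: eventually_sequentially)
    show ?thesis
    proof (intro exI[of _ N] allI impI)
      fix m n assume mn: "m \<ge> N" "n \<ge> N"
      have "sq.sq M (v - u (r n)) = sq.sq M (u (r n) - v)"
        using S sq.herm[of "u (r n)" M v] by (simp add: sq.sq_diff)
      moreover have eq: "u (r m) - u (r n) = (u (r m) - v) + (v - u (r n))" by simp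
      moreover have "sq.sq M ((u (r m) - v) + (v - u (r n))) \<le> 2 * sq.sq M (u (r m) - v) + 2 * sq.sq M (v - u (r n))"
        by (rule sq.sq_add_le) (use S in simp_all)
      ultimately show "h.sq (u (r m) - u (r n)) < \<epsilon>" using N[OF mn(1)] N[OF mn(2)] unfolding h_sq by simp
    qed
  qed
  with r show ?thesis by blast
qed

lemma test_functions_independent:
  "\<exists>f :: nat \<Rightarrow> heis \<Rightarrow> complex. (\<forall>i<n. f i \<in> test_functions \<Omega>) \<and>
     (\<forall>c. h.sq (\<Sum>i<n. fscale (c i) (f i)) = 0 \<longrightarrow> (\<forall>i<n. c i = 0))"
proof -
  obtain f where f: "\<forall>i<n. f i \<in> test_functions \<Omega>"
      "\<And>c. (AE p in M. (\<Sum>i<n. c i * f i p) = 0) \<Longrightarrow> (\<forall>i<n. c i = 0)"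
    using test_functions_infinite_dimensional[OF open_\<Omega> nonempty, of n] by blast
  have "\<forall>i<n. c i = 0" if "h.sq (\<Sum>i<n. fscale (c i) (f i)) = 0" for c
  proof (rule f(2))
    have "(\<Sum>i<n. fscale (c i) (f i)) \<in> sqint M"
      using f(1) by (intro sq.sum_mem sq.sc_mem) (auto intro: S1_sqint test_function_S1)
    then show "AE p in M. (\<Sum>i<n. c i * f i p) = 0"
      using that by (simp add: h_sq sq_eq_0_iff sum_fun_apply fscale_def)
  qed
  with f(1) show ?thesis by blast
qed

text \<open>Covers both form domains. Compactness is inherited from \<open>S1 \<Omega>\<close>,
  completeness from closedness of D, and infinite dimension from the test functions, which D
  contains.\<close>

lemma compact_form_subspace:
  assumes D: "D \<subseteq> S1 \<Omega>" "test_functions \<Omega> \<subseteq> D" "0 \<in> D" "\<And>u v. u \<in> D \<Longrightarrow> v \<in> D \<Longrightarrow> u + v \<in> D"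
    "\<And>c u. u \<in> D \<Longrightarrow> fscale c u \<in> D"
    and closed: "\<And>u v. (\<And>n::nat. u n \<in> D) \<Longrightarrow> v \<in> S1 \<Omega> \<Longrightarrow> (\<lambda>n. n.sq (u n - v)) \<longlonglongrightarrow> 0 \<Longrightarrow> v \<in> D"
  shows "compact_form D fscale (L2_inner \<Omega>) (sub_form \<Omega>)"
proof -
  interpret hD: semi_inner D fscale "L2_inner \<Omega>"
    by (rule semi_inner_subspace[OF semi_inner_L2_inner]) (use D in auto)
  interpret aD: semi_inner D fscale "sub_form \<Omega>"
    by (rule semi_inner_subspace[OF semi_inner_sub_form]) (use D in auto)
  show ?thesis
  proof
    fix u :: "nat \<Rightarrow> heis \<Rightarrow> complex" and C
    assume "\<And>n. u n \<in> D" "\<And>n. aD.sq (u n) + hD.sq (u n) \<le> C"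
    then show "\<exists>r::nat\<Rightarrow>nat. strict_mono r \<and> (\<forall>\<epsilon>>0. \<exists>N. \<forall>m\<ge>N. \<forall>n\<ge>N. hD.sq (u (r m) - u (r n)) < \<epsilon>)"
      using S1_compactness[of u C] D(1) by blast
  next
    fix u :: "nat \<Rightarrow> heis \<Rightarrow> complex"
    assume u: "\<And>n. u n \<in> D" and "\<And>\<epsilon>. \<epsilon> > 0 \<Longrightarrow> \<exists>N. \<forall>m\<ge>N. \<forall>n\<ge>N::nat. aD.sq (u m - u n) + hD.sq (u m - u n) < \<epsilon>"
    then obtain v where v: "v \<in> S1 \<Omega>" "(\<lambda>n. a.sq (u n - v)) \<longlonglongrightarrow> 0" "(\<lambda>n. h.sq (u n - v)) \<longlonglongrightarrow> 0"
      using S1_complete[of u] D(1) by blast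
    have "(\<lambda>n. n.sq (u n - v)) \<longlonglongrightarrow> 0" using tendsto_add[OF v(2,3)] by (simp add: n_sq)
    then have "v \<in> D" using closed[of u v] u v(1) by blast
    with v show "\<exists>v\<in>D. (\<lambda>n. aD.sq (u n - v)) \<longlonglongrightarrow> 0 \<and> (\<lambda>n. hD.sq (u n - v)) \<longlonglongrightarrow> 0" by blast
  next
    fix n
    show "\<exists>f :: nat \<Rightarrow> heis \<Rightarrow> complex. (\<forall>i<n. f i \<in> D) \<and>
        (\<forall>c. hD.sq (\<Sum>i<n. fscale (c i) (f i)) = 0 \<longrightarrow> (\<forall>i<n. c i = 0))"
      using test_functions_independent[of n] D(2) by blast
  qed
qed

sublocale N: compact_form "S1 \<Omega>" fscale "L2_inner \<Omega>" "sub_form \<Omega>"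
  by (rule compact_form_subspace) (auto intro: test_function_S1)

sublocale D: compact_form "S1_0 \<Omega>" fscale "L2_inner \<Omega>" "sub_form \<Omega>"
  by (rule compact_form_subspace) (auto intro: S1_0_sub test_function_S1_0 S1_0_subspace S1_0_closed)

end


section \<open>Positivity of Dirichlet eigenvalues\<close>

lemma C1fun_arctan: "C1fun (\<lambda>p. complex_of_real (arctan (p \<bullet> w)))"
  and frechet_derivative_arctan:
    "frechet_derivative (\<lambda>p. complex_of_real (arctan (p \<bullet> w))) (at p) v = of_real (v \<bullet> w / (1 + (p \<bullet> w)\<^sup>2))"
proof -
  have d: "((\<lambda>p. complex_of_real (arctan (p \<bullet> w))) has_derivative (\<lambda>v. of_real (v \<bullet> w / (1 + (p \<bullet> w)\<^sup>2)))) (at p)" for p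
    by (auto intro!: derivative_eq_intros simp: field_simps)
  show "C1fun (\<lambda>p. complex_of_real (arctan (p \<bullet> w)))"
  proof (rule C1funI[OF d])
    have "1 + (p \<bullet> w)\<^sup>2 \<noteq> 0" for p using zero_le_power2[of "p \<bullet> w"] by linarith
    then show "continuous_on UNIV (\<lambda>p. complex_of_real (v \<bullet> w / (1 + (p \<bullet> w)\<^sup>2)))" for v
      by (intro continuous_intros) auto
  qed
  show "frechet_derivative (\<lambda>p. complex_of_real (arctan (p \<bullet> w))) (at p) v = of_real (v \<bullet> w / (1 + (p \<bullet> w)\<^sup>2))"
    by (simp add: frechet_derivative_eqI[OF d])
qed

lemma sq_mult_le:
  assumes "u \<in> sqint M" "k \<in> borel_measurable M" "\<And>p. cmod (k p) \<le> C"
  shows "(\<lambda>p. k p * u p) \<in> sqint M" "sq.sq M (\<lambda>p. k p * u p) \<le> C\<^sup>2 * sq.sq M u"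
proof -
  have le: "cmod (k p * u p) \<le> C * cmod (u p)" for p
    using assms(3)[of p] by (simp add: norm_mult mult_right_mono)
  show m: "(\<lambda>p. k p * u p) \<in> sqint M"
    by (rule sqint_bound[OF assms(1), of _ C]) (use assms(2) sqint_meas[OF assms(1)] le in simp_all)
  have "(LINT p|M. (cmod (k p * u p))\<^sup>2) \<le> (LINT p|M. C\<^sup>2 * (cmod (u p))\<^sup>2)"
  proof (rule integral_mono)
    show "(cmod (k p * u p))\<^sup>2 \<le> C\<^sup>2 * (cmod (u p))\<^sup>2" for p
      using power_mono[OF le, of p 2] by (simp add: power_mult_distrib)
  qed (use sqint_integrable[OF m] sqint_integrable[OF assms(1)] in simp_all)
  then show "sq.sq M (\<lambda>p. k p * u p) \<le> C\<^sup>2 * sq.sq M u" by (simp add: sq_sq m assms(1))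
qed

lemma continuous_measurable_lebesgue_on:
  fixes f :: "'a::euclidean_space \<Rightarrow> complex"
  shows "continuous_on UNIV f \<Longrightarrow> f \<in> borel_measurable (lebesgue_on \<Omega>)"
  by (intro measurable_restrict_space1 measurable_completion) (simp add: borel_measurable_continuous_onI)

text \<open>The square root of the derivative of \<open>arctan\<close> in the first coordinate. Integrating $X(\arctan(x)|\phi|^2)$
  gives a Poincare inequality with this weight on any open set.\<close>

definition weight :: "heis \<Rightarrow> complex" where
  "weight p = of_real (1 / sqrt (1 + (fst p)\<^sup>2))"

lemma sqrt_one_plus_square_ge_1: "1 \<le> sqrt (1 + x\<^sup>2)"
  by (rule real_le_rsqrt) simp

lemma weight_nonzero: "weight p \<noteq> 0"
proof -
  have "sqrt (1 + (fst p)\<^sup>2) \<noteq> 0" using sqrt_one_plus_square_ge_1[of "fst p"] by linarith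
  then show ?thesis by (simp only: weight_def of_real_eq_0_iff divide_eq_0_iff) simp
qed

lemma norm_weight_le: "cmod (weight p) \<le> 1"
proof -
  have "\<bar>1 / s\<bar> \<le> 1" if "1 \<le> s" for s :: real using that by simp
  then show ?thesis unfolding weight_def norm_of_real using sqrt_one_plus_square_ge_1 by blast
qed

lemma continuous_weight: "continuous_on UNIV weight"
proof -
  have "sqrt (1 + (fst p)\<^sup>2) \<noteq> 0" for p :: heis
    using sqrt_one_plus_square_ge_1[of "fst p"] by linarith
  then show ?thesis unfolding weight_def[abs_def] by (intro continuous_intros) auto
qed

context heis_open begin

text \<open>Skew-symmetry of V. Compact support of \<phi> suppresses boundary terms whatever f does
  at the boundary or at infinity, so f may be a derivative of U_s.\<close>

lemma sip_field_deriv_test_function: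
  assumes V: "shear_field V" and f: "C1fun f" and \<phi>: "\<phi> \<in> test_functions \<Omega>"
  shows "sip M f (field_deriv V \<phi>) = - sip M (field_deriv V f) \<phi>"
proof -
  note C1 = test_function_C1[OF \<phi>] and bs = test_function_bounded_support[OF \<phi>] and out = test_function_outside[OF \<phi>]
  note cont = C1fun_continuous[OF C1] C1fun_continuous[OF f] field_deriv_continuous[OF V C1] field_deriv_continuous[OF V f]
  have "sip M f (field_deriv V \<phi>) = (LINT p|lborel. f p * cnj (field_deriv V \<phi> p))"
    unfolding sip_def
    by (intro integral_lebesgue_on_eq_lborel open_\<Omega> borel_measurable_continuous_onI continuous_intros cont) (simp add: out)
  also have "\<dots> = - (LINT p|lborel. field_deriv V f p * cnj (\<phi> p))"
    using field_by_parts[OF V f C1fun_cnj[OF C1]] bs by (simp add: field_deriv_cnj[OF C1] bounded_support_def)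
  also have "(LINT p|lborel. field_deriv V f p * cnj (\<phi> p)) = sip M (field_deriv V f) \<phi>"
    unfolding sip_def
    by (intro integral_lebesgue_on_eq_lborel[symmetric] open_\<Omega> borel_measurable_continuous_onI continuous_intros cont)
       (simp add: out)
  finally show ?thesis .
qed

text \<open>With A = arctan x the product rule gives X(A \<phi>) = \<open>weight\<close>^2 \<phi> +
  A X\<phi>; pairing with \<phi> and moving X across leaves two terms with the bounded factor A. The
  function x in place of arctan x would be unbounded on a set of infinite width. The constant 4 is
  twice the crude bound 2 for |A|.\<close>

lemma field_X_poincare:
  assumes \<phi>: "\<phi> \<in> test_functions \<Omega>"
  shows "sq.sq M (\<lambda>p. weight p * \<phi> p) \<le> 4 * sqrt (sq.sq M \<phi>) * sqrt (sq.sq M (field_deriv field_X \<phi>))"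
proof -
  define A where "A = (\<lambda>p::heis. complex_of_real (arctan (p \<bullet> (1, 0, 0))))"
  note C1 = test_function_C1[OF \<phi>]
  note S = test_function_sqint(1)[OF open_\<Omega> \<phi>] test_function_sqint(2)[OF open_\<Omega> \<phi> shear_field_X]
  have AC1: "C1fun A" unfolding A_def by (rule C1fun_arctan)
  let ?X = "field_deriv field_X"
  have XA: "?X A p = (weight p)\<^sup>2" for p
  proof -
    have "?X A p = of_real (field_X p \<bullet> (1, 0, 0) / (1 + (p \<bullet> (1, 0, 0))\<^sup>2))"
      unfolding A_def field_deriv_def by (rule frechet_derivative_arctan)
    also have "\<dots> = (weight p)\<^sup>2" by (cases p) (simp add: weight_def power_divide flip: of_real_power)
    finally show ?thesis .
  qed
  have kr: "cnj (weight p) = weight p" for p by (simp add: weight_def)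
  have Ab: "cmod (A p) \<le> 2" for p
  proof -
    have "\<bar>arctan (p \<bullet> (1, 0, 0))\<bar> \<le> 2" using arctan_bounded[of "p \<bullet> (1, 0, 0)"] pi_less_4 by linarith
    then show ?thesis by (simp add: A_def)
  qed
  have Am: "A \<in> borel_measurable M" by (rule continuous_measurable_lebesgue_on[OF C1fun_continuous[OF AC1]])
  note km = continuous_measurable_lebesgue_on[OF continuous_weight] and kb = norm_weight_le
  note AS = sq_mult_le[OF S(1) Am Ab] sq_mult_le[OF S(2) Am Ab]
  have "sip M (\<lambda>p. weight p * \<phi> p) (\<lambda>p. weight p * \<phi> p) + sip M (\<lambda>p. A p * ?X \<phi> p) \<phi>
      = (LINT p|M. (weight p * \<phi> p) * cnj (weight p * \<phi> p) + (A p * ?X \<phi> p) * cnj (\<phi> p))"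
    unfolding sip_def
    using sqint_mult_integrable[OF sq_mult_le(1)[where k = weight, OF S(1) km kb] sqint_cnj[OF sq_mult_le(1)[where k = weight, OF S(1) km kb]]]
      sqint_mult_integrable[OF AS(3) sqint_cnj[OF S(1)]] by simp
  also have "\<dots> = sip M (?X (\<lambda>p. A p * \<phi> p)) \<phi>"
    unfolding sip_def
    by (intro Bochner_Integration.integral_cong refl)
       (simp add: field_deriv_mult[OF AC1 C1] XA kr power2_eq_square algebra_simps)
  also have "\<dots> = - sip M (\<lambda>p. A p * \<phi> p) (?X \<phi>)"
    using sip_field_deriv_test_function[OF shear_field_X C1fun_mult[OF AC1 C1] \<phi>] by simp
  finally have eq: "sip M (\<lambda>p. weight p * \<phi> p) (\<lambda>p. weight p * \<phi> p) =
      - sip M (\<lambda>p. A p * \<phi> p) (?X \<phi>) - sip M (\<lambda>p. A p * ?X \<phi> p) \<phi>" by (rule add_implies_diff)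
  have "sqrt (sq.sq M (\<lambda>p. A p * f p)) \<le> 2 * sqrt (sq.sq M f)" if "f \<in> sqint M" for f
  proof -
    have "sqrt (sq.sq M (\<lambda>p. A p * f p)) \<le> sqrt (2\<^sup>2 * sq.sq M f)"
      by (intro real_sqrt_le_mono sq_mult_le(2)[OF that Am Ab])
    then show ?thesis by (simp add: real_sqrt_mult)
  qed
  note b = this[OF S(1)] this[OF S(2)]
  have "sq.sq M (\<lambda>p. weight p * \<phi> p) \<le> cmod (sip M (\<lambda>p. weight p * \<phi> p) (\<lambda>p. weight p * \<phi> p))"
    unfolding sq.sq_def by (rule complex_Re_le_cmod)
  also have "\<dots> \<le> cmod (sip M (\<lambda>p. A p * ?X \<phi> p) \<phi>) + cmod (sip M (\<lambda>p. A p * \<phi> p) (?X \<phi>))"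
    unfolding eq using norm_triangle_ineq4[of "- sip M (\<lambda>p. A p * \<phi> p) (?X \<phi>)" "sip M (\<lambda>p. A p * ?X \<phi> p) \<phi>"] by simp
  also have "\<dots> \<le> sqrt (sq.sq M (\<lambda>p. A p * ?X \<phi> p)) * sqrt (sq.sq M \<phi>) + sqrt (sq.sq M (\<lambda>p. A p * \<phi> p)) * sqrt (sq.sq M (?X \<phi>))"
    by (intro add_mono sq.cauchy_schwarz AS S)
  also have "\<dots> \<le> (2 * sqrt (sq.sq M (?X \<phi>))) * sqrt (sq.sq M \<phi>) + (2 * sqrt (sq.sq M \<phi>)) * sqrt (sq.sq M (?X \<phi>))"
    by (intro add_mono mult_right_mono b) (simp_all add: S)
  finally show ?thesis by (simp add: mult_ac)
qed

text \<open>The weighted inequality passes to the \<open>S1\<close>-limit, and the weight vanishes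
  nowhere. Applied to a Dirichlet eigenfunction it excludes the eigenvalue 0, which would force its
  X-derivative to be null.\<close>

lemma S1_0_X_null:
  assumes u: "u \<in> S1_0 \<Omega>" and X0: "sq.sq M (X u) = 0"
  shows "AE p in M. u p = 0"
proof -
  obtain \<phi> where \<phi>: "\<And>n::nat. \<phi> n \<in> test_functions \<Omega>" "(\<lambda>n. sq.sq M (\<phi> n - u)) \<longlonglongrightarrow> 0"
    "(\<lambda>n. sq.sq M (field_deriv field_X (\<phi> n) - X u)) \<longlonglongrightarrow> 0"
    by (rule S1_0_approx[OF u]) blast
  note uS = S1_sqint[OF S1_0_sub[OF u]]
  note S = test_function_sqint(1)[OF open_\<Omega> \<phi>(1)] test_function_sqint(2)[OF open_\<Omega> \<phi>(1) shear_field_X]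
  note km = continuous_measurable_lebesgue_on[OF continuous_weight] and kb = norm_weight_le
  note kS = sq_mult_le(1)[where k = weight, OF S(1) km kb] and ku = sq_mult_le(1)[where k = weight, OF uS(1) km kb]
  have "(\<lambda>n. sq.sq M ((\<lambda>p. weight p * \<phi> n p) - (\<lambda>p. weight p * u p))) \<longlonglongrightarrow> 0"
  proof (rule tendsto_sandwich[OF _ _ tendsto_const \<phi>(2)]; intro always_eventually allI)
    fix n
    show "0 \<le> sq.sq M ((\<lambda>p. weight p * \<phi> n p) - (\<lambda>p. weight p * u p))" using kS ku by simp
    have "(\<lambda>p. weight p * \<phi> n p) - (\<lambda>p. weight p * u p) = (\<lambda>p. weight p * (\<phi> n - u) p)" by (simp add: fun_eq_iff algebra_simps)
    then show "sq.sq M ((\<lambda>p. weight p * \<phi> n p) - (\<lambda>p. weight p * u p)) \<le> sq.sq M (\<phi> n - u)"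
      using sq_mult_le(2)[where k = weight, OF sq.diff_mem[OF S(1) uS(1)] km kb] by simp
  qed
  then have 1: "(\<lambda>n. sq.sq M (\<lambda>p. weight p * \<phi> n p)) \<longlonglongrightarrow> sq.sq M (\<lambda>p. weight p * u p)"
    by (rule sq.sq_tendsto[OF kS ku])
  have "(\<lambda>n. 4 * sqrt (sq.sq M (\<phi> n)) * sqrt (sq.sq M (field_deriv field_X (\<phi> n)))) \<longlonglongrightarrow>
      4 * sqrt (sq.sq M u) * sqrt (sq.sq M (X u))"
    by (intro tendsto_intros sq.sq_tendsto S uS \<phi>)
  then have "sq.sq M (\<lambda>p. weight p * u p) \<le> 4 * sqrt (sq.sq M u) * sqrt (sq.sq M (X u))"
    by (rule LIMSEQ_le[OF 1]) (use field_X_poincare[OF \<phi>(1)] in auto)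
  then have "sq.sq M (\<lambda>p. weight p * u p) = 0" using X0 sq.sq_nonneg[OF ku] by (simp add: order_antisym)
  then have "AE p in M. weight p * u p = 0" using ku by (simp add: sq_eq_0_iff)
  then show ?thesis
  proof eventually_elim
    case (elim p)
    then show ?case using weight_nonzero[of p] by simp
  qed
qed

end


section \<open>Dilations\<close>

text \<open>For nonzero r these are automorphisms of the group; t has weight 2 because it is the
  direction of the commutator of X and Y. They multiply both fields by r and volume by r^4.\<close>

fun dil :: "real \<Rightarrow> heis \<Rightarrow> heis" where
  "dil r (x, y, t) = (r * x, r * y, r\<^sup>2 * t)"

lemma dil_1 [simp]: "dil 1 p = p"
  by (cases p) simp

lemma dil_dil: "dil r (dil s p) = dil (r * s) p"
  by (cases p) (simp add: power_mult_distrib)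

lemma bounded_linear_dil: "bounded_linear (dil r)"
proof -
  have "linear (dil r)" by (rule linearI) (auto simp: algebra_simps)
  then show ?thesis by (simp add: linear_conv_bounded_linear)
qed

lemma dil_field_X: "dil r (field_X p) = r *\<^sub>R field_X (dil r p)"
  by (cases p) (simp add: power2_eq_square)

lemma dil_field_Y: "dil r (field_Y p) = r *\<^sub>R field_Y (dil r p)"
  by (cases p) (simp add: power2_eq_square)

lemma Basis_heis: "(Basis :: heis set) = {(1, 0, 0), (0, 1, 0), (0, 0, 1)}"
  by (auto simp: Basis_prod_def zero_prod_def)

lemma
  assumes "r > 0"
  shows dil_measurable: "dil r \<in> lebesgue \<rightarrow>\<^sub>M lebesgue"
    and lebesgue_dil: "lebesgue = density (distr lebesgue lebesgue (dil r)) (\<lambda>_. ennreal (r ^ 4))"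
proof -
  define c :: "heis \<Rightarrow> real" where "c = (\<lambda>j. if j = (0, 0, 1) then r\<^sup>2 else r)"
  have c: "c j \<noteq> 0" for j using assms by (simp add: c_def)
  have T: "(\<lambda>x::heis. 0 + (\<Sum>j\<in>Basis. (c j * (x \<bullet> j)) *\<^sub>R j)) = dil r"
    by (auto simp: fun_eq_iff Basis_heis c_def)
  have "(\<Prod>j\<in>Basis. \<bar>c j\<bar>) = r ^ 4" using assms by (simp add: Basis_heis c_def power2_eq_square power4_eq_xxxx)
  then show "dil r \<in> lebesgue \<rightarrow>\<^sub>M lebesgue" "lebesgue = density (distr lebesgue lebesgue (dil r)) (\<lambda>_. ennreal (r ^ 4))"
    using lebesgue_affine_measurable[of c 0] lebesgue_affine_euclidean[of c 0] c unfolding T by simp_all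
qed

lemma integral_dil:
  fixes f :: "heis \<Rightarrow> 'b::{banach, second_countable_topology}"
  assumes r: "r > 0" and f: "f \<in> borel_measurable lebesgue"
  shows "(LINT p|lebesgue. f p) = r ^ 4 *\<^sub>R (LINT p|lebesgue. f (dil r p))"
    and "integrable lebesgue f \<longleftrightarrow> integrable lebesgue (\<lambda>p. f (dil r p))"
    and "(\<lambda>p. f (dil r p)) \<in> borel_measurable lebesgue"
proof -
  note m = dil_measurable[OF r]
  show "(\<lambda>p. f (dil r p)) \<in> borel_measurable lebesgue" by (rule measurable_compose[OF m f])
  have fd: "f \<in> borel_measurable (distr lebesgue lebesgue (dil r))" using f by simp
  have "(LINT p|lebesgue. f p) = (LINT p|density (distr lebesgue lebesgue (dil r)) (\<lambda>_. ennreal (r ^ 4)). f p)"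
    by (subst lebesgue_dil[OF r]) (rule refl)
  also have "\<dots> = (LINT p|distr lebesgue lebesgue (dil r). r ^ 4 *\<^sub>R f p)"
    using r fd by (intro integral_density) auto
  also have "\<dots> = (LINT p|lebesgue. r ^ 4 *\<^sub>R f (dil r p))"
    using f by (intro integral_distr m) simp
  also have "\<dots> = r ^ 4 *\<^sub>R (LINT p|lebesgue. f (dil r p))" using r by simp
  finally show "(LINT p|lebesgue. f p) = r ^ 4 *\<^sub>R (LINT p|lebesgue. f (dil r p))" .
  have "integrable lebesgue f \<longleftrightarrow> integrable (density (distr lebesgue lebesgue (dil r)) (\<lambda>_. ennreal (r ^ 4))) f"
    by (subst lebesgue_dil[OF r]) (rule refl)
  also have "\<dots> \<longleftrightarrow> integrable (distr lebesgue lebesgue (dil r)) (\<lambda>p. r ^ 4 *\<^sub>R f p)"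
    using r fd by (intro integrable_density) auto
  also have "\<dots> \<longleftrightarrow> integrable lebesgue (\<lambda>p. r ^ 4 *\<^sub>R f (dil r p))"
    using f by (intro integrable_distr_eq m) simp
  also have "\<dots> \<longleftrightarrow> integrable lebesgue (\<lambda>p. f (dil r p))"
    using integrable_scaleR_right[of "inverse (r ^ 4)" lebesgue "\<lambda>p. r ^ 4 *\<^sub>R f (dil r p)"] r by auto
  finally show "integrable lebesgue f \<longleftrightarrow> integrable lebesgue (\<lambda>p. f (dil r p))" .
qed

lemma C1fun_dil: "C1fun f \<Longrightarrow> C1fun (\<lambda>p. f (dil r p))"
  and frechet_derivative_dil: "C1fun f \<Longrightarrow> frechet_derivative (\<lambda>p. f (dil r p)) (at p) v = frechet_derivative f (at (dil r p)) (dil r v)"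
proof -
  assume f: "C1fun f"
  have d: "((\<lambda>p. f (dil r p)) has_derivative (\<lambda>v. frechet_derivative f (at (dil r p)) (dil r v))) (at p)" for p
    by (rule has_derivative_compose[OF bounded_linear_imp_has_derivative[OF bounded_linear_dil] C1fun_deriv[OF f]])
  show "C1fun (\<lambda>p. f (dil r p))"
  proof (rule C1funI[OF d])
    fix v
    have "continuous_on UNIV (dil r)" using bounded_linear_dil by (rule linear_continuous_on)
    then show "continuous_on UNIV (\<lambda>p. frechet_derivative f (at (dil r p)) (dil r v))"
      using continuous_on_compose2[OF C1fun_deriv_continuous[OF f]] by blast
  qed
  show "frechet_derivative (\<lambda>p. f (dil r p)) (at p) v = frechet_derivative f (at (dil r p)) (dil r v)"
    by (simp add: frechet_derivative_eqI[OF d])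
qed

section \<open>Zero extensions and their dilates\<close>

text \<open>Representatives have arbitrary values outside \<Omega>, and a dilation brings such
  points into view; they are set to zero before dilating.\<close>

definition ext0 :: "heis set \<Rightarrow> (heis \<Rightarrow> complex) \<Rightarrow> heis \<Rightarrow> complex" where
  "ext0 \<Omega> f p = (if p \<in> \<Omega> then f p else 0)"

lemma ext0_eq: "ext0 \<Omega> f p = indicator \<Omega> p *\<^sub>R f p"
  by (simp add: ext0_def)

lemma ext0_id: "(\<And>p. p \<notin> \<Omega> \<Longrightarrow> f p = 0) \<Longrightarrow> ext0 \<Omega> f = f"
  by (auto simp: ext0_def)

context heis_open begin

lemma ext0_measurable: "f \<in> borel_measurable M \<Longrightarrow> ext0 \<Omega> f \<in> borel_measurable lebesgue"
  using open_\<Omega> unfolding ext0_eq[abs_def] by (subst (asm) borel_measurable_restrict_space_iff) auto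

lemma integral_ext0: "(LINT p|M. f p * g p) = (LINT p|lebesgue. ext0 \<Omega> f p * g p)"
  by (subst integral_lebesgue_on[OF open_\<Omega>]) (simp add: ext0_eq)

lemma ext0_sq_integrable:
  assumes "f \<in> sqint M"
  shows "integrable lebesgue (\<lambda>p. (cmod (ext0 \<Omega> f p))\<^sup>2)" "(LINT p|lebesgue. (cmod (ext0 \<Omega> f p))\<^sup>2) = sq.sq M f"
proof -
  have eq: "(cmod (ext0 \<Omega> f p))\<^sup>2 = indicator \<Omega> p *\<^sub>R (cmod (f p))\<^sup>2" for p by (simp add: ext0_def)
  show "integrable lebesgue (\<lambda>p. (cmod (ext0 \<Omega> f p))\<^sup>2)"
    unfolding eq using sqint_integrable[OF assms] open_\<Omega> by (subst (asm) integrable_restrict_space) auto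
  show "(LINT p|lebesgue. (cmod (ext0 \<Omega> f p))\<^sup>2) = sq.sq M f"
    unfolding eq sq_sq[OF assms] by (rule integral_lebesgue_on[OF open_\<Omega>, symmetric])
qed

text \<open>Only an inequality, because the dilate is looked at on \<Omega> and part of its mass may
  lie outside. It provides the uniform continuity in f that is needed near r = 1.\<close>

lemma ext0_dil_sqint:
  assumes r: "r > 0" and f: "f \<in> sqint M"
  shows "(\<lambda>p. ext0 \<Omega> f (dil r p)) \<in> sqint M" "r ^ 4 * sq.sq M (\<lambda>p. ext0 \<Omega> f (dil r p)) \<le> sq.sq M f"
proof -
  note m = ext0_measurable[OF sqint_meas[OF f]]
  have m2: "(\<lambda>p. (cmod (ext0 \<Omega> f p))\<^sup>2) \<in> borel_measurable lebesgue" using m by simp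
  note i = ext0_sq_integrable(1)[OF f, unfolded integral_dil(2)[OF r m2]]
  have i': "integrable lebesgue (\<lambda>p. indicator \<Omega> p *\<^sub>R (cmod (ext0 \<Omega> f (dil r p)))\<^sup>2)"
    using i open_\<Omega> by (intro integrable_mult_indicator) auto
  show s: "(\<lambda>p. ext0 \<Omega> f (dil r p)) \<in> sqint M"
  proof (rule sqintI)
    show "(\<lambda>p. ext0 \<Omega> f (dil r p)) \<in> borel_measurable M"
      by (rule measurable_restrict_space1[OF integral_dil(3)[OF r m]])
    show "integrable M (\<lambda>p. (cmod (ext0 \<Omega> f (dil r p)))\<^sup>2)"
      using i' open_\<Omega> by (subst integrable_restrict_space) auto
  qed
  have "sq.sq M (\<lambda>p. ext0 \<Omega> f (dil r p)) = (LINT p|lebesgue. indicator \<Omega> p *\<^sub>R (cmod (ext0 \<Omega> f (dil r p)))\<^sup>2)"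
    unfolding sq_sq[OF s] by (rule integral_lebesgue_on[OF open_\<Omega>])
  also have "\<dots> \<le> (LINT p|lebesgue. (cmod (ext0 \<Omega> f (dil r p)))\<^sup>2)"
    by (intro integral_mono i i') (auto simp: indicator_def)
  finally have "r ^ 4 * sq.sq M (\<lambda>p. ext0 \<Omega> f (dil r p)) \<le> r ^ 4 * (LINT p|lebesgue. (cmod (ext0 \<Omega> f (dil r p)))\<^sup>2)"
    using r by (intro mult_left_mono) auto
  also have "\<dots> = sq.sq M f" using integral_dil(1)[OF r m2] ext0_sq_integrable(2)[OF f] by simp
  finally show "r ^ 4 * sq.sq M (\<lambda>p. ext0 \<Omega> f (dil r p)) \<le> sq.sq M f" .
qed

text \<open>The pairing of f with its r-dilate. Integration over \<Omega> loses nothing, since the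
  zero extension of f vanishes elsewhere; so this is the inner product on the whole group.\<close>

definition corr :: "real \<Rightarrow> (heis \<Rightarrow> complex) \<Rightarrow> complex" where
  "corr r f = sip M f (\<lambda>p. ext0 \<Omega> f (dil r p))"

text \<open>Together with the eigenvalue equation tested against the dilates by \<open>r\<close> and \<open>1 / r\<close>, this symmetry
  expresses the orthogonality of \<open>u\<close> to its dilates.\<close>

lemma corr_inverse:
  assumes r: "r > 0" and f: "f \<in> sqint M"
  shows "corr (1 / r) f = of_real (r ^ 4) * cnj (corr r f)"
proof -
  let ?e = "ext0 \<Omega> f"
  have m: "?e \<in> borel_measurable lebesgue" by (rule ext0_measurable[OF sqint_meas[OF f]])
  have r': "1 / r > 0" using r by simp
  have m2: "(\<lambda>p. ?e p * cnj (?e (dil (1 / r) p))) \<in> borel_measurable lebesgue"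
    by (intro borel_measurable_times borel_measurable_cnj m integral_dil(3)[OF r' m])
  have "corr (1 / r) f = (LINT p|lebesgue. ?e p * cnj (?e (dil (1 / r) p)))"
    unfolding corr_def sip_def by (rule integral_ext0)
  also have "\<dots> = r ^ 4 *\<^sub>R (LINT p|lebesgue. ?e (dil r p) * cnj (?e (dil (1 / r) (dil r p))))"
    by (rule integral_dil(1)[OF r m2])
  also have "\<dots> = r ^ 4 *\<^sub>R (LINT p|lebesgue. cnj (?e p * cnj (?e (dil r p))))"
    using r by (simp add: dil_dil mult.commute)
  also have "(LINT p|lebesgue. cnj (?e p * cnj (?e (dil r p)))) = cnj (LINT p|lebesgue. ?e p * cnj (?e (dil r p)))"
    by (rule Bochner_Integration.integral_cnj)
  also have "(LINT p|lebesgue. ?e p * cnj (?e (dil r p))) = corr r f"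
    unfolding corr_def sip_def by (rule integral_ext0[symmetric])
  finally show ?thesis by (simp add: scaleR_conv_of_real)
qed

text \<open>Extension by zero respects weak derivatives because u is a limit of test functions,
  whose zero extensions are themselves and stay C1 after any dilation. For a function with boundary
  values, a jump along the dilated boundary would appear inside \<Omega>.\<close>

lemma dil_weak_deriv:
  assumes V: "shear_field V" "\<And>r p. dil r (V p) = r *\<^sub>R V (dil r p)" and r: "r > 0"
    and uS: "u \<in> sqint M" "g \<in> sqint M"
    and \<phi>: "\<And>n. \<phi> n \<in> test_functions \<Omega>" "(\<lambda>n. sq.sq M (\<phi> n - u)) \<longlonglongrightarrow> 0"
      "(\<lambda>n. sq.sq M (field_deriv V (\<phi> n) - g)) \<longlonglongrightarrow> 0"
  shows "has_weak_deriv \<Omega> V (\<lambda>p. ext0 \<Omega> u (dil r p)) (\<lambda>p. of_real r * ext0 \<Omega> g (dil r p))"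
proof -
  let ?D = "\<lambda>f p. ext0 \<Omega> f (dil r p)"
  note S = test_function_sqint[OF open_\<Omega> \<phi>(1)]
  have wd: "has_weak_deriv \<Omega> V (?D (\<phi> n)) (\<lambda>p. of_real r * ?D (field_deriv V (\<phi> n)) p)" for n
  proof -
    note C1 = test_function_C1[OF \<phi>(1)[of n]]
    have e: "ext0 \<Omega> (\<phi> n) = \<phi> n" "ext0 \<Omega> (field_deriv V (\<phi> n)) = field_deriv V (\<phi> n)"
      using test_function_outside[OF \<phi>(1)[of n]] by (auto intro!: ext0_id)
    have "field_deriv V (\<lambda>p. \<phi> n (dil r p)) = (\<lambda>p. of_real r * field_deriv V (\<phi> n) (dil r p))"
      using C1fun_deriv[OF C1, THEN has_derivative_linear]
      by (simp add: field_deriv_def frechet_derivative_dil[OF C1] V(2) linear_scale scaleR_conv_of_real fun_eq_iff)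
    then show ?thesis using C1fun_has_weak_deriv[OF open_\<Omega> V(1) C1fun_dil[OF C1, of r]] by (simp add: e)
  qed
  have lim: "(\<lambda>n. sq.sq M (?D (f n) - ?D k)) \<longlonglongrightarrow> 0"
    if f: "\<And>n. f n \<in> sqint M" and k: "k \<in> sqint M" and l: "(\<lambda>n. sq.sq M (f n - k)) \<longlonglongrightarrow> 0" for f :: "nat \<Rightarrow> heis \<Rightarrow> complex" and k
  proof (rule tendsto_sandwich[OF _ _ tendsto_const])
    have eq: "?D (f n) - ?D k = ?D (f n - k)" for n by (auto simp: ext0_def fun_eq_iff)
    have b: "r ^ 4 * sq.sq M (?D (f n) - ?D k) \<le> sq.sq M (f n - k)" for n
      unfolding eq by (rule ext0_dil_sqint(2)[OF r sq.diff_mem[OF f k]])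
    have "sq.sq M (?D (f n) - ?D k) \<le> sq.sq M (f n - k) / r ^ 4" for n
      using b[of n] r by (simp add: pos_le_divide_eq mult.commute)
    then show "\<forall>\<^sub>F n in sequentially. sq.sq M (?D (f n) - ?D k) \<le> sq.sq M (f n - k) / r ^ 4" by simp
    show "(\<lambda>n. sq.sq M (f n - k) / r ^ 4) \<longlonglongrightarrow> 0" using tendsto_divide[OF l tendsto_const, of "r ^ 4"] r by simp
    show "\<forall>\<^sub>F n in sequentially. 0 \<le> sq.sq M (?D (f n) - ?D k)"
      using ext0_dil_sqint(1)[OF r f] ext0_dil_sqint(1)[OF r k] by simp
  qed
  note gV = S(2)[OF V(1)]
  have "(\<lambda>n. sq.sq M ((\<lambda>p. of_real r * ?D (field_deriv V (\<phi> n)) p) - (\<lambda>p. of_real r * ?D g p))) \<longlonglongrightarrow> 0"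
  proof -
    have "sq.sq M ((\<lambda>p. of_real r * ?D (field_deriv V (\<phi> n)) p) - (\<lambda>p. of_real r * ?D g p)) =
       r\<^sup>2 * sq.sq M (?D (field_deriv V (\<phi> n)) - ?D g)" for n
    proof -
      have "(\<lambda>p. of_real r * ?D (field_deriv V (\<phi> n)) p) - (\<lambda>p. of_real r * ?D g p) = fscale (of_real r) (?D (field_deriv V (\<phi> n)) - ?D g)"
        by (simp add: fscale_def fun_eq_iff algebra_simps)
      then show ?thesis using ext0_dil_sqint(1)[OF r gV[of n]] ext0_dil_sqint(1)[OF r uS(2)] by (simp add: sq.sq_sc)
    qed
    then show ?thesis using tendsto_mult_right_zero[OF lim[OF gV uS(2) \<phi>(3)]] by simp
  qed
  from weak_deriv_limit[OF open_\<Omega> V(1) _ _ _ _ wd lim[OF S(1) uS(1) \<phi>(2)] this]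
  show ?thesis using ext0_dil_sqint(1)[OF r] S(1) gV uS by (simp add: L2_eq_sqint sqint_scale)
qed

text \<open>The two hypotheses on u act together: membership in \<open>S1_0 \<Omega>\<close> makes
  its dilates, cut off to \<Omega>, members of \<open>S1 \<Omega>\<close>, and the Neumann equation
  may be tested against all of \<open>S1 \<Omega>\<close>, although such a dilate need not satisfy
  the Dirichlet condition.\<close>

theorem S1_0_Neumann_eigenfunction_null:
  assumes fin: "emeasure lebesgue \<Omega> < \<infinity>" and u: "u \<in> S1_0 \<Omega>" and L: "\<mu> \<noteq> 0"
    and eig: "\<And>v. v \<in> S1 \<Omega> \<Longrightarrow> sub_form \<Omega> u v = of_real \<mu> * L2_inner \<Omega> u v"
  shows "AE p in M. u p = 0"
proof -
  obtain \<phi> where \<phi>: "\<And>n::nat. \<phi> n \<in> test_functions \<Omega>" "(\<lambda>n. sq.sq M (\<phi> n - u)) \<longlonglongrightarrow> 0"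
    "(\<lambda>n. sq.sq M (field_deriv field_X (\<phi> n) - X u)) \<longlonglongrightarrow> 0" "(\<lambda>n. sq.sq M (field_deriv field_Y (\<phi> n) - Y u)) \<longlonglongrightarrow> 0"
    by (rule S1_0_approx[OF u]) blast
  note uS = S1_sqint[OF S1_0_sub[OF u]]
  let ?D = "\<lambda>r f p. ext0 \<Omega> f (dil r p)"
  have 1: "of_real r * (corr r (X u) + corr r (Y u)) = of_real \<mu> * corr r u" if r: "r > 0" for r
  proof -
    note d = ext0_dil_sqint(1)[OF r]
    have L2: "?D r u \<in> L2 \<Omega>" "(\<lambda>p. of_real r * ?D r (X u) p) \<in> L2 \<Omega>" "(\<lambda>p. of_real r * ?D r (Y u) p) \<in> L2 \<Omega>"
      using d uS by (simp_all add: L2_eq_sqint sqint_scale)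
    note wX = weak_deriv_eq[OF open_\<Omega> L2(1,2) dil_weak_deriv[OF shear_field_X dil_field_X r uS(1,2) \<phi>(1,2,3)]]
    note wY = weak_deriv_eq[OF open_\<Omega> L2(1,3) dil_weak_deriv[OF shear_field_Y dil_field_Y r uS(1,3) \<phi>(1,2,4)]]
    have vS: "?D r u \<in> S1 \<Omega>" using wX wY by (simp add: S1_eq)
    have c: "sip M f (W (?D r u)) = of_real r * corr r f"
      if "f \<in> sqint M" "AE p in M. W (?D r u) p = of_real r * ?D r f p" "W (?D r u) \<in> sqint M" for W f
    proof -
      have "sip M f (W (?D r u)) = sip M f (fscale (of_real r) (?D r f))"
        using that sqint_meas[OF sq.sc_mem[OF d[OF that(1)], of "of_real r"]]
        by (intro sip_cong_AE) (simp_all add: fscale_def sqint_meas)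
      also have "\<dots> = of_real r * corr r f" using that(1) d by (simp add: sq.sc_right corr_def)
      finally show ?thesis .
    qed
    have "sub_form \<Omega> u (?D r u) = of_real r * corr r (X u) + of_real r * corr r (Y u)"
      unfolding sub_form_def L2_inner_eq_sip using c[of "X u" X] c[of "Y u" Y] uS wX(2) wY(2) S1_sqint[OF vS] by simp
    then show ?thesis using eig[OF vS] by (simp add: L2_inner_eq_sip corr_def distrib_left)
  qed
  \<comment> \<open>Let c = \<open>corr r u\<close> and let C be the sum of \<open>corr r\<close> at
    X u and Y u. The equations for r and for 1/r read r C = \<mu> c and C = \<mu> r c, so \<mu> (r^2
    - 1) c = 0.\<close>
  have corr0: "corr r u = 0" if r: "r > 1" for r
  proof -
    have r0: "r > 0" "1 / r > 0" using r by simp_all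
    have *: "of_real (1 / r) * (of_real (r ^ 4) * cnj (corr r (X u)) + of_real (r ^ 4) * cnj (corr r (Y u))) =
      of_real \<mu> * (of_real (r ^ 4) * cnj (corr r u))"
      using 1[OF r0(2)] uS by (simp only: corr_inverse[OF r0(1)])
    have "of_real (r ^ 4) * (cnj (corr r (X u)) + cnj (corr r (Y u))) =
        of_real r * (of_real (1 / r) * (of_real (r ^ 4) * cnj (corr r (X u)) + of_real (r ^ 4) * cnj (corr r (Y u))))"
      using r0 by (simp add: distrib_left)
    also have "\<dots> = of_real (r ^ 4) * (of_real \<mu> * of_real r * cnj (corr r u))"
      unfolding * by (simp only: mult_ac)
    finally have "cnj (corr r (X u) + corr r (Y u)) = cnj (of_real \<mu> * of_real r * corr r u)"
      using r0 by simp
    then have "corr r (X u) + corr r (Y u) = of_real \<mu> * of_real r * corr r u" by (simp only: complex_cnj_cancel_iff)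
    with 1[OF r0(1)] have "of_real \<mu> * (of_real (r\<^sup>2) - 1) * corr r u = 0"
      by (simp add: power2_eq_square algebra_simps)
    moreover have "of_real (r\<^sup>2) - 1 \<noteq> (0::complex)"
    proof -
      have "1 < r\<^sup>2" using r by (simp add: one_less_power)
      then have "r\<^sup>2 - 1 \<noteq> 0" by linarith
      then have "complex_of_real (r\<^sup>2 - 1) \<noteq> 0" by (simp only: of_real_eq_0_iff not_False_eq_True)
      then show ?thesis by simp
    qed
    ultimately show ?thesis using L by simp
  qed
  \<comment> \<open>Dilation is continuous at r = 1 on a fixed test function \<psi>. For r > 1 the
    pairing of u with the dilate of \<psi> equals that with the dilate of \<psi> - u, and the factor
    r^4 at least 1 makes the resulting bound uniform in r.\<close>
  have bound: "cmod (sip M u \<psi>) \<le> sqrt (sq.sq M u) * sqrt (sq.sq M (\<psi> - u))" if \<psi>: "\<psi> \<in> test_functions \<Omega>" for \<psi>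
  proof -
    define r where "r = (\<lambda>n. 1 + 1 / real (Suc n))"
    have r: "r n > 1" "r n > 0" for n by (auto simp: r_def add_pos_pos)
    have e: "ext0 \<Omega> \<psi> = \<psi>" using test_function_outside[OF \<psi>] by (intro ext0_id)
    note C1 = test_function_C1[OF \<psi>]
    note S = test_function_sqint(1)[OF open_\<Omega> \<psi>]
    have DS: "?D (r n) \<psi> \<in> sqint M" "?D (r n) u \<in> sqint M" for n by (intro ext0_dil_sqint(1) r S uS)+
    obtain B where B: "\<And>p. cmod (\<psi> p) \<le> B"
      using continuous_bounded_support_bounded[OF C1fun_continuous[OF C1] test_function_bounded_support[OF \<psi>]] by blast
    have "(\<lambda>n. LINT p|M. u p * cnj (?D (r n) \<psi> p)) \<longlonglongrightarrow> (LINT p|M. u p * cnj (\<psi> p))"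
    proof (rule integral_dominated_convergence)
      \<comment> \<open>Finite measure makes u integrable: it is a product of two square-integrable
        functions.\<close>
      have "(\<lambda>p. indicator \<Omega> p) \<in> sqint M" using open_\<Omega> fin by (intro indicator_sqint) auto
      then have "integrable M (\<lambda>p. u p * indicator \<Omega> p)" by (rule sqint_mult_integrable[OF uS(1)])
      then have "integrable M (\<lambda>p. B * cmod (u p * indicator \<Omega> p))" by (intro integrable_mult_right integrable_norm)
      then show "integrable M (\<lambda>p. B * cmod (u p))"
        by (rule Bochner_Integration.integrable_cong[THEN iffD1, rotated -1]) (auto simp: indicator_def)
      show "(\<lambda>p. u p * cnj (\<psi> p)) \<in> borel_measurable M" "(\<lambda>p. u p * cnj (?D (r n) \<psi> p)) \<in> borel_measurable M" for n
        by (intro borel_measurable_times borel_measurable_cnj sqint_meas uS S DS)+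
      show "AE p in M. (\<lambda>n. u p * cnj (?D (r n) \<psi> p)) \<longlonglongrightarrow> u p * cnj (\<psi> p)"
      proof (rule AE_I2)
        fix p
        have "r \<longlonglongrightarrow> 1 + 0" unfolding r_def by (intro tendsto_intros LIMSEQ_Suc lim_1_over_n)
        then have r1: "r \<longlonglongrightarrow> 1" by simp
        obtain x y t :: real where p: "p = (x, y, t)" by (cases p)
        have "(\<lambda>n. (r n * x, r n * y, (r n)\<^sup>2 * t)) \<longlonglongrightarrow> (1 * x, 1 * y, 1\<^sup>2 * t)"
          by (intro tendsto_Pair tendsto_mult tendsto_power r1 tendsto_const)
        then have "(\<lambda>n. dil (r n) p) \<longlonglongrightarrow> p" by (simp add: p)
        moreover have "isCont \<psi> p" using C1fun_continuous[OF C1] continuous_on_eq_continuous_at[OF open_UNIV] by blast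
        ultimately have "(\<lambda>n. \<psi> (dil (r n) p)) \<longlonglongrightarrow> \<psi> p" using isCont_tendsto_compose by blast
        then show "(\<lambda>n. u p * cnj (?D (r n) \<psi> p)) \<longlonglongrightarrow> u p * cnj (\<psi> p)" unfolding e by (intro tendsto_intros)
      qed
      show "AE p in M. norm (u p * cnj (?D (r n) \<psi> p)) \<le> B * cmod (u p)" for n
        unfolding e using B mult_right_mono[OF B norm_ge_zero] by (intro AE_I2) (simp add: norm_mult mult.commute[of "cmod (u _)"])
    qed
    then have "(\<lambda>n. cmod (sip M u (?D (r n) \<psi>))) \<longlonglongrightarrow> cmod (sip M u \<psi>)" unfolding sip_def by (rule tendsto_norm)
    moreover have "cmod (sip M u (?D (r n) \<psi>)) \<le> sqrt (sq.sq M u) * sqrt (sq.sq M (\<psi> - u))" for n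
    proof -
      have "sip M u (?D (r n) \<psi>) = sip M u (?D (r n) \<psi> - ?D (r n) u)"
        using corr0[OF r(1)[of n]] DS[of n] uS by (simp add: sq.diff_right corr_def)
      also have "?D (r n) \<psi> - ?D (r n) u = ?D (r n) (\<psi> - u)" by (auto simp: ext0_def fun_eq_iff)
      also have "cmod (sip M u (?D (r n) (\<psi> - u))) \<le> sqrt (sq.sq M u) * sqrt (sq.sq M (?D (r n) (\<psi> - u)))"
        by (intro sq.cauchy_schwarz uS ext0_dil_sqint(1) r sq.diff_mem S)
      also have "\<dots> \<le> sqrt (sq.sq M u) * sqrt (sq.sq M (\<psi> - u))"
      proof (intro mult_left_mono real_sqrt_le_mono)
        have "1 * sq.sq M (?D (r n) (\<psi> - u)) \<le> r n ^ 4 * sq.sq M (?D (r n) (\<psi> - u))"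
          using r(1)[of n] by (intro mult_right_mono sq.sq_nonneg ext0_dil_sqint(1) r sq.diff_mem S uS) simp
        also have "\<dots> \<le> sq.sq M (\<psi> - u)" by (intro ext0_dil_sqint(2) r sq.diff_mem S uS)
        finally show "sq.sq M (?D (r n) (\<psi> - u)) \<le> sq.sq M (\<psi> - u)" by simp
      qed (use uS in simp)
      finally show ?thesis .
    qed
    ultimately show ?thesis by (intro LIMSEQ_le_const2) auto
  qed
  note S = test_function_sqint(1)[OF open_\<Omega> \<phi>(1)]
  \<comment> \<open>Along the approximating test functions the bound tends to 0, while the pairing
    tends to the squared norm of u.\<close>
  have "(\<lambda>n. cmod (sip M (\<phi> n) u)) \<longlonglongrightarrow> cmod (sip M u u)"
    by (intro tendsto_norm sq.h_tendsto S uS \<phi>)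
  moreover have "cmod (sip M (\<phi> n) u) = cmod (sip M u (\<phi> n))" for n
    using sq.herm[OF uS(1) S, of n] by simp
  moreover have "(\<lambda>n. sqrt (sq.sq M u) * sqrt (sq.sq M (\<phi> n - u))) \<longlonglongrightarrow> sqrt (sq.sq M u) * sqrt 0"
    by (intro tendsto_intros \<phi>)
  ultimately have "cmod (sip M u u) \<le> sqrt (sq.sq M u) * sqrt 0"
    using bound[OF \<phi>(1)] by (intro LIMSEQ_le) auto
  then have "sq.sq M u = 0" by (simp add: sq.sq_def)
  then show ?thesis using uS by (simp add: sq_eq_0_iff)
qed

end


section \<open>Landau level functions\<close>

lemma has_derivative_integral:
  fixes f f' :: "real \<Rightarrow> 'a \<Rightarrow> real"
  assumes fin: "finite_measure M"
    and int: "\<And>s. integrable M (f s)" and meas: "\<And>s. f' s \<in> borel_measurable M"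
    and deriv: "\<And>s p. ((\<lambda>s. f s p) has_real_derivative f' s p) (at s)"
    and bound: "\<And>s p. \<bar>f' s p\<bar> \<le> C"
  shows "((\<lambda>s. LINT p|M. f s p) has_real_derivative (LINT p|M. f' s p)) (at s)"
proof -
  have lip: "\<bar>f (s + h) p - f s p\<bar> \<le> C * \<bar>h\<bar>" for h p
    using field_differentiable_bound[of UNIV "\<lambda>s. f s p" "\<lambda>s. f' s p" C s "s + h"] deriv bound by (simp add: has_field_derivative_at_within)
  have "((\<lambda>h. ((LINT p|M. f (s + h) p) - (LINT p|M. f s p)) / h) \<longlongrightarrow> (LINT p|M. f' s p)) (at 0)"
    unfolding tendsto_at_iff_sequentially comp_def
  proof (intro allI impI)
    fix h :: "nat \<Rightarrow> real" assume h: "\<forall>i. h i \<in> UNIV - {0}" "h \<longlonglongrightarrow> 0"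
    have "(\<lambda>n. LINT p|M. (f (s + h n) p - f s p) / h n) \<longlonglongrightarrow> (LINT p|M. f' s p)"
    proof (rule integral_dominated_convergence)
      show "integrable M (\<lambda>p. C)" using fin by (simp add: finite_measure.integrable_const)
      show "(\<lambda>p. (f (s + h n) p - f s p) / h n) \<in> borel_measurable M" for n
        using int by (intro borel_measurable_divide borel_measurable_diff) auto
      show "AE p in M. (\<lambda>n. (f (s + h n) p - f s p) / h n) \<longlonglongrightarrow> f' s p"
      proof (rule AE_I2)
        fix p
        have "((\<lambda>h. (f (s + h) p - f s p) / h) \<longlongrightarrow> f' s p) (at 0)" using deriv[of p s] by (simp add: DERIV_def)
        then show "(\<lambda>n. (f (s + h n) p - f s p) / h n) \<longlonglongrightarrow> f' s p"
          using h unfolding tendsto_at_iff_sequentially comp_def by blast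
      qed
      show "AE p in M. norm ((f (s + h n) p - f s p) / h n) \<le> C" for n
        using lip h(1) by (intro AE_I2) (simp add: pos_divide_le_eq)
    qed (rule meas)
    moreover have "(LINT p|M. (f (s + h n) p - f s p) / h n) = ((LINT p|M. f (s + h n) p) - (LINT p|M. f s p)) / h n" for n
      using int by simp
    ultimately show "(\<lambda>n. ((LINT p|M. f (s + h n) p) - (LINT p|M. f s p)) / h n) \<longlonglongrightarrow> (LINT p|M. f' s p)"
      by (simp only:)
  qed
  then show ?thesis by (simp add: DERIV_def)
qed

lemma square_exp_bound:
  fixes L z :: real assumes "L > 0"
  shows "z\<^sup>2 * exp (- (L * z\<^sup>2)) \<le> 1 / L" "\<bar>z\<bar> * exp (- (L * z\<^sup>2)) \<le> 1 + 1 / L"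
proof -
  have e: "exp (- (L * z\<^sup>2)) \<le> 1" using assms by simp
  have "L * z\<^sup>2 \<le> exp (L * z\<^sup>2)" using exp_ge_add_one_self[of "L * z\<^sup>2"] by linarith
  then show 1: "z\<^sup>2 * exp (- (L * z\<^sup>2)) \<le> 1 / L" using assms by (simp add: exp_minus field_simps)
  have "\<bar>z\<bar> \<le> 1 + z\<^sup>2"
  proof (cases "\<bar>z\<bar> \<le> 1")
    case True
    then show ?thesis using zero_le_power2[of z] by linarith
  next
    case False
    then have "\<bar>z\<bar> * 1 \<le> \<bar>z\<bar> * \<bar>z\<bar>" by (intro mult_left_mono) auto
    then show ?thesis by (simp add: power2_eq_square)
  qed
  then have "\<bar>z\<bar> * exp (- (L * z\<^sup>2)) \<le> (1 + z\<^sup>2) * exp (- (L * z\<^sup>2))" by (intro mult_right_mono) auto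
  also have "\<dots> = exp (- (L * z\<^sup>2)) + z\<^sup>2 * exp (- (L * z\<^sup>2))" by (simp add: distrib_right)
  also have "\<dots> \<le> 1 + 1 / L" using 1 e by (intro add_mono)
  finally show "\<bar>z\<bar> * exp (- (L * z\<^sup>2)) \<le> 1 + 1 / L" .
qed

section \<open>Gaussian solutions of the eigenvalue equation\<close>

definition gauss :: "real \<Rightarrow> real \<Rightarrow> heis \<Rightarrow> real" where
  "gauss L s = (\<lambda>(x, y, t). exp (- (L * (y - s)\<^sup>2)))"

text \<open>The phase t + 2xy is annihilated by Y, and X maps it to 4y; with the factor L/4 and the
  term -L s x the phase has X-derivative L (y - s). The Gaussian depends on y only, so X does not
  see it and Y multiplies it by -L (y - s).\<close>

definition landau :: "real \<Rightarrow> real \<Rightarrow> heis \<Rightarrow> complex" where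
  "landau L s p = exp (of_real (- (L / 2) * (fst (snd p) - s)\<^sup>2) +
     \<i> * of_real (L / 4 * (snd (snd p) + 2 * (fst p * fst (snd p))) - L * s * fst p))"

definition shifted_y :: "real \<Rightarrow> heis \<Rightarrow> complex" where
  "shifted_y s p = of_real (fst (snd p) - s)"

lemma shifted_y_C1: "C1fun (shifted_y s)"
  and field_deriv_shifted_y: "field_deriv field_X (shifted_y s) p = 0" "field_deriv field_Y (shifted_y s) p = 1"
proof -
  have d: "(shifted_y s has_derivative (\<lambda>v. of_real (fst (snd v)))) (at p)" for p
    unfolding shifted_y_def[abs_def] by (auto intro!: derivative_eq_intros)
  show "C1fun (shifted_y s)" by (rule C1funI[OF d]) simp
  show "field_deriv field_X (shifted_y s) p = 0" "field_deriv field_Y (shifted_y s) p = 1"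
    by (cases p; simp add: field_deriv_def frechet_derivative_eqI[OF d])+
qed

text \<open>The two derivatives combine to (X + iY) U = 0: U is annihilated by a ladder operator,
  which marks the lowest Landau level.\<close>

lemma landau_C1: "C1fun (landau L s)"
  and field_deriv_landau_X: "field_deriv field_X (landau L s) = (\<lambda>p. \<i> * of_real L * (shifted_y s p * landau L s p))"
  and field_deriv_landau_Y: "field_deriv field_Y (landau L s) = (\<lambda>p. - of_real L * (shifted_y s p * landau L s p))"
proof -
  let ?E = "\<lambda>p::heis. complex_of_real (- (L / 2) * (fst (snd p) - s)\<^sup>2) +
     \<i> * of_real (L / 4 * (snd (snd p) + 2 * (fst p * fst (snd p))) - L * s * fst p)"
  define E' where "E' = (\<lambda>(p::heis) (v::heis). complex_of_real (- L * (fst (snd p) - s) * fst (snd v)) +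
     \<i> * of_real (L / 4 * (snd (snd v) + 2 * (fst p * fst (snd v) + fst v * fst (snd p))) - L * s * fst v))"
  have E: "(?E has_derivative E' p) (at p)" for p
  proof -
    have "((\<lambda>p::heis. - (L / 2) * (fst (snd p) - s)\<^sup>2) has_derivative
        (\<lambda>v. - L * (fst (snd p) - s) * fst (snd v))) (at p)"
      by (auto intro!: derivative_eq_intros)
    moreover have "((\<lambda>p::heis. L / 4 * (snd (snd p) + 2 * (fst p * fst (snd p))) - L * s * fst p) has_derivative
        (\<lambda>v. L / 4 * (snd (snd v) + 2 * (fst p * fst (snd v) + fst v * fst (snd p))) - L * s * fst v)) (at p)"
      by (auto intro!: derivative_eq_intros)
    ultimately show ?thesis
      unfolding E'_def by (intro has_derivative_add has_derivative_of_real has_derivative_mult_right)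
  qed
  have d: "(landau L s has_derivative (\<lambda>v. landau L s p * E' p v)) (at p)" for p
    unfolding landau_def[abs_def]
    by (rule has_derivative_compose[OF E DERIV_exp[unfolded has_field_derivative_def]])
  have c: "continuous_on UNIV (landau L s)" unfolding landau_def[abs_def] by (intro continuous_intros)
  show "C1fun (landau L s)"
    by (rule C1funI[OF d]) (unfold E'_def, intro continuous_intros c)
  show "field_deriv field_X (landau L s) = (\<lambda>p. \<i> * of_real L * (shifted_y s p * landau L s p))"
    "field_deriv field_Y (landau L s) = (\<lambda>p. - of_real L * (shifted_y s p * landau L s p))"
    by (auto simp: field_deriv_def frechet_derivative_eqI[OF d] E'_def shifted_y_def fun_eq_iff algebra_simps)
qed

lemma norm_landau: "(cmod (landau L s p))\<^sup>2 = gauss L s p"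
  by (cases p) (simp add: landau_def norm_exp_eq_Re gauss_def power2_eq_square flip: exp_add)

lemma C1fun_const: "C1fun (\<lambda>p. c)"
  by (rule C1funI[of _ "\<lambda>p v. 0"]) auto

lemma field_deriv_cmult: "C1fun f \<Longrightarrow> field_deriv V (\<lambda>p. c * f p) p = c * field_deriv V f p"
  by (simp add: field_deriv_mult[OF C1fun_const]) (simp add: field_deriv_def)

text \<open>The two terms quadratic in y - s cancel; what remains is -L U, which comes from Y(y - s)
  = 1, while X(y - s) = 0.\<close>

lemma landau_second_derivatives:
  "C1fun (field_deriv field_X (landau L s))" "C1fun (field_deriv field_Y (landau L s))"
  "field_deriv field_X (field_deriv field_X (landau L s)) p + field_deriv field_Y (field_deriv field_Y (landau L s)) p
     = - of_real L * landau L s p"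
proof -
  have c: "C1fun (\<lambda>p. shifted_y s p * landau L s p)" by (intro C1fun_mult shifted_y_C1 landau_C1)
  show "C1fun (field_deriv field_X (landau L s))" "C1fun (field_deriv field_Y (landau L s))"
    unfolding field_deriv_landau_X field_deriv_landau_Y by (intro C1fun_mult C1fun_const c)+
  have X: "field_deriv field_X (\<lambda>p. shifted_y s p * landau L s p) p = shifted_y s p * (\<i> * of_real L * (shifted_y s p * landau L s p))"
    by (simp add: field_deriv_mult[OF shifted_y_C1 landau_C1] field_deriv_shifted_y field_deriv_landau_X)
  have Y: "field_deriv field_Y (\<lambda>p. shifted_y s p * landau L s p) p =
      landau L s p - shifted_y s p * (of_real L * (shifted_y s p * landau L s p))"
    by (simp add: field_deriv_mult[OF shifted_y_C1 landau_C1] field_deriv_shifted_y field_deriv_landau_Y)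
  show "field_deriv field_X (field_deriv field_X (landau L s)) p + field_deriv field_Y (field_deriv field_Y (landau L s)) p
     = - of_real L * landau L s p"
    unfolding field_deriv_landau_X field_deriv_landau_Y field_deriv_cmult[OF c] X Y
    by (simp add: algebra_simps)
qed

context heis_open begin

text \<open>Twice the integrand is \<open>g2\<close>, the second derivative of \<open>gauss\<close>
  in the centre s, and differentiation under the integral is justified by bounds uniform in s and p.
  \<Omega> may be unbounded in y, so decay of G at infinity is a matter of dominated convergence on
  a finite measure.\<close>

lemma gauss_second_moment_negative:
  assumes fin: "emeasure lebesgue \<Omega> < \<infinity>" and ne: "\<Omega> \<noteq> {}" and L: "L > 0"
  shows "\<exists>s. (LINT p|M. (2 * L\<^sup>2 * (fst (snd p) - s)\<^sup>2 - L) * gauss L s p) < 0"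
proof -
  let ?y = "\<lambda>p::heis. fst (snd p)"
  define g1 where "g1 = (\<lambda>s p. 2 * L * (?y p - s) * gauss L s p)"
  define g2 where "g2 = (\<lambda>s p. 2 * ((2 * L\<^sup>2 * (?y p - s)\<^sup>2 - L) * gauss L s p))"
  have g: "gauss L s p = exp (- (L * (?y p - s)\<^sup>2))" for s p by (cases p) (simp add: gauss_def)
  have fm: "finite_measure M"
    using fin open_\<Omega> by (intro finite_measureI) (simp add: emeasure_restrict_space)
  have cont: "continuous_on UNIV (gauss L s)" "continuous_on UNIV (g1 s)" "continuous_on UNIV (g2 s)" for s
    unfolding g1_def g2_def g by (intro continuous_intros)+
  have meas: "f \<in> borel_measurable M" if "continuous_on UNIV f" for f :: "heis \<Rightarrow> real"
    using that by (intro measurable_restrict_space1 measurable_completion) (simp add: borel_measurable_continuous_onI)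
  have bdd: "integrable M f" if "continuous_on UNIV f" "\<And>p. \<bar>f p\<bar> \<le> C" for f :: "heis \<Rightarrow> real" and C
    using that by (intro finite_measure.integrable_const_bound[OF fm, of _ C] meas) auto
  have b0: "\<bar>gauss L s p\<bar> \<le> 1" for s p using L by (simp add: g)
  have b1: "\<bar>g1 s p\<bar> \<le> 2 * L * (1 + 1 / L)" for s p
  proof -
    have "\<bar>g1 s p\<bar> = 2 * L * (\<bar>?y p - s\<bar> * gauss L s p)" using L by (simp add: g1_def g abs_mult)
    also have "\<dots> \<le> 2 * L * (1 + 1 / L)"
      using square_exp_bound(2)[OF L, of "?y p - s"] L by (intro mult_left_mono) (simp_all add: g)
    finally show ?thesis .
  qed
  have b2: "\<bar>g2 s p\<bar> \<le> 4 * L\<^sup>2 * (1 / L) + 2 * L" for s p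
  proof -
    have 0: "0 \<le> gauss L s p" by (simp add: g)
    have "g2 s p = 4 * L\<^sup>2 * ((?y p - s)\<^sup>2 * gauss L s p) - 2 * L * gauss L s p" by (simp add: g2_def algebra_simps)
    moreover have "4 * L\<^sup>2 * ((?y p - s)\<^sup>2 * gauss L s p) \<le> 4 * L\<^sup>2 * (1 / L)"
      using square_exp_bound(1)[OF L, of "?y p - s"] by (intro mult_left_mono) (simp_all add: g)
    moreover have "0 \<le> 4 * L\<^sup>2 * ((?y p - s)\<^sup>2 * gauss L s p)" using 0 by simp
    moreover have "2 * L * gauss L s p \<le> 2 * L * 1" using b0[of s p] L by (intro mult_left_mono) auto
    moreover have "0 \<le> 2 * L * gauss L s p" using 0 L by simp
    ultimately show ?thesis by linarith
  qed
  define G where "G = (\<lambda>s. LINT p|M. gauss L s p)"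
  define G1 where "G1 = (\<lambda>s. LINT p|M. g1 s p)"
  have "((\<lambda>s. gauss L s p) has_real_derivative g1 s p) (at s)" for s p
    unfolding g1_def g by (auto intro!: derivative_eq_intros simp: algebra_simps)
  from has_derivative_integral[OF fm bdd[OF cont(1) b0] meas[OF cont(2)] this b1]
  have G': "(G has_real_derivative G1 s) (at s)" for s unfolding G_def G1_def .
  have "((\<lambda>s. g1 s p) has_real_derivative g2 s p) (at s)" for s p
    unfolding g1_def g2_def g by (auto intro!: derivative_eq_intros simp: algebra_simps power2_eq_square)
  from has_derivative_integral[OF fm bdd[OF cont(2) b1] meas[OF cont(3)] this b2]
  have G'': "(G1 has_real_derivative (LINT p|M. g2 s p)) (at s)" for s unfolding G1_def .
  have G0: "G 0 > 0"
  proof -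
    have "G 0 \<ge> 0" unfolding G_def by (intro Bochner_Integration.integral_nonneg) (simp add: g)
    moreover have "G 0 \<noteq> 0"
    proof
      assume "G 0 = 0"
      then have "AE p in M. gauss L 0 p = 0"
        unfolding G_def using integral_nonneg_eq_0_iff_AE[OF bdd[OF cont(1) b0]] by (simp add: g)
      then have "AE p in M. False" by (simp add: g)
      then have "AE p in lebesgue. p \<notin> \<Omega>" using AE_lebesgue_on_iff[OF open_\<Omega>, of "\<lambda>_. False"] by simp
      then have "\<Omega> \<in> null_sets lebesgue" using open_\<Omega> by (subst AE_iff_null_sets) auto
      then show False using open_not_negligible[OF open_\<Omega> ne] by (simp add: negligible_iff_null_sets)
    qed
    ultimately show ?thesis by linarith
  qed
  have lim: "(\<lambda>n. G (c n)) \<longlonglongrightarrow> 0" if c: "filterlim (\<lambda>n. \<bar>c n\<bar>) at_top sequentially" for c :: "nat \<Rightarrow> real"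
  proof -
    have "(\<lambda>n. LINT p|M. gauss L (c n) p) \<longlonglongrightarrow> (LINT p|M. 0)"
    proof (rule integral_dominated_convergence)
      show "integrable M (\<lambda>p. 1)" using fm by (simp add: finite_measure.integrable_const)
      show "gauss L (c n) \<in> borel_measurable M" for n by (rule meas[OF cont(1)])
      show "AE p in M. norm (gauss L (c n) p) \<le> 1" for n using b0 by simp
      show "AE p in M. (\<lambda>n. gauss L (c n) p) \<longlonglongrightarrow> 0"
      proof (rule AE_I2)
        fix p
        have "filterlim (\<lambda>n. - \<bar>?y p\<bar> + \<bar>c n\<bar>) at_top sequentially"
          by (rule filterlim_tendsto_add_at_top[OF tendsto_const c])
        then have "filterlim (\<lambda>n. \<bar>?y p - c n\<bar>) at_top sequentially"
          by (rule filterlim_at_top_mono) (auto intro!: always_eventually)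
        then have "filterlim (\<lambda>n. \<bar>?y p - c n\<bar> ^ 2) at_top sequentially"
          by (intro filterlim_pow_at_top) auto
        then have "filterlim (\<lambda>n. L * (?y p - c n)\<^sup>2) at_top sequentially"
          using L by (intro filterlim_tendsto_pos_mult_at_top[OF tendsto_const]) simp_all
        then have "(\<lambda>n. exp (- (L * (?y p - c n)\<^sup>2))) \<longlonglongrightarrow> 0"
          by (intro filterlim_compose[OF exp_at_bot] filterlim_compose[OF filterlim_uminus_at_bot_at_top])
        then show "(\<lambda>n. gauss L (c n) p) \<longlonglongrightarrow> 0" by (simp add: g)
      qed
    qed simp
    then show ?thesis by (simp add: G_def)
  qed
  have "\<forall>\<^sub>F n in sequentially. G (real n) < G 0"
    using lim[of real] G0 by (intro order_tendstoD) (simp_all add: filterlim_real_sequentially)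
  moreover have "\<forall>\<^sub>F n in sequentially. G (- real n) < G 0"
    using lim[of "\<lambda>n. - real n"] G0 by (intro order_tendstoD) (simp_all add: filterlim_real_sequentially)
  moreover have "\<forall>\<^sub>F n in sequentially. 0 < real n"
    using eventually_gt_at_top[of "0::nat"] by eventually_elim simp
  ultimately have "\<forall>\<^sub>F n in sequentially. G (real n) < G 0 \<and> G (- real n) < G 0 \<and> 0 < real n"
    by eventually_elim blast
  then obtain n where n: "G (real n) < G 0" "G (- real n) < G 0" "0 < real n"
    by (auto simp: eventually_sequentially)
  \<comment> \<open>Mean value theorem on both sides of 0: G has positive slope at some z1 < 0 and
    negative slope at some z2 > 0, hence a negative second derivative between them.\<close>
  obtain z1 where z1: "- real n < z1" "z1 < 0" "G 0 - G (- real n) = (0 - - real n) * G1 z1"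
    using MVT2[of "- real n" 0 G G1] n(3) G' by auto
  obtain z2 where z2: "0 < z2" "z2 < real n" "G (real n) - G 0 = (real n - 0) * G1 z2"
    using MVT2[of 0 "real n" G G1] n(3) G' by auto
  have "real n * G1 z1 > 0" using z1(3) n(2) by simp
  then have s1: "G1 z1 > 0" using n(3) by (simp add: zero_less_mult_iff)
  have "real n * G1 z2 < 0" using z2(3) n(1) by simp
  then have s2: "G1 z2 < 0" using n(3) by (simp add: mult_less_0_iff)
  obtain z where z: "G1 z2 - G1 z1 = (z2 - z1) * (LINT p|M. g2 z p)"
    using MVT2[of z1 z2 G1 "\<lambda>s. LINT p|M. g2 s p"] z1 z2 G'' by auto
  have "(z2 - z1) * (LINT p|M. g2 z p) < 0" using z s1 s2 by linarith
  then have "(LINT p|M. g2 z p) < 0" using z1(2) z2(1) by (simp add: mult_less_0_iff)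
  then have "(LINT p|M. (2 * L\<^sup>2 * (?y p - z)\<^sup>2 - L) * gauss L z p) < 0" unfolding g2_def by simp
  then show ?thesis by blast
qed

text \<open>U is not in the Dirichlet form domain; it solves the equation only against functions in
  \<open>S1_0 \<Omega>\<close>, for which no boundary term arises. Both U and its derivatives are
  bounded, so finite measure makes them square-integrable.\<close>

theorem landau_trial_function:
  assumes fin: "emeasure lebesgue \<Omega> < \<infinity>" and ne: "\<Omega> \<noteq> {}" and L: "L > 0"
  shows "\<exists>U\<in>S1 \<Omega>. a.sq U < L * h.sq U \<and> (\<forall>v\<in>S1_0 \<Omega>. sub_form \<Omega> U v = of_real L * L2_inner \<Omega> U v)"
proof -
  obtain s where s: "(LINT p|M. (2 * L\<^sup>2 * (fst (snd p) - s)\<^sup>2 - L) * gauss L s p) < 0"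
    using gauss_second_moment_negative[OF assms] by blast
  let ?U = "landau L s"
  let ?X = "field_deriv field_X ?U" and ?Y = "field_deriv field_Y ?U"
  have fm: "finite_measure M"
    using fin open_\<Omega> by (intro finite_measureI) (simp add: emeasure_restrict_space)
  have bdd: "f \<in> sqint M" if "continuous_on UNIV f" "\<And>p. (cmod (f p))\<^sup>2 \<le> C" for f C
  proof (rule sqintI)
    show m: "f \<in> borel_measurable M" by (rule continuous_measurable_lebesgue_on[OF that(1)])
    show "integrable M (\<lambda>p. (cmod (f p))\<^sup>2)"
      by (rule finite_measure.integrable_const_bound[OF fm, of _ C]) (use m that(2) in auto)
  qed
  have sq_X: "(cmod (?X p))\<^sup>2 = L\<^sup>2 * ((fst (snd p) - s)\<^sup>2 * gauss L s p)"
    and sq_Y: "(cmod (?Y p))\<^sup>2 = L\<^sup>2 * ((fst (snd p) - s)\<^sup>2 * gauss L s p)" for p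
    by (simp_all add: field_deriv_landau_X field_deriv_landau_Y norm_mult power_mult_distrib norm_landau shifted_y_def
        flip: of_real_diff)
  have gb: "gauss L s p \<le> 1" for p using L by (cases p) (simp add: gauss_def)
  have yb: "L\<^sup>2 * ((fst (snd p) - s)\<^sup>2 * gauss L s p) \<le> L\<^sup>2 * (1 / L)" for p
  proof (rule mult_left_mono)
    show "(fst (snd p) - s)\<^sup>2 * gauss L s p \<le> 1 / L"
      using square_exp_bound(1)[OF L, of "fst (snd p) - s"] by (cases p) (simp add: gauss_def)
  qed simp
  note C1 = landau_C1[of L s]
  have S: "?U \<in> sqint M" "?X \<in> sqint M" "?Y \<in> sqint M"
    by (rule bdd[OF C1fun_continuous[OF C1], of 1], simp add: norm_landau gb)
       (rule bdd[OF field_deriv_continuous[OF shear_field_X C1]], unfold sq_X, rule yb,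
        rule bdd[OF field_deriv_continuous[OF shear_field_Y C1]], unfold sq_Y, rule yb)
  have US: "?U \<in> S1 \<Omega>" by (rule C1fun_S1[OF C1 S])
  note wX = C1fun_weak_deriv(2)[OF shear_field_X C1 S(1,2)] and wY = C1fun_weak_deriv(2)[OF shear_field_Y C1 S(1,3)]
  note W = S1_sqint[OF US]
  have "a.sq ?U - L * h.sq ?U = sq.sq M ?X + sq.sq M ?Y - L * sq.sq M ?U"
    using sq_cong_AE[OF wX W(2) S(2)] sq_cong_AE[OF wY W(3) S(3)] by (simp add: a_sq h_sq)
  also have "\<dots> = (LINT p|M. (cmod (?X p))\<^sup>2 + (cmod (?Y p))\<^sup>2 - L * (cmod (?U p))\<^sup>2)"
    using S[THEN sqint_integrable] by (simp add: sq_sq S)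
  also have "\<dots> = (LINT p|M. (2 * L\<^sup>2 * (fst (snd p) - s)\<^sup>2 - L) * gauss L s p)"
    by (intro Bochner_Integration.integral_cong refl) (simp add: sq_X sq_Y norm_landau algebra_simps)
  finally have lt: "a.sq ?U < L * h.sq ?U" using s by simp
  \<comment> \<open>The approximated function v stands in the first argument, where
    \<open>sq.h_tendsto\<close> applies; Hermitian symmetry swaps the arguments at the end.\<close>
  have eig: "sip M (X v) ?X + sip M (Y v) ?Y = of_real L * sip M v ?U" if v: "v \<in> S1_0 \<Omega>" for v
  proof -
    obtain \<phi> where \<phi>: "\<And>n::nat. \<phi> n \<in> test_functions \<Omega>" "(\<lambda>n. sq.sq M (\<phi> n - v)) \<longlonglongrightarrow> 0"
      "(\<lambda>n. sq.sq M (field_deriv field_X (\<phi> n) - X v)) \<longlonglongrightarrow> 0" "(\<lambda>n. sq.sq M (field_deriv field_Y (\<phi> n) - Y v)) \<longlonglongrightarrow> 0"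
      by (rule S1_0_approx[OF v]) blast
    note vS = S1_sqint[OF S1_0_sub[OF v]]
    note \<phi>S = test_function_sqint(1)[OF open_\<Omega> \<phi>(1)] test_function_sqint(2)[OF open_\<Omega> \<phi>(1) shear_field_X]
      test_function_sqint(2)[OF open_\<Omega> \<phi>(1) shear_field_Y]
    have "sip M (field_deriv field_X (\<phi> n)) ?X + sip M (field_deriv field_Y (\<phi> n)) ?Y = of_real L * sip M (\<phi> n) ?U" for n
    proof -
      note bp = sip_field_deriv_test_function[OF shear_field_X landau_second_derivatives(1)[of L s] \<phi>(1)[of n]]
        sip_field_deriv_test_function[OF shear_field_Y landau_second_derivatives(2)[of L s] \<phi>(1)[of n]]
      let ?XX = "field_deriv field_X ?X" and ?YY = "field_deriv field_Y ?Y"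
      have i: "integrable M (\<lambda>p. f p * cnj (\<phi> n p))" if "continuous_on UNIV f" for f
      proof -
        have "(\<lambda>p. f p * cnj (\<phi> n p)) \<in> sqint M"
          using test_function_bounded_support[OF \<phi>(1)[of n]]
          by (intro bounded_support_sqint open_\<Omega> continuous_intros that C1fun_continuous test_function_C1[OF \<phi>(1)] bounded_support_mult)
             (simp add: bounded_support_def)
        moreover have "(\<lambda>p. 1) \<in> sqint M" by (rule bdd[of _ 1]) auto
        ultimately show ?thesis using sqint_mult_integrable by fastforce
      qed
      have "sip M ?XX (\<phi> n) + sip M ?YY (\<phi> n) = (LINT p|M. ?XX p * cnj (\<phi> n p) + ?YY p * cnj (\<phi> n p))"
        unfolding sip_def
        by (intro Bochner_Integration.integral_add[symmetric] i field_deriv_continuous shear_field_X shear_field_Y landau_second_derivatives)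
      also have "\<dots> = (LINT p|M. - of_real L * (?U p * cnj (\<phi> n p)))"
        by (intro Bochner_Integration.integral_cong refl)
           (simp only: distrib_right[symmetric] landau_second_derivatives(3) mult.assoc)
      also have "\<dots> = - of_real L * sip M ?U (\<phi> n)" unfolding sip_def by (rule integral_mult_right_zero)
      finally have e: "sip M ?XX (\<phi> n) + sip M ?YY (\<phi> n) = - of_real L * sip M ?U (\<phi> n)" .
      have "sip M ?X (field_deriv field_X (\<phi> n)) + sip M ?Y (field_deriv field_Y (\<phi> n)) =
          - (sip M ?XX (\<phi> n) + sip M ?YY (\<phi> n))" unfolding bp by simp
      also have "\<dots> = of_real L * sip M ?U (\<phi> n)" unfolding e by simp
      finally have "sip M ?X (field_deriv field_X (\<phi> n)) + sip M ?Y (field_deriv field_Y (\<phi> n)) = of_real L * sip M ?U (\<phi> n)" .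
      then have "cnj (sip M ?X (field_deriv field_X (\<phi> n)) + sip M ?Y (field_deriv field_Y (\<phi> n))) = cnj (of_real L * sip M ?U (\<phi> n))"
        by (rule arg_cong)
      then show ?thesis using S \<phi>S[of n] by (simp add: sq.herm[symmetric])
    qed
    moreover have "(\<lambda>n. sip M (field_deriv field_X (\<phi> n)) ?X + sip M (field_deriv field_Y (\<phi> n)) ?Y) \<longlonglongrightarrow> sip M (X v) ?X + sip M (Y v) ?Y"
      by (intro tendsto_add sq.h_tendsto \<phi>S vS S \<phi>)
    moreover have "(\<lambda>n. of_real L * sip M (\<phi> n) ?U) \<longlonglongrightarrow> of_real L * sip M v ?U"
      by (intro tendsto_mult tendsto_const sq.h_tendsto \<phi>S vS S \<phi>)
    ultimately show ?thesis using LIMSEQ_unique by simp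
  qed
  have "sub_form \<Omega> ?U v = of_real L * L2_inner \<Omega> ?U v" if v: "v \<in> S1_0 \<Omega>" for v
  proof -
    have vS1: "v \<in> S1 \<Omega>" by (rule S1_0_sub[OF v])
    note vS = S1_sqint[OF vS1]
    have "sip M (X v) (X ?U) = sip M (X v) ?X" "sip M (Y v) (Y ?U) = sip M (Y v) ?Y"
      using wX wY vS W S by (auto intro!: sip_cong_AE sqint_meas)
    then have "sub_form \<Omega> v ?U = of_real L * L2_inner \<Omega> v ?U"
      using eig[OF v] by (simp add: sub_form_def L2_inner_eq_sip)
    then show ?thesis using a.herm[OF vS1 US] h.herm[OF vS1 US] by simp
  qed
  with US lt show ?thesis by blast
qed

end


section \<open>Comparison of eigenvalues\<close>

context heis_compact begin

text \<open>Indices start at 0, so \<open>l k\<close> is the Dirichlet eigenvalue number k + 1 and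
  \<open>l' (Suc k)\<close> the Neumann eigenvalue number k + 2.\<close>

theorem Neumann_less_Dirichlet:
  assumes fin: "emeasure lebesgue \<Omega> < \<infinity>"
    and e: "D.eigensystem e l" and f: "N.eigensystem f l'"
  shows "l' (Suc k) < l k"
proof (rule ccontr)
  assume "\<not> l' (Suc k) < l k"
  then have le: "l k \<le> l' (Suc k)" by simp
  define \<mu> where "\<mu> = l k"
  have eD [simp]: "e i \<in> S1_0 \<Omega>" and eon: "L2_inner \<Omega> (e i) (e m) = (if i = m then 1 else 0)"
    and einc: "incseq l" and eeig: "\<And>v. v \<in> S1_0 \<Omega> \<Longrightarrow> sub_form \<Omega> (e i) v = of_real (l i) * L2_inner \<Omega> (e i) v" for i m
    using e by (auto simp: D.eigensystem_def)
  have fS [simp]: "f i \<in> S1 \<Omega>" and fon: "L2_inner \<Omega> (f i) (f m) = (if i = m then 1 else 0)"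
    and feig: "\<And>v. v \<in> S1 \<Omega> \<Longrightarrow> sub_form \<Omega> (f i) v = of_real (l' i) * L2_inner \<Omega> (f i) v"
    and fmin: "\<And>v. v \<in> N.orth f i \<Longrightarrow> l' i * h.sq v \<le> a.sq v" for i m
    using f by (auto simp: N.eigensystem_def)
  have eS [simp]: "e i \<in> S1 \<Omega>" for i by (rule S1_0_sub[OF eD])
  have esq: "h.sq (e i) = 1" "a.sq (e i) = l i" for i
    using eeig[of "e i" i] eon[of i i] by (simp_all add: h.sq_def a.sq_def)
  \<comment> \<open>Positivity is used twice: for the Gaussian in U, and at the end, where the
    dilation argument needs a nonzero eigenvalue.\<close>
  have "\<mu> \<noteq> 0"
  proof
    assume "\<mu> = 0"
    then have "sq.sq M (X (e k)) + sq.sq M (Y (e k)) = 0" using esq(2)[of k] by (simp add: a_sq \<mu>_def)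
    moreover have "0 \<le> sq.sq M (X (e k))" "0 \<le> sq.sq M (Y (e k))" using S1_sqint[OF eS] by simp_all
    ultimately have "sq.sq M (X (e k)) = 0" by linarith
    from S1_0_X_null[OF eD this] have "h.sq (e k) = 0" using S1_sqint(1)[OF eS] by (simp add: h_sq sq_eq_0_iff)
    then show False by (simp add: esq)
  qed
  moreover have "\<mu> \<ge> 0" using a.sq_nonneg[OF eS[of k]] by (simp add: esq \<mu>_def)
  ultimately have pos: "\<mu> > 0" by simp
  obtain U where US [simp]: "U \<in> S1 \<Omega>" and Ult: "a.sq U < \<mu> * h.sq U"
    and Ueig: "\<And>v. v \<in> S1_0 \<Omega> \<Longrightarrow> sub_form \<Omega> U v = of_real \<mu> * L2_inner \<Omega> U v"
    using landau_trial_function[OF fin nonempty pos] by blast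
  define j where "j = Suc k"
  \<comment> \<open>These are j + 1 trial vectors against j orthogonality conditions. Only the
    coefficient vector c is known to be nonzero; independence of U from the e i is not established
    beforehand, and the contradiction will be that all coefficients vanish.\<close>
  define b where "b = (\<lambda>i. if i < j then e i else U)"
  have bS [simp]: "b i \<in> S1 \<Omega>" for i by (simp add: b_def)
  obtain c where c: "\<exists>i<Suc j. c i \<noteq> 0" "\<And>m. m < j \<Longrightarrow> (\<Sum>i<Suc j. L2_inner \<Omega> (b i) (f m) * c i) = 0"
    using homogeneous_system_nontrivial[of j "Suc j" "\<lambda>m i. L2_inner \<Omega> (b i) (f m)"] by auto
  define u where "u = (\<Sum>i<j. fscale (c i) (e i))"
  define w where "w = u + fscale (c j) U"
  have uD: "u \<in> S1_0 \<Omega>" unfolding u_def by (intro D.h.sum_mem D.h.sc_mem eD)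
  have uS [simp]: "u \<in> S1 \<Omega>" by (rule S1_0_sub[OF uD])
  have wS [simp]: "w \<in> S1 \<Omega>" by (simp add: w_def)
  have hu: "L2_inner \<Omega> u v = (\<Sum>i<j. c i * L2_inner \<Omega> (e i) v)" if "v \<in> S1 \<Omega>" for v
    unfolding u_def using that by (simp add: h.sum_left h.sc_left)
  have w_orth: "w \<in> N.orth f j"
  proof -
    have "L2_inner \<Omega> w (f m) = 0" if "m < j" for m
    proof -
      have "L2_inner \<Omega> w (f m) = (\<Sum>i<Suc j. L2_inner \<Omega> (b i) (f m) * c i)"
        by (simp add: w_def h.add_left h.sc_left hu b_def mult.commute)
      then show ?thesis using c(2)[OF that] by simp
    qed
    then show ?thesis by (simp add: N.orth_def)
  qed
  have hue: "L2_inner \<Omega> u (e m) = c m" if "m < j" for m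
  proof -
    have "L2_inner \<Omega> u (e m) = (\<Sum>i<j. if i = m then c m else 0)"
      unfolding hu[OF eS] by (intro sum.cong refl) (simp add: eon)
    then show ?thesis using that by simp
  qed
  have heu: "L2_inner \<Omega> (e m) u = cnj (c m)" if "m < j" for m
    using hue[OF that] h.herm[OF uS eS[of m]] by simp
  have "L2_inner \<Omega> u u = of_real (\<Sum>i<j. (cmod (c i))\<^sup>2)"
    unfolding hu[OF uS] of_real_sum complex_norm_square by (intro sum.cong refl) (simp add: heu)
  then have hsq: "h.sq u = (\<Sum>i<j. (cmod (c i))\<^sup>2)" by (simp only: h.sq_def Re_complex_of_real)
  have "sub_form \<Omega> u u = (\<Sum>i<j. c i * sub_form \<Omega> (e i) u)"
    by (subst (1) u_def) (simp add: a.sum_left a.sc_left)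
  also have "\<dots> = of_real (\<Sum>i<j. l i * (cmod (c i))\<^sup>2)"
    unfolding of_real_sum of_real_mult complex_norm_square
    by (intro sum.cong refl) (simp add: heu eeig[OF uD])
  finally have "a.sq u = (\<Sum>i<j. l i * (cmod (c i))\<^sup>2)" by (simp only: a.sq_def Re_complex_of_real)
  also have "\<dots> \<le> (\<Sum>i<j. \<mu> * (cmod (c i))\<^sup>2)"
    using einc by (intro sum_mono mult_right_mono) (auto simp: incseq_def \<mu>_def j_def)
  finally have asq: "a.sq u \<le> \<mu> * h.sq u" by (simp add: hsq sum_distrib_left)
  \<comment> \<open>Since u lies in \<open>S1_0 \<Omega>\<close>, the equation for U applies to it,
    and the mixed terms of the two forms match with the factor \<mu>.\<close>
  have cross: "Re (sub_form \<Omega> u (fscale (c j) U)) = \<mu> * Re (L2_inner \<Omega> u (fscale (c j) U))"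
    using Ueig[OF uD] a.herm[OF US uS] h.herm[OF US uS] by (simp add: a.sc_right h.sc_right algebra_simps)
  \<comment> \<open>The strict deficit of U enters with weight |c j|^2; the lower bound
    \<open>min\<close> on \<open>orth f j\<close> then leaves no room for U in w.\<close>
  have upper: "a.sq w \<le> \<mu> * h.sq w - (cmod (c j))\<^sup>2 * (\<mu> * h.sq U - a.sq U)"
    using asq cross by (simp add: w_def a.sq_add h.sq_add a.sq_sc h.sq_sc algebra_simps)
  have min: "\<mu> * h.sq v \<le> a.sq v" if v: "v \<in> N.orth f j" for v
  proof -
    have "0 \<le> h.sq v" using v by (simp add: N.orth_def)
    then have "\<mu> * h.sq v \<le> l' j * h.sq v" using le by (intro mult_right_mono) (simp_all add: \<mu>_def j_def)
    with fmin[OF v] show ?thesis by linarith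
  qed
  have "(cmod (c j))\<^sup>2 * (\<mu> * h.sq U - a.sq U) \<le> 0" using upper min[OF w_orth] by linarith
  then have cj: "c j = 0" using Ult by (simp add: mult_le_0_iff)
  then have wu: "w = u" by (simp add: w_def fscale_def fun_eq_iff)
  have eq: "a.sq w = \<mu> * h.sq w" using upper min[OF w_orth] cj by simp
  \<comment> \<open>The constant is \<mu> rather than \<open>l' j\<close>: by \<open>min\<close> it
    is a lower bound for the Rayleigh quotient on \<open>orth f j\<close>, and w gives
    equality.\<close>
  have "sub_form \<Omega> w v = of_real \<mu> * L2_inner \<Omega> w v" if "v \<in> S1 \<Omega>" for v
    by (rule N.critical_eq[of j f l']) (use fon feig min w_orth eq that in auto)
  then have "AE p in M. u p = 0"
    using S1_0_Neumann_eigenfunction_null[OF fin uD, of \<mu>] pos by (simp add: wu)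
  then have "h.sq u = 0" using S1_sqint(1)[OF uS] by (simp add: h_sq sq_eq_0_iff)
  then have "c i = 0" if "i < j" for i using hue[OF that] h.null_left[OF uS eS] by simp
  then show False using c(1) cj by (auto simp: less_Suc_eq)
qed

end

theorem theorem1p1:
  fixes \<Omega> :: "heis set" and j :: nat
  assumes "domain \<Omega>"
    and "emeasure lebesgue \<Omega> < \<infinity>"
    and "compact_embedding_S1_L2 \<Omega>"
    and "j \<ge> 1"
  shows "nth_eigenvalue \<Omega> (neumann_sublaplacian \<Omega>) (j + 1)
           < nth_eigenvalue \<Omega> (dirichlet_sublaplacian \<Omega>) j"
proof -
  interpret heis_compact \<Omega>
    by unfold_locales (use assms in \<open>auto simp: domain_def\<close>)
  obtain f l' where f: "N.eigensystem f l'" using N.eigensystem_exists by blast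
  obtain e l where e: "D.eigensystem e l" using D.eigensystem_exists by blast
  have "S1 \<Omega> \<subseteq> L2 \<Omega>" "S1_0 \<Omega> \<subseteq> L2 \<Omega>" using S1_sqint(1) S1_0_sub by (auto simp: L2_eq_sqint)
  then have "eigenvalue_enumeration \<Omega> (neumann_sublaplacian \<Omega>) l'"
      "eigenvalue_enumeration \<Omega> (dirichlet_sublaplacian \<Omega>) l"
    unfolding neumann_sublaplacian_def dirichlet_sublaplacian_def
    using eigenvalue_enumeration_form_operator[OF N.compact_form_axioms _ f]
      eigenvalue_enumeration_form_operator[OF D.compact_form_axioms _ e] by blast+
  \<comment> \<open>Position j in the list is index j - 1, and for j at least 1 the index
    \<open>Suc (j - 1)\<close> of the Neumann list is its position j + 1.\<close>
  then show ?thesis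
    using Neumann_less_Dirichlet[OF assms(2) e f, of "j - 1"] assms(4) by (simp add: nth_eigenvalue_eq)
qed

end
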